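(* Let $\mathcal{T}=(S,(\mathcal{B}_i,T_i,\beta_i)_{i\in I})$ be a Souslin and non-redundant $(S,(\mathcal{B}_i)_{i\in I})$-based type structure. If $\mathcal{T}$ is terminal, then $\mathcal{T}$ is complete.
   Context: All topological spaces are metrizable; products carry the product topology, subsets the subspace topology, $\Sigma_X$ is the Borel $\sigma$-algebra, $\Delta(X)$ is the space of Borel probability measures with the weak convergence topology. For a family $\mathcal{B}\subseteq\Sigma_X$ of non-empty Borel sets, a CPS on $(X,\Sigma_X,\mathcal{B})$ is an array $\mu=(\mu(\cdot|B))_{B\in\mathcal{B}}\in\Delta(X)^{\mathcal{B}}$ with $\mu(B|B)=1$ for all $B$ and $\mu(A|B)\mu(B|C)=\mu(A|C)$ whenever $A\in\Sigma_X$, $B,C\in\mathcal{B}$, $A\subseteq B\subseteq C$; $\Delta^{\mathcal{B}}(X)$ is the set of CPSs with the subspace topology of the product topology on $\Delta(X)^{\mathcal{B}}$. Convention: for $X\times Y$ and $\mathcal{B}\subseteq\Sigma_X$, $\Delta^{\mathcal{B}}(X\times Y)$ denotes CPSs w.r.t. $\{B\times Y:B\in\mathcal{B}\}$. For measurable $f:X\to Y$ with $\mathcal{B}_X=\{f^{-1}(B):B\in\mathcal{B}_Y\}$, $\overline{\mathcal{L}}_f(\mu)(E|B):=\mu(f^{-1}(E)|f^{-1}(B))$. A Souslin space is a continuous image of a complete separable metric space. Setting: $I=\{i,j\}$ two players; $S$ a metrizable Souslin space; $\mathcal{B}_i\subseteq\Sigma_S$ countable families of non-empty Borel sets. An $(S,(\mathcal{B}_i)_{i\in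 I})$-based type structure is $\mathcal{T}=(S,(\mathcal{B}_i,T_i,\beta_i)_{i\in I})$ with each $T_i$ metrizable and each $\beta_i:T_i\to\Delta^{\mathcal{B}_i}(S\times T_j)$ Borel measurable. $\mathcal{T}$ is Souslin if every $T_i$ is Souslin; complete if every $\beta_i$ is surjective. Canonical hierarchies: $\Theta_i^0:=S$, $H_i^1:=\Delta^{\mathcal{B}_i}(S)$; for $n\ge1$, $\Theta_i^n:=S\times H_j^n$, $\rho_i^{n-1,n}:\Theta_i^n\to\Theta_i^{n-1}$ the coordinate projection dropping the last belief (projection onto $S$ if $n=1$), $H_i^{n+1}:=\{((\mu_i^1,\dots,\mu_i^n),\mu_i^{n+1})\in H_i^n\times\Delta^{\mathcal{B}_i}(\Theta_i^n):\overline{\mathcal{L}}_{\rho_i^{n-1,n}}(\mu_i^{n+1})=\mu_i^n\}$; $H_i:=\{(\mu_i^1,\mu_i^2,\dots)\in\prod_{n\ge0}\Delta^{\mathcal{B}_i}(\Theta_i^n):\forall n\ge1,(\mu_i^1,\dots,\mu_i^n)\in H_i^n\}$. Hierarchy maps: $h_{-i}^0:S\times T_j\to S$ the projection; $h_i^1(t_i):=\overline{\mathcal{L}}_{h_{-i}^0}(\beta_i(t_i))$; for $n\ge1$, $h_{-i}^n:=(\mathrm{Id}_S,h_j^n)$, $h_i^{n+1}(t_i):=(h_i^n(t_i),\overline{\mathcal{L}}_{h_{-i}^n}(\beta_i(t_i)))$; $h_i(t_i):=(\overline{\mathcal{L}}_{h_{-i}^n}(\beta_i(t_i)))_{n\ge0}\in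 H_i$; for another structure $\mathcal{T}^*$ these are $h_i^*$. $\mathcal{T}$ is non-redundant if each $h_i:T_i\to H_i$ is injective. $\mathcal{T}$ is terminal if for every $(S,(\mathcal{B}_i)_{i\in I})$-based type structure $\mathcal{T}^*=(S,(\mathcal{B}_i,T_i^*,\beta_i^* )_{i\in I})$, every $i$ and every $t_i^*\in T_i^*$ there is $t_i\in T_i$ with $h_i^*(t_i^* )=h_i(t_i)$. *)

theory Defs
  imports "HOL-Probability.Probability"
begin

datatype player = Player_i | Player_j

fun other :: "player \<Rightarrow> player" where
  "other Player_i = Player_j"
| "other Player_j = Player_i"

definition borel_of :: "'x topology \<Rightarrow> 'x measure" where
  "borel_of X = sigma (topspace X) {U. openin X U}"

text \<open>Souslin space: continuous image of a complete separable metric space.  Every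
  separable metric space has cardinality at most that of the continuum, so it suffices to
  let the domain range over metric spaces whose carrier is a subset of the reals.\<close>
definition souslin_space :: "'x topology \<Rightarrow> bool" where
  "souslin_space X \<longleftrightarrow>
     (\<exists>(m::real metric) f. mcomplete_of m \<and> separable_space (mtopology_of m) \<and>
        continuous_map (mtopology_of m) X f \<and> f ` mspace m = topspace X)"

definition prob_measures :: "'x topology \<Rightarrow> 'x measure set" where
  "prob_measures X = {M. sets M = sets (borel_of X) \<and> prob_space M}"

definition bcont :: "'x topology \<Rightarrow> ('x \<Rightarrow> real) set" where
  "bcont X = {f. continuous_map X euclideanreal f \<and> bounded (f ` topspace X)}"

text \<open>Topology of weak convergence on Delta(X): the coarsest topology making all maps
  mu |-> integral f d mu (f bounded continuous) continuous.\<close>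
definition weak_topology :: "'x topology \<Rightarrow> 'x measure topology" where
  "weak_topology X =
     pullback_topology (prob_measures X) (\<lambda>M. restrict (\<lambda>f. integral\<^sup>L M f) (bcont X))
       (product_topology (\<lambda>_. euclideanreal) (bcont X))"

text \<open>CPSs on X with respect to the conditioning family {c B | B in Bs}, indexed by B in Bs.
  For X itself (based on S) c is the identity; for a product S x Y, c B = B x Y.\<close>
definition cps_set :: "'x topology \<Rightarrow> 'b set set \<Rightarrow> ('b set \<Rightarrow> 'x set) \<Rightarrow> ('b set \<Rightarrow> 'x measure) set" where
  "cps_set X Bs c =
     {\<mu> \<in> Pi\<^sub>E Bs (\<lambda>_. prob_measures X).
        (\<forall>B\<in>Bs. measure (\<mu> B) (c B) = 1) \<and>
        (\<forall>A B C. A \<in> sets (borel_of X) \<longrightarrow> B \<in> Bs \<longrightarrow> C \<in> Bs \<longrightarrow> A \<subseteq> c B \<longrightarrow> c B \<subseteq> c C \<longrightarrow>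
           measure (\<mu> B) A * measure (\<mu> C) (c B) = measure (\<mu> C) A)}"

definition cps_top :: "'x topology \<Rightarrow> 'b set set \<Rightarrow> ('b set \<Rightarrow> 'x set) \<Rightarrow> ('b set \<Rightarrow> 'x measure) topology" where
  "cps_top X Bs c = subtopology (product_topology (\<lambda>_. weak_topology X) Bs) (cps_set X Bs c)"

definition cps_image :: "'b set set \<Rightarrow> 'y measure \<Rightarrow> ('x \<Rightarrow> 'y) \<Rightarrow> ('b set \<Rightarrow> 'x measure) \<Rightarrow> ('b set \<Rightarrow> 'y measure)" where
  "cps_image Bs N f \<mu> = (\<lambda>B\<in>Bs. distr (\<mu> B) N f)"

text \<open>Finite hierarchies of different lengths have different HOL types; each level H^n is
  therefore represented through an injective coding into the reals (a fixed injection chosen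
  by Hilbert choice), with the topology transported along the coding.\<close>
definition enc :: "'x set \<Rightarrow> 'x \<Rightarrow> real" where
  "enc A = (SOME e. inj_on e A)"

definition dec :: "'x set \<Rightarrow> real \<Rightarrow> 'x" where
  "dec A = the_inv_into A (enc A)"

definition transport :: "'x topology \<Rightarrow> real topology" where
  "transport X = pullback_topology (enc (topspace X) ` topspace X) (dec (topspace X)) X"

definition H1obj :: "'a topology \<Rightarrow> (player \<Rightarrow> 'a set set) \<Rightarrow> player \<Rightarrow> ('a set \<Rightarrow> 'a measure) topology" where
  "H1obj S Bs p = cps_top S (Bs p) (\<lambda>B. B)"

text \<open>HObj S Bs k p is H^{k+2}_p, whose elements are pairs (code of a prefix in H^{k+1}_p, mu^{k+2})
  with mu^{k+2} a CPS on Theta^{k+1}_p = S x H^{k+1}_{-p}, satisfying the coherence condition.\<close>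
fun HObj :: "'a topology \<Rightarrow> (player \<Rightarrow> 'a set set) \<Rightarrow> nat \<Rightarrow> player \<Rightarrow>
              (real \<times> ('a set \<Rightarrow> ('a \<times> real) measure)) topology" where
  "HObj S Bs 0 p =
     subtopology
       (prod_topology (transport (H1obj S Bs p))
          (cps_top (prod_topology S (transport (H1obj S Bs (other p)))) (Bs p)
             (\<lambda>B. B \<times> topspace (transport (H1obj S Bs (other p))))))
       {(c, \<nu>). cps_image (Bs p) (borel_of S) fst \<nu> = dec (topspace (H1obj S Bs p)) c}"
| "HObj S Bs (Suc k) p =
     subtopology
       (prod_topology (transport (HObj S Bs k p))
          (cps_top (prod_topology S (transport (HObj S Bs k (other p)))) (Bs p)
             (\<lambda>B. B \<times> topspace (transport (HObj S Bs k (other p))))))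
       {(c, \<nu>). cps_image (Bs p)
                   (borel_of (prod_topology S
                      (case k of 0 \<Rightarrow> transport (H1obj S Bs (other p))
                               | Suc k' \<Rightarrow> transport (HObj S Bs k' (other p)))))
                   (\<lambda>(s, h). (s, fst (dec (topspace (HObj S Bs k (other p))) h))) \<nu>
               = snd (dec (topspace (HObj S Bs k p)) c)}"

text \<open>Hc S Bs n p: the (coded) space H^{n+1}_p.\<close>
definition Hc :: "'a topology \<Rightarrow> (player \<Rightarrow> 'a set set) \<Rightarrow> nat \<Rightarrow> player \<Rightarrow> real topology" where
  "Hc S Bs n p = (case n of 0 \<Rightarrow> transport (H1obj S Bs p) | Suc k \<Rightarrow> transport (HObj S Bs k p))"

definition type_structure ::
  "'a topology \<Rightarrow> (player \<Rightarrow> 'a set set) \<Rightarrow> (player \<Rightarrow> 't topology) \<Rightarrow>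
   (player \<Rightarrow> 't \<Rightarrow> 'a set \<Rightarrow> ('a \<times> 't) measure) \<Rightarrow> bool" where
  "type_structure S Bs T \<beta> \<longleftrightarrow>
     (\<forall>p. metrizable_space (T p) \<and>
          \<beta> p \<in> borel_of (T p) \<rightarrow>\<^sub>M
                 borel_of (cps_top (prod_topology S (T (other p))) (Bs p) (\<lambda>B. B \<times> topspace (T (other p)))))"

definition souslin_structure :: "(player \<Rightarrow> 't topology) \<Rightarrow> bool" where
  "souslin_structure T \<longleftrightarrow> (\<forall>p. souslin_space (T p))"

definition complete_structure ::
  "'a topology \<Rightarrow> (player \<Rightarrow> 'a set set) \<Rightarrow> (player \<Rightarrow> 't topology) \<Rightarrow>
   (player \<Rightarrow> 't \<Rightarrow> 'a set \<Rightarrow> ('a \<times> 't) measure) \<Rightarrow> bool" where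
  "complete_structure S Bs T \<beta> \<longleftrightarrow>
     (\<forall>p. \<beta> p ` topspace (T p) = cps_set (prod_topology S (T (other p))) (Bs p) (\<lambda>B. B \<times> topspace (T (other p))))"

text \<open>Coded hierarchy maps: hcode S Bs \<beta> n p t is the code of h^{n+1}_p(t) in Hc S Bs n p.\<close>
primrec hcode :: "'a topology \<Rightarrow> (player \<Rightarrow> 'a set set) \<Rightarrow>
   (player \<Rightarrow> 't \<Rightarrow> 'a set \<Rightarrow> ('a \<times> 't) measure) \<Rightarrow> nat \<Rightarrow> player \<Rightarrow> 't \<Rightarrow> real" where
  "hcode S Bs \<beta> 0 p t = enc (topspace (H1obj S Bs p)) (cps_image (Bs p) (borel_of S) fst (\<beta> p t))"
| "hcode S Bs \<beta> (Suc k) p t =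
     enc (topspace (HObj S Bs k p))
       (hcode S Bs \<beta> k p t,
        cps_image (Bs p) (borel_of (prod_topology S (Hc S Bs k (other p))))
          (\<lambda>(s, t'). (s, hcode S Bs \<beta> k (other p) t')) (\<beta> p t))"

text \<open>The hierarchy map h_p(t) = (L_{h^n_{-p}}(beta_p(t)))_{n>=0}: the first component is the
  n = 0 entry (a CPS on S), the second component at index n is the entry n+1 (a CPS on
  Theta^{n+1}_p = S x H^{n+1}_{-p}).\<close>
definition hier :: "'a topology \<Rightarrow> (player \<Rightarrow> 'a set set) \<Rightarrow>
   (player \<Rightarrow> 't \<Rightarrow> 'a set \<Rightarrow> ('a \<times> 't) measure) \<Rightarrow> player \<Rightarrow> 't \<Rightarrow>
   ('a set \<Rightarrow> 'a measure) \<times> (nat \<Rightarrow> 'a set \<Rightarrow> ('a \<times> real) measure)" where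
  "hier S Bs \<beta> p t =
     (cps_image (Bs p) (borel_of S) fst (\<beta> p t),
      \<lambda>n. cps_image (Bs p) (borel_of (prod_topology S (Hc S Bs n (other p))))
             (\<lambda>(s, t'). (s, hcode S Bs \<beta> n (other p) t')) (\<beta> p t))"

definition non_redundant ::
  "'a topology \<Rightarrow> (player \<Rightarrow> 'a set set) \<Rightarrow> (player \<Rightarrow> 't topology) \<Rightarrow>
   (player \<Rightarrow> 't \<Rightarrow> 'a set \<Rightarrow> ('a \<times> 't) measure) \<Rightarrow> bool" where
  "non_redundant S Bs T \<beta> \<longleftrightarrow> (\<forall>p. inj_on (hier S Bs \<beta> p) (topspace (T p)))"

definition terminal ::
  "'a topology \<Rightarrow> (player \<Rightarrow> 'a set set) \<Rightarrow> (player \<Rightarrow> 't topology) \<Rightarrow>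
   (player \<Rightarrow> 't \<Rightarrow> 'a set \<Rightarrow> ('a \<times> 't) measure) \<Rightarrow> bool" where
  "terminal S Bs T \<beta> \<longleftrightarrow>
     (\<forall>(T' :: player \<Rightarrow> 't option topology) \<beta>'. type_structure S Bs T' \<beta>' \<longrightarrow>
        (\<forall>p. \<forall>t'\<in>topspace (T' p). \<exists>t\<in>topspace (T p). hier S Bs \<beta>' p t' = hier S Bs \<beta> p t))"

end

theory Submission
  imports Defs
begin

text \<open>Given a belief \<open>\<mu>\<close> of player \<open>i\<close>, add to \<open>T i\<close> one isolated type \<open>None\<close> holding \<open>\<mu>\<close>; the
  hierarchies of the old types do not change.  Terminality gives a type \<open>t\<close> of \<open>T i\<close> with the same
  hierarchy as \<open>None\<close>, so \<open>\<beta> i t\<close> and \<open>\<mu>\<close> agree on all events that are measurable with respect to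
  some finite-order hierarchy of the opponent.  By non-redundancy countably many of these events
  separate the points of the Souslin space \<open>S \<times> T j\<close>, hence generate its Borel sets by Blackwell's
  theorem, and \<open>\<beta> i t = \<mu>\<close>.  All spaces in the hierarchy are separable and metrizable (used in the form
  second countable, Hausdorff and completely regular), which makes the hierarchy maps Borel.\<close>

subsection \<open>Borel sets of second countable spaces\<close>


text \<open>The obstacle is that hierarchies only test events pulled back along the maps
  \<open>hmap\<close>, while \<open>\<beta> i t = \<mu>\<close> requires equality on every Borel set
  of \<open>S \<times> T j\<close>. Injectivity of the hierarchy map alone makes the pulled-back
  events separate points, not generate; analyticity of \<open>S \<times> T j\<close> closes this
  gap. The two hypotheses act on different players: terminality on the one whose belief is
  prescribed, non-redundancy on the opponent. The new type goes to one player only. Since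
  \<open>\<mu>\<close> lives on \<open>S \<times> T j\<close>, the opponent's types are merely
  copied into the option type and no belief charges \<open>None\<close>, so computing the new
  hierarchy involves no circularity. The levels are coded by real numbers, so a level can be used
  only once \<open>enc\<close> is known to be injective on it and the coded tuple is known to lie in
  it. Measurability of the hierarchy maps and coherence of their values therefore go through one
  joint induction. Push-forward along a Borel map need not be weakly continuous, so the levels are
  only Borel in the type.\<close>

lemma space_borel_of [simp]: "space (borel_of X) = topspace X"
  unfolding borel_of_def by (rule space_measure_of) (auto dest: openin_subset)

lemma sets_borel_of: "sets (borel_of X) = sigma_sets (topspace X) {U. openin X U}"
  unfolding borel_of_def by (rule sets_measure_of) (auto dest: openin_subset)

lemma openin_borel_of: "openin X U \<Longrightarrow> U \<in> sets (borel_of X)"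
  by (simp add: sets_borel_of sigma_sets.Basic)

lemma measurable_borel_ofI:
  assumes "f \<in> space M \<rightarrow> topspace Y"
    and "\<And>U. openin Y U \<Longrightarrow> f -` U \<inter> space M \<in> sets M"
  shows "f \<in> M \<rightarrow>\<^sub>M borel_of Y"
  unfolding borel_of_def
  by (rule measurable_measure_of) (use assms in \<open>auto dest: openin_subset\<close>)

lemma continuous_map_measurable:
  assumes "continuous_map X Y f"
  shows "f \<in> borel_of X \<rightarrow>\<^sub>M borel_of Y"
proof (rule measurable_borel_ofI)
  show "f \<in> space (borel_of X) \<rightarrow> topspace Y"
    using assms by (simp add: continuous_map_def Pi_iff)
  fix U assume "openin Y U"
  then have "openin X {x \<in> topspace X. f x \<in> U}"
    using assms by (simp add: continuous_map_def)
  moreover have "{x \<in> topspace X. f x \<in> U} = f -` U \<inter> topspace X" by auto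
  ultimately show "f -` U \<inter> space (borel_of X) \<in> sets (borel_of X)"
    by (simp add: openin_borel_of)
qed

section \<open>Countable subbases\<close>

definition countable_subbase :: "'x topology \<Rightarrow> 'x set set \<Rightarrow> bool" where
  "countable_subbase X \<S> \<longleftrightarrow> countable \<S> \<and> (\<forall>V\<in>\<S>. openin X V) \<and>
     (\<forall>U x. openin X U \<longrightarrow> x \<in> U \<longrightarrow> (\<exists>F. finite F \<and> F \<subseteq> \<S> \<and> x \<in> \<Inter>F \<and> topspace X \<inter> \<Inter>F \<subseteq> U))"

lemma countable_subbase_inter:
  assumes "countable_subbase X \<S>"
  shows "countable ((\<lambda>F. topspace X \<inter> \<Inter>F) ` {F. finite F \<and> F \<subseteq> \<S>})"
    and "F \<subseteq> \<S> \<Longrightarrow> finite F \<Longrightarrow> openin X (topspace X \<inter> \<Inter>F)"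
proof -
  show "countable ((\<lambda>F. topspace X \<inter> \<Inter>F) ` {F. finite F \<and> F \<subseteq> \<S>})"
    using assms by (intro countable_image countable_Collect_finite_subset) (simp add: countable_subbase_def)
  show "openin X (topspace X \<inter> \<Inter>F)" if "F \<subseteq> \<S>" "finite F"
  \<comment> \<open>\<open>\<Inter>{}\<close> is \<open>UNIV\<close>; intersecting with
    \<open>topspace X\<close> lets the empty family stand for the whole space.\<close>
  proof (cases "F = {}")
    case False
    then have "openin X (\<Inter>F)"
      using assms that by (intro openin_Inter) (auto simp: countable_subbase_def)
    then show ?thesis by (simp add: openin_Int)
  qed simp
qed

lemma countable_subbase_imp_second_countable:
  assumes "countable_subbase X \<S>"
  shows "second_countable X"
  unfolding second_countable_def
proof (intro exI conjI allI impI ballI)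
  let ?B = "(\<lambda>F. topspace X \<inter> \<Inter>F) ` {F. finite F \<and> F \<subseteq> \<S>}"
  show "countable ?B" by (rule countable_subbase_inter[OF assms])
  show "openin X V" if "V \<in> ?B" for V
    using that countable_subbase_inter(2)[OF assms] by auto
  fix U x assume U: "openin X U \<and> x \<in> U"
  then obtain F where "finite F" "F \<subseteq> \<S>" "x \<in> \<Inter>F" "topspace X \<inter> \<Inter>F \<subseteq> U"
    using assms unfolding countable_subbase_def by blast
  moreover have "x \<in> topspace X" using U openin_subset by blast
  ultimately show "\<exists>V\<in>?B. x \<in> V \<and> V \<subseteq> U"
    by (intro bexI[of _ "topspace X \<inter> \<Inter>F"]) auto
qed

text \<open>Countability of the subbase makes every open set a countable union of finite
  intersections, so a sigma-algebra that contains the subbasic preimages contains all open ones.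
  Measurability into products and spaces of measures rests on this.\<close>

lemma measurable_countable_subbase:
  assumes sb: "countable_subbase Y \<S>"
    and f: "f \<in> space M \<rightarrow> topspace Y"
    and meas: "\<And>V. V \<in> \<S> \<Longrightarrow> f -` V \<inter> space M \<in> sets M"
  shows "f \<in> M \<rightarrow>\<^sub>M borel_of Y"
proof (rule measurable_borel_ofI)
  fix U assume U: "openin Y U"
  define \<F> where "\<F> = {F. finite F \<and> F \<subseteq> \<S> \<and> topspace Y \<inter> \<Inter>F \<subseteq> U}"
  have "countable \<F>"
    unfolding \<F>_def using sb
    by (intro countable_subset[OF _ countable_Collect_finite_subset[of \<S>]]) (auto simp: countable_subbase_def)
  moreover have "f -` (topspace Y \<inter> \<Inter>F) \<inter> space M \<in> sets M" if "F \<in> \<F>" for F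
  proof -
    have "f -` (topspace Y \<inter> \<Inter>F) \<inter> space M = (\<Inter>V\<in>F. f -` V \<inter> space M) \<inter> space M"
      using f by auto
    also have "\<dots> \<in> sets M"
    proof (cases "F = {}")
      case False
      then have "(\<Inter>V\<in>F. f -` V \<inter> space M) \<in> sets M"
        using that meas by (intro sets.finite_INT) (auto simp: \<F>_def)
      then show ?thesis by auto
    qed simp
    finally show ?thesis .
  qed
  moreover have "f -` U \<inter> space M = (\<Union>F\<in>\<F>. f -` (topspace Y \<inter> \<Inter>F) \<inter> space M)"
  proof (intro equalityI subsetI)
    fix x assume x: "x \<in> f -` U \<inter> space M"
    then obtain F where "finite F" "F \<subseteq> \<S>" "f x \<in> \<Inter>F" "topspace Y \<inter> \<Inter>F \<subseteq> U"
      using sb U unfolding countable_subbase_def by blast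
    then have "F \<in> \<F>" "f x \<in> topspace Y \<inter> \<Inter>F" using x f by (auto simp: \<F>_def)
    then show "x \<in> (\<Union>F\<in>\<F>. f -` (topspace Y \<inter> \<Inter>F) \<inter> space M)" using x by blast
  qed (auto simp: \<F>_def)
  ultimately show "f -` U \<inter> space M \<in> sets M" by (metis (no_types, lifting) sets.countable_UN'')
qed (fact f)

lemma second_countable_imp_countable_subbase:
  assumes "second_countable X"
  obtains \<B> where "countable_subbase X \<B>"
proof -
  obtain \<B> where "countable \<B>" "\<forall>V\<in>\<B>. openin X V"
    and *: "\<forall>U x. openin X U \<and> x \<in> U \<longrightarrow> (\<exists>V\<in>\<B>. x \<in> V \<and> V \<subseteq> U)"
    using assms unfolding second_countable_def by blast
  moreover have "\<exists>F. finite F \<and> F \<subseteq> \<B> \<and> x \<in> \<Inter>F \<and> topspace X \<inter> \<Inter>F \<subseteq> U" if "openin X U" "x \<in> U" for U x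
  proof -
    obtain V where "V \<in> \<B>" "x \<in> V" "V \<subseteq> U" using * \<open>openin X U\<close> \<open>x \<in> U\<close> by blast
    then show ?thesis by (intro exI[of _ "{V}"]) auto
  qed
  ultimately have "countable_subbase X \<B>" unfolding countable_subbase_def by simp
  then show ?thesis by (rule that)
qed

lemma countable_subbase_prod_topology:
  assumes "countable_subbase X \<A>" "countable_subbase Y \<B>"
  shows "countable_subbase (prod_topology X Y)
    ((\<lambda>U. U \<times> topspace Y) ` \<A> \<union> (\<lambda>V. topspace X \<times> V) ` \<B>)" (is "countable_subbase _ ?S")
proof -
  have "\<exists>F. finite F \<and> F \<subseteq> ?S \<and> z \<in> \<Inter>F \<and> topspace (prod_topology X Y) \<inter> \<Inter>F \<subseteq> W"
    if W: "openin (prod_topology X Y) W" "z \<in> W" for W z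
  proof -
    obtain x y where z: "z = (x, y)" by fastforce
    with W(2) obtain U V where UV: "openin X U" "openin Y V" "x \<in> U" "y \<in> V" "U \<times> V \<subseteq> W"
      using W(1)[unfolded openin_prod_topology_alt, rule_format, of x y] by blast
    obtain F where F: "finite F" "F \<subseteq> \<A>" "x \<in> \<Inter>F" "topspace X \<inter> \<Inter>F \<subseteq> U"
      using assms(1) UV unfolding countable_subbase_def by blast
    obtain G where G: "finite G" "G \<subseteq> \<B>" "y \<in> \<Inter>G" "topspace Y \<inter> \<Inter>G \<subseteq> V"
      using assms(2) UV unfolding countable_subbase_def by blast
    have xy: "x \<in> topspace X" "y \<in> topspace Y" using UV openin_subset by blast+
    let ?F = "(\<lambda>U. U \<times> topspace Y) ` F \<union> (\<lambda>V. topspace X \<times> V) ` G"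
    have "topspace (prod_topology X Y) \<inter> \<Inter>?F \<subseteq> U \<times> V"
    proof clarify
      fix a b assume ab: "(a, b) \<in> topspace (prod_topology X Y)" "(a, b) \<in> \<Inter>?F"
      have "a \<in> \<Inter>F" "b \<in> \<Inter>G" using ab(2) by blast+
      then show "a \<in> U \<and> b \<in> V" using F(4) G(4) ab(1) by auto
    qed
    moreover have "finite ?F" "?F \<subseteq> ?S" using F G by auto
    moreover have "z \<in> \<Inter>?F" using F(3) G(3) xy z by auto
    moreover have "topspace (prod_topology X Y) \<inter> \<Inter>?F \<subseteq> W"
      using calculation(1) UV(5) by (rule order_trans)
    ultimately show ?thesis by (intro exI[of _ ?F] conjI)
  qed
  moreover have "countable ?S" "\<forall>V\<in>?S. openin (prod_topology X Y) V"
    using assms unfolding countable_subbase_def by (auto simp: openin_prod_Times_iff)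
  ultimately show ?thesis unfolding countable_subbase_def by simp
qed

lemma countable_subbase_product_topology:
  assumes "countable I" "\<And>i. i \<in> I \<Longrightarrow> countable_subbase (X i) (\<S> i)"
  shows "countable_subbase (product_topology X I)
    (\<Union>i\<in>I. (\<lambda>V. {x \<in> topspace (product_topology X I). x i \<in> V}) ` \<S> i)" (is "countable_subbase ?P ?S")
proof -
  have op: "openin ?P {x \<in> topspace ?P. x i \<in> V}" if "i \<in> I" "V \<in> \<S> i" for i V
    using that assms
    by (intro openin_continuous_map_preimage[where Y = "X i"] continuous_map_product_projection)
       (auto simp: countable_subbase_def)
  have "\<exists>F. finite F \<and> F \<subseteq> ?S \<and> z \<in> \<Inter>F \<and> topspace ?P \<inter> \<Inter>F \<subseteq> W"
    if W: "openin ?P W" "z \<in> W" for W z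
  proof -
    obtain U where U: "finite {i \<in> I. U i \<noteq> topspace (X i)}" "\<forall>i\<in>I. openin (X i) (U i)"
      "z \<in> Pi\<^sub>E I U" "Pi\<^sub>E I U \<subseteq> W"
      using W unfolding openin_product_topology_alt by meson
    let ?J = "{i \<in> I. U i \<noteq> topspace (X i)}"
    have "\<exists>F. finite F \<and> F \<subseteq> \<S> i \<and> z i \<in> \<Inter>F \<and> topspace (X i) \<inter> \<Inter>F \<subseteq> U i" if "i \<in> I" for i
      using assms(2)[OF that] U that unfolding countable_subbase_def by (auto simp: PiE_iff)
    then obtain F where F: "\<And>i. i \<in> I \<Longrightarrow> finite (F i) \<and> F i \<subseteq> \<S> i \<and> z i \<in> \<Inter>(F i) \<and> topspace (X i) \<inter> \<Inter>(F i) \<subseteq> U i"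
      by metis
    have zP: "z \<in> topspace ?P" using W openin_subset by blast
    let ?F = "\<Union>i\<in>?J. (\<lambda>V. {x \<in> topspace ?P. x i \<in> V}) ` F i"
    have "finite ?F" using U(1) F by auto
    moreover have "?F \<subseteq> ?S" using F by blast
    moreover have "z \<in> \<Inter>?F" using F zP by auto
    moreover have "topspace ?P \<inter> \<Inter>?F \<subseteq> Pi\<^sub>E I U"
    proof
      fix x assume x: "x \<in> topspace ?P \<inter> \<Inter>?F"
      have "x i \<in> U i" if "i \<in> I" for i
      proof (cases "i \<in> ?J")
        case True
        have "x i \<in> \<Inter>(F i)" using x True by blast
        moreover have "x i \<in> topspace (X i)" using x that by auto
        ultimately show ?thesis using F[OF that] by blast
      qed (use x that in auto)
      moreover have "x \<in> extensional I" using x by (auto simp: PiE_def)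
      ultimately show "x \<in> Pi\<^sub>E I U" by (auto simp: PiE_iff)
    qed
    moreover have "topspace ?P \<inter> \<Inter>?F \<subseteq> W"
      using calculation(4) U(4) by (rule order_trans)
    ultimately show ?thesis by (intro exI[of _ ?F] conjI)
  qed
  moreover have "countable ?S"
    using assms by (intro countable_UN countable_image) (auto simp: countable_subbase_def)
  moreover have "\<forall>V\<in>?S. openin ?P V" using op by blast
  ultimately show ?thesis unfolding countable_subbase_def by simp
qed

text \<open>By Urysohn's metrization theorem these are the separable metrizable spaces. Second
  countability serves measurability and the codings, the Hausdorff property separates points,
  complete regularity provides continuous test functions; all three pass through the constructions
  without choosing a metric.\<close>

definition nice_space :: "'x topology \<Rightarrow> bool" where
  "nice_space X \<longleftrightarrow> second_countable X \<and> Hausdorff_space X \<and> completely_regular_space X"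

lemma nice_space_subbase:
  assumes "nice_space X" obtains \<S> where "countable_subbase X \<S>"
  using assms second_countable_imp_countable_subbase unfolding nice_space_def by blast

lemma nice_space_subtopology: "nice_space X \<Longrightarrow> nice_space (subtopology X A)"
  by (simp add: nice_space_def second_countable_subtopology Hausdorff_space_subtopology
      completely_regular_space_subtopology)

lemma nice_space_prod_topology:
  assumes "nice_space X" "nice_space Y"
  shows "nice_space (prod_topology X Y)"
proof -
  obtain \<A> \<B> where "countable_subbase X \<A>" "countable_subbase Y \<B>"
    using assms nice_space_subbase by metis
  from countable_subbase_imp_second_countable[OF countable_subbase_prod_topology[OF this]]
  show ?thesis using assms
    by (simp add: nice_space_def Hausdorff_space_prod_topology completely_regular_space_prod_topology)
qed

lemma nice_space_product_topology:
  assumes "countable I" "\<And>i. i \<in> I \<Longrightarrow> nice_space (X i)"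
  shows "nice_space (product_topology X I)"
proof -
  have "\<forall>i. \<exists>\<S>. i \<in> I \<longrightarrow> countable_subbase (X i) \<S>"
    using assms nice_space_subbase by metis
  then obtain \<S> where "\<And>i. i \<in> I \<Longrightarrow> countable_subbase (X i) (\<S> i)" by metis
  from countable_subbase_imp_second_countable[OF countable_subbase_product_topology[OF assms(1) this]]
  show ?thesis using assms
    by (simp add: nice_space_def Hausdorff_space_product_topology completely_regular_space_product_topology)
qed

lemma nice_space_homeomorphic: "X homeomorphic_space Y \<Longrightarrow> nice_space X \<Longrightarrow> nice_space Y"
  unfolding nice_space_def
  by (simp add: homeomorphic_space_second_countability homeomorphic_Hausdorff_space
    homeomorphic_completely_regular_space)

section \<open>Borel maps into products and subspaces\<close>

lemma measurable_into_prod_topology: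
  assumes "second_countable X" "second_countable Y"
    and f: "f \<in> M \<rightarrow>\<^sub>M borel_of X" and g: "g \<in> M \<rightarrow>\<^sub>M borel_of Y"
  shows "(\<lambda>x. (f x, g x)) \<in> M \<rightarrow>\<^sub>M borel_of (prod_topology X Y)"
proof -
  obtain \<A> \<B> where AB: "countable_subbase X \<A>" "countable_subbase Y \<B>"
    using assms second_countable_imp_countable_subbase by metis
  have fg: "f x \<in> topspace X" "g x \<in> topspace Y" if "x \<in> space M" for x
    using measurable_space[OF f that] measurable_space[OF g that] by auto
  show ?thesis
  proof (rule measurable_countable_subbase[OF countable_subbase_prod_topology[OF AB]])
    fix V assume "V \<in> (\<lambda>U. U \<times> topspace Y) ` \<A> \<union> (\<lambda>V. topspace X \<times> V) ` \<B>"
    then consider U where "U \<in> \<A>" "V = U \<times> topspace Y" | W where "W \<in> \<B>" "V = topspace X \<times> W" by blast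
    then show "(\<lambda>x. (f x, g x)) -` V \<inter> space M \<in> sets M"
    proof cases
      case 1
      then have "(\<lambda>x. (f x, g x)) -` V \<inter> space M = f -` U \<inter> space M" using fg by auto
      then show ?thesis using 1 AB measurable_sets[OF f openin_borel_of] by (simp add: countable_subbase_def)
    next
      case 2
      then have "(\<lambda>x. (f x, g x)) -` V \<inter> space M = g -` W \<inter> space M" using fg by auto
      then show ?thesis using 2 AB measurable_sets[OF g openin_borel_of] by (simp add: countable_subbase_def)
    qed
  qed (use fg in auto)
qed

lemma measurable_into_product_topology:
  assumes I: "countable I" and sc: "\<And>i. i \<in> I \<Longrightarrow> second_countable (X i)"
    and f: "\<And>i. i \<in> I \<Longrightarrow> (\<lambda>x. f x i) \<in> M \<rightarrow>\<^sub>M borel_of (X i)"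
    and ext: "\<And>x. x \<in> space M \<Longrightarrow> f x \<in> extensional I"
  shows "f \<in> M \<rightarrow>\<^sub>M borel_of (product_topology X I)"
proof -
  have "\<forall>i. \<exists>\<S>. i \<in> I \<longrightarrow> countable_subbase (X i) \<S>"
    using sc second_countable_imp_countable_subbase by metis
  then obtain \<S> where S: "\<And>i. i \<in> I \<Longrightarrow> countable_subbase (X i) (\<S> i)" by metis
  have fx: "f x \<in> topspace (product_topology X I)" if "x \<in> space M" for x
    using measurable_space[OF f that] ext[OF that] by (auto simp: PiE_iff)
  show ?thesis
  proof (rule measurable_countable_subbase[OF countable_subbase_product_topology[OF I S]])
    fix V assume "V \<in> (\<Union>i\<in>I. (\<lambda>V. {x \<in> topspace (product_topology X I). x i \<in> V}) ` \<S> i)"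
    then obtain i W where iW: "i \<in> I" "W \<in> \<S> i" "V = {x \<in> topspace (product_topology X I). x i \<in> W}" by blast
    then have "f -` V \<inter> space M = (\<lambda>x. f x i) -` W \<inter> space M" using fx by auto
    then show "f -` V \<inter> space M \<in> sets M"
      using iW S measurable_sets[OF f openin_borel_of] by (simp add: countable_subbase_def)
  qed (use fx in auto)
qed

lemma measurable_into_subtopology:
  assumes f: "f \<in> M \<rightarrow>\<^sub>M borel_of X" and A: "\<And>x. x \<in> space M \<Longrightarrow> f x \<in> A"
  shows "f \<in> M \<rightarrow>\<^sub>M borel_of (subtopology X A)"
proof (rule measurable_borel_ofI)
  show "f \<in> space M \<rightarrow> topspace (subtopology X A)"
    using A measurable_space[OF f] by auto
  fix U assume "openin (subtopology X A) U"
  then obtain W where W: "openin X W" "U = W \<inter> A" by (auto simp: openin_subtopology)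
  then have "f -` U \<inter> space M = f -` W \<inter> space M" using A by auto
  then show "f -` U \<inter> space M \<in> sets M"
    using measurable_sets[OF f openin_borel_of[OF W(1)]] by simp
qed

text \<open>A point is determined by the set of basic open sets containing it, so the space injects into the
  power set of the naturals.  This makes the codings \<open>enc\<close> of the hierarchy spaces injective.\<close>
lemma nice_space_inj_real:
  assumes "nice_space X"
  shows "\<exists>e::'x \<Rightarrow> real. inj_on e (topspace (X::'x topology))"
proof -
  obtain \<B> where \<B>: "countable \<B>" 
    and *: "\<And>U x. openin X U \<Longrightarrow> x \<in> U \<Longrightarrow> (\<exists>V\<in>\<B>. x \<in> V \<and> V \<subseteq> U)"
    using assms unfolding nice_space_def second_countable_def by meson
  let ?i = "to_nat_on \<B>"
  obtain k :: "nat set \<Rightarrow> real" where k: "inj k"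
    using nat_sets_eqpoll_reals unfolding eqpoll_def bij_betw_def by blast
  have "inj_on (\<lambda>x. k (?i ` {V \<in> \<B>. x \<in> V})) (topspace X)"
  proof (rule inj_onI, rule ccontr)
    fix x y assume xy: "x \<in> topspace X" "y \<in> topspace X" "x \<noteq> y"
      and eq: "k (?i ` {V \<in> \<B>. x \<in> V}) = k (?i ` {V \<in> \<B>. y \<in> V})"
    have "{V \<in> \<B>. x \<in> V} = {V \<in> \<B>. y \<in> V}"
      using injD[OF k eq] inj_on_to_nat_on[OF \<B>]
      by (simp add: inj_on_image_eq_iff)
    moreover obtain U where "openin X U" "x \<in> U" "y \<notin> U"
      using Hausdorff_imp_t1_space[of X] assms xy unfolding nice_space_def t1_space_def by meson
    ultimately show False using * by blast
  qed
  then show ?thesis by blast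
qed

section \<open>Topologies carried over to real codes\<close>

lemma enc_inj: "nice_space X \<Longrightarrow> inj_on (enc (topspace X)) (topspace X)"
  unfolding enc_def using someI_ex[OF nice_space_inj_real] .

lemma dec_enc: "nice_space X \<Longrightarrow> x \<in> topspace X \<Longrightarrow> dec (topspace X) (enc (topspace X) x) = x"
  unfolding dec_def by (rule the_inv_into_f_f[OF enc_inj])

lemma topspace_transport:
  assumes "nice_space X"
  shows "topspace (transport X) = enc (topspace X) ` topspace X"
  unfolding transport_def topspace_pullback_topology using dec_enc[OF assms] by auto

lemma homeomorphic_maps_transport:
  assumes "nice_space X"
  shows "homeomorphic_maps X (transport X) (enc (topspace X)) (dec (topspace X))"
  unfolding homeomorphic_maps_def
proof (intro conjI)
  show "continuous_map (transport X) X (dec (topspace X))"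
    unfolding transport_def
    using continuous_map_pullback[OF continuous_map_id, of "enc (topspace X) ` topspace X" "dec (topspace X)" X]
    by simp
  have "continuous_map X X (dec (topspace X) \<circ> enc (topspace X))"
    by (rule continuous_map_eq[OF continuous_map_id]) (simp add: dec_enc[OF assms])
  then show "continuous_map X (transport X) (enc (topspace X))"
    unfolding transport_def by (rule continuous_map_pullback') auto
next
  show "\<forall>x\<in>topspace X. dec (topspace X) (enc (topspace X) x) = x"
    by (simp add: dec_enc[OF assms])
  show "\<forall>y\<in>topspace (transport X). enc (topspace X) (dec (topspace X) y) = y"
    unfolding topspace_transport[OF assms] by (simp add: dec_enc[OF assms])
qed

lemma nice_space_transport: "nice_space X \<Longrightarrow> nice_space (transport X)"
  by (rule nice_space_homeomorphic[OF homeomorphic_maps_imp_homeomorphic_space[OF homeomorphic_maps_transport]])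


subsection \<open>The weak topology\<close>

lemma continuous_map_borel_measurable:
  assumes "continuous_map X euclideanreal f"
  shows "f \<in> borel_measurable (borel_of X)"
proof (rule borel_measurableI)
  fix V :: "real set" assume "open V"
  then have "openin X {x \<in> topspace X. f x \<in> V}"
    using assms by (simp add: continuous_map_def)
  moreover have "{x \<in> topspace X. f x \<in> V} = f -` V \<inter> space (borel_of X)" by auto
  ultimately show "f -` V \<inter> space (borel_of X) \<in> sets (borel_of X)"
    by (metis openin_borel_of)
qed

lemma prob_measures_eq_space: "prob_measures X = space (prob_algebra (borel_of X))"
  by (simp add: prob_measures_def space_prob_algebra)

lemma prob_measuresD:
  assumes "M \<in> prob_measures X"
  shows "prob_space M" "sets M = sets (borel_of X)" "space M = topspace X"
  using assms by (auto simp: prob_measures_def dest: sets_eq_imp_space_eq)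

lemma topspace_weak_topology [simp]: "topspace (weak_topology X) = prob_measures X"
  unfolding weak_topology_def topspace_pullback_topology by auto

lemma bcont_integrable:
  assumes f: "f \<in> bcont X" and M: "M \<in> prob_measures X"
  shows "integrable M f"
proof -
  interpret prob_space M by (rule prob_measuresD[OF M])
  have "f \<in> borel_measurable M"
    using continuous_map_borel_measurable[of X f] f prob_measuresD(2)[OF M]
    by (simp add: bcont_def cong: measurable_cong_sets)
  moreover obtain B where "\<forall>x\<in>topspace X. norm (f x) \<le> B"
    using f unfolding bcont_def bounded_iff by auto
  ultimately show ?thesis
    by (intro integrable_const_bound[where B = B]) (auto simp: prob_measuresD[OF M] intro!: AE_I2)
qed

lemma continuous_map_integral_weak_topology:
  assumes "f \<in> bcont X"
  shows "continuous_map (weak_topology X) euclideanreal (\<lambda>M. integral\<^sup>L M f)"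
proof -
  have "continuous_map (weak_topology X) euclideanreal
     ((\<lambda>x. x f) \<circ> (\<lambda>M. restrict (\<lambda>f. integral\<^sup>L M f) (bcont X)))"
    unfolding weak_topology_def
    by (intro continuous_map_pullback continuous_map_product_projection assms)
  then show ?thesis using assms by (simp add: o_def)
qed

text \<open>A closed set of the pullback is the trace of the preimage of a closed set in
  \<open>Y\<close>, so a separating function on \<open>Y\<close> composed with \<open>f\<close>
  still separates. The weak topology is such a pullback of a power of the real line.\<close>

lemma completely_regular_pullback_topology:
  assumes "completely_regular_space Y"
  shows "completely_regular_space (pullback_topology A f Y)"
  unfolding completely_regular_space_alt
proof (intro allI impI)
  fix C x assume C: "closedin (pullback_topology A f Y) C" and x: "x \<in> topspace (pullback_topology A f Y) - C"
  then obtain U where U: "openin Y U" "topspace (pullback_topology A f Y) - C = f -` U \<inter> A"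
    unfolding closedin_def openin_pullback_topology by auto
  then have "closedin Y (topspace Y - U)" "f x \<in> topspace Y - (topspace Y - U)"
    using x openin_subset by auto
  then obtain g where g: "continuous_map Y euclideanreal g" "g (f x) = 0" "g ` (topspace Y - U) \<subseteq> {1}"
    using assms unfolding completely_regular_space_alt by meson
  have "(g \<circ> f) ` C \<subseteq> {1}"
  proof -
    have "f y \<in> topspace Y - U" if "y \<in> C" for y
      using U(2) that closedin_subset[OF C] by (auto simp: topspace_pullback_topology)
    then show ?thesis using g(3) by fastforce
  qed
  then show "\<exists>h. continuous_map (pullback_topology A f Y) euclideanreal h \<and> h x = 0 \<and> h ` C \<subseteq> {1}"
    using g continuous_map_pullback[OF g(1)] by (intro exI[of _ "g \<circ> f"]) auto
qed

lemma prob_measures_eqI: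
  assumes M: "M \<in> prob_measures X" and N: "N \<in> prob_measures X"
    and eq: "\<And>U. openin X U \<Longrightarrow> measure M U = measure N U"
  shows "M = N"
proof (rule measure_eqI_generator_eq[where E = "{U. openin X U}" and \<Omega> = "topspace X" and A = "\<lambda>_. topspace X"])
  interpret M: prob_space M by (rule prob_measuresD[OF M])
  interpret N: prob_space N by (rule prob_measuresD[OF N])
  show "emeasure M U = emeasure N U" if "U \<in> {U. openin X U}" for U
    using eq that by (simp add: M.emeasure_eq_measure N.emeasure_eq_measure)
  show "emeasure M (topspace X) \<noteq> \<infinity>" by (simp add: M.emeasure_eq_measure)
qed (auto simp: Int_stable_def openin_Int sets_borel_of prob_measuresD[OF M] prob_measuresD[OF N] dest: openin_subset)

text \<open>Every open set is a cozero set here: by a Lindelof argument countably many of the bump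
  functions given by complete regularity suffice to cover \<open>U\<close>, and their partial sums,
  scaled up and cut off at 1, tend to the indicator.\<close>

lemma indicator_approx:
  assumes X: "nice_space X" and U: "openin X U"
  obtains u :: "nat \<Rightarrow> 'x \<Rightarrow> real"
  where "\<And>n. continuous_map X euclideanreal (u n)"
    "\<And>n x. x \<in> topspace X \<Longrightarrow> 0 \<le> u n x \<and> u n x \<le> indicator U x"
    "\<And>x. x \<in> topspace X \<Longrightarrow> (\<lambda>n. u n x) \<longlonglongrightarrow> indicator U x"
proof -
  define good where "good g \<longleftrightarrow> continuous_map X euclideanreal g \<and> (\<forall>y\<in>topspace X. 0 \<le> g y) \<and>
    (\<forall>y\<in>topspace X - U. g y = 0)" for g :: "'x \<Rightarrow> real"
  have ex_good: "\<exists>g. good g \<and> g x = 1" if "x \<in> U" for x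
  proof -
    have "closedin X (topspace X - U)" "x \<in> topspace X - (topspace X - U)"
      using U that openin_subset by auto
    then obtain f where f: "continuous_map X (top_of_set {0..1::real}) f" "f x = 0" "f ` (topspace X - U) \<subseteq> {1}"
      using X unfolding nice_space_def completely_regular_space_def by meson
    have c: "continuous_map X euclideanreal f" and r: "\<And>y. y \<in> topspace X \<Longrightarrow> f y \<le> 1"
      using f(1) by (auto simp: continuous_map_in_subtopology)
    have "good (\<lambda>y. 1 - f y)"
      unfolding good_def using c r f(3) by (auto intro!: continuous_map_diff)
    then show ?thesis using f(2) by (intro exI[of _ "\<lambda>y. 1 - f y"]) simp
  qed
  obtain \<B> where \<B>: "countable \<B>" 
    and *: "\<And>U x. openin X U \<Longrightarrow> x \<in> U \<Longrightarrow> (\<exists>V\<in>\<B>. x \<in> V \<and> V \<subseteq> U)"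
    using X unfolding nice_space_def second_countable_def by meson
  \<comment> \<open>Basic sets are selected instead of functions, since the base is countable while
    the family of bumps need not be; the threshold 1/2 gives a positive lower bound on each selected
    set.\<close>
  define \<C> where "\<C> = {V \<in> \<B>. \<exists>g. good g \<and> (\<forall>y\<in>V. g y > 1/2)}"
  have \<C>: "countable \<C>" unfolding \<C>_def using \<B> by simp
  have "\<forall>V. \<exists>g. V \<in> \<C> \<longrightarrow> good g \<and> (\<forall>y\<in>V. g y > 1/2)" unfolding \<C>_def by blast
  then obtain G where G: "\<And>V. V \<in> \<C> \<Longrightarrow> good (G V) \<and> (\<forall>y\<in>V. G V y > 1/2)" by metis
  have cover: "\<exists>V\<in>\<C>. x \<in> V" if x: "x \<in> U" for x
  proof -
    obtain g where g: "good g" "g x = 1" using ex_good[OF x] by blast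
    then have "openin X {y \<in> topspace X. 1/2 < g y}"
      unfolding good_def continuous_map_upper_lower_semicontinuous_lt by blast
    moreover have "x \<in> {y \<in> topspace X. 1/2 < g y}" using g x U openin_subset by auto
    ultimately obtain V where "V \<in> \<B>" "x \<in> V" "V \<subseteq> {y \<in> topspace X. 1/2 < g y}" using * by meson
    then show ?thesis unfolding \<C>_def using g by blast
  qed
  \<comment> \<open>If \<open>U\<close> is empty there may be no selected set; the zero function
    then fills the enumeration.\<close>
  define g where "g k = (if \<C> = {} then (\<lambda>_. 0) else G (from_nat_into \<C> k))" for k
  have good_g: "good (g k)" for k
    unfolding g_def using G from_nat_into[of \<C> k] by (auto simp: good_def)
  define u where "u n x = min 1 (real n * (\<Sum>k<n. g k x))" for n x
  have gpos: "0 \<le> g k x" if "x \<in> topspace X" for k x using good_g that by (auto simp: good_def)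
  have uU: "u n x = 0" if "x \<in> topspace X" "x \<notin> U" for n x
    using good_g that by (auto simp: good_def u_def)
  show ?thesis
  proof
    show "continuous_map X euclideanreal (u n)" for n
      unfolding u_def using good_g
      by (intro continuous_map_real_min continuous_map_real_mult continuous_map_sum continuous_map_canonical_const) (auto simp: good_def)
    show "0 \<le> u n x \<and> u n x \<le> indicator U x" if "x \<in> topspace X" for n x
      using gpos[OF that] uU[OF that, of n] by (cases "x \<in> U") (auto simp: u_def sum_nonneg)
    show "(\<lambda>n. u n x) \<longlonglongrightarrow> indicator U x" if x: "x \<in> topspace X" for x
    proof (cases "x \<in> U")
      case True
      then obtain V where V: "V \<in> \<C>" "x \<in> V" using cover by blast
      obtain k where "from_nat_into \<C> k = V" using from_nat_into_surj[OF \<C> V(1)] by blast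
      then have gk: "g k x > 1/2" unfolding g_def using V G by auto
      \<comment> \<open>\<open>n > k\<close> puts \<open>g k x\<close> into the sum, and
        \<open>n \<ge> 2\<close> turns its lower bound 1/2 into the cutoff value 1.\<close>
      have "u n x = 1" if n: "n \<ge> k + 2" for n
      proof -
        have "g k x \<le> (\<Sum>k<n. g k x)" using n gpos[OF x] by (intro member_le_sum) auto
        then have "2 * (1/2) \<le> real n * (\<Sum>k<n. g k x)" using gk n by (intro mult_mono) auto
        then show ?thesis by (simp add: u_def)
      qed
      then show ?thesis using True
        by (intro tendsto_eventually) (auto simp: eventually_sequentially)
    qed (use uU x in simp)
  qed
qed

text \<open>The approximating functions lie below the indicator and their integrals tend to
  \<open>measure M U\<close>, so this number is a supremum of weakly continuous functionals: the
  open-set half of the portmanteau theorem.\<close>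

lemma openin_weak_topology_measure:
  assumes X: "nice_space X" and U: "openin X U"
  shows "openin (weak_topology X) {M \<in> prob_measures X. r < measure M U}"
proof -
  obtain u where u: "\<And>n. continuous_map X euclideanreal (u n)"
    "\<And>n x. x \<in> topspace X \<Longrightarrow> 0 \<le> u n x \<and> u n x \<le> indicator U x"
    "\<And>x. x \<in> topspace X \<Longrightarrow> (\<lambda>n. u n x) \<longlonglongrightarrow> indicator U x"
    using indicator_approx[OF X U] by metis
  have ub: "0 \<le> u n x \<and> u n x \<le> 1" if "x \<in> topspace X" for n x
    using u(2)[OF that, of n] by (cases "x \<in> U") auto
  have bc: "u n \<in> bcont X" for n
    unfolding bcont_def bounded_iff using u(1) ub by (auto intro!: exI[of _ 1])
  have "{M \<in> prob_measures X. r < measure M U} =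
    (\<Union>n. {M \<in> topspace (weak_topology X). r < integral\<^sup>L M (u n)})" (is "?L = ?R")
  proof (intro equalityI subsetI)
    fix M assume "M \<in> ?L"
    then have M: "M \<in> prob_measures X" "r < measure M U" by auto
    interpret prob_space M by (rule prob_measuresD[OF M(1)])
    have U': "U \<in> sets M" using openin_borel_of[OF U] prob_measuresD[OF M(1)] by simp
    have "(\<lambda>n. integral\<^sup>L M (u n)) \<longlonglongrightarrow> integral\<^sup>L M (indicator U :: _ \<Rightarrow> real)"
    proof (rule integral_dominated_convergence[where w = "\<lambda>_. 1"])
      show "u n \<in> borel_measurable M" for n
        using bcont_integrable[OF bc M(1)] by (rule borel_measurable_integrable)
    qed (use U' u(3) ub prob_measuresD(3)[OF M(1)] in \<open>auto intro!: AE_I2\<close>)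
    moreover have "integral\<^sup>L M (indicator U :: _ \<Rightarrow> real) = measure M U"
      using U' sets.sets_into_space[OF U'] by (simp add: Int_absorb2)
    ultimately have "(\<lambda>n. integral\<^sup>L M (u n)) \<longlonglongrightarrow> measure M U" by simp
    from order_tendstoD(1)[OF this M(2)] obtain n where "r < integral\<^sup>L M (u n)"
      by (auto simp: eventually_sequentially)
    then show "M \<in> ?R" using M by auto
  next
    fix M assume "M \<in> ?R"
    then obtain n where M: "M \<in> prob_measures X" "r < integral\<^sup>L M (u n)" by auto
    interpret prob_space M by (rule prob_measuresD[OF M(1)])
    have U': "U \<in> sets M" using openin_borel_of[OF U] prob_measuresD[OF M(1)] by simp
    have "integral\<^sup>L M (u n) \<le> integral\<^sup>L M (indicator U :: _ \<Rightarrow> real)"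
      using u(2) U' prob_measuresD(3)[OF M(1)]
      by (intro integral_mono bcont_integrable[OF bc M(1)]) (auto simp: emeasure_eq_measure)
    also have "\<dots> = measure M U"
      using U' sets.sets_into_space[OF U'] by (simp add: Int_absorb2)
    finally show "M \<in> ?L" using M by auto
  qed
  moreover have "openin (weak_topology X) {M \<in> topspace (weak_topology X). r < integral\<^sup>L M (u n)}" for n
    using continuous_map_integral_weak_topology[OF bc]
    unfolding continuous_map_upper_lower_semicontinuous_lt by blast
  ultimately show ?thesis by auto
qed

section \<open>Lower semicontinuity of integrals\<close>

definition lsc_map :: "'x topology \<Rightarrow> ('x \<Rightarrow> real) \<Rightarrow> bool" where
  "lsc_map X f \<longleftrightarrow> (\<forall>a. openin X {x \<in> topspace X. a < f x})"

lemma lsc_map_const: "lsc_map X (\<lambda>_. c)"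
  unfolding lsc_map_def
proof
  fix a
  show "openin X {x \<in> topspace X. a < c}" by (cases "a < c") auto
qed

lemma lsc_map_add:
  assumes "lsc_map X f" "lsc_map X g" shows "lsc_map X (\<lambda>x. f x + g x)"
  unfolding lsc_map_def
proof
  fix a
  have "{x \<in> topspace X. a < f x + g x} =
    (\<Union>q. {x \<in> topspace X. q < f x} \<inter> {x \<in> topspace X. a - q < g x})" (is "?L = ?R")
  proof (intro equalityI subsetI)
    fix x assume "x \<in> ?L"
    then obtain q where "a - g x < q" "q < f x" using dense[of "a - g x" "f x"] by auto
    then show "x \<in> ?R" using \<open>x \<in> ?L\<close> by auto
  qed auto
  moreover have "openin X ?R"
    using assms unfolding lsc_map_def by (intro openin_Union) auto
  ultimately show "openin X ?L" by simp
qed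

lemma lsc_map_sum:
  "(\<And>i. i \<in> I \<Longrightarrow> lsc_map X (f i)) \<Longrightarrow> lsc_map X (\<lambda>x. \<Sum>i\<in>I. f i x)"
  by (induction I rule: infinite_finite_induct) (auto intro: lsc_map_const lsc_map_add)

lemma lsc_map_divide:
  assumes "lsc_map X f" "c > 0" shows "lsc_map X (\<lambda>x. f x / c)"
  using assms by (simp add: lsc_map_def pos_less_divide_eq)

text \<open>The number counted is \<open>\<lceil>n t\<rceil> - 1\<close>, which is below
  \<open>n t\<close> and at least \<open>n t - 1\<close> when t > 0; truncated subtraction on the
  naturals settles t = 0.\<close>

lemma count_below_bounds:
  assumes "0 \<le> t" "t \<le> 1" "n > 0"
  shows "(\<Sum>k=1..n. of_bool (real k / real n < t)) \<le> real n * t"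
    "real n * t \<le> (\<Sum>k=1..n. of_bool (real k / real n < t)) + (1::real)"
proof -
  have "{k \<in> {1..n}. real k / real n < t} = {1..<nat \<lceil>real n * t\<rceil>}"
  proof (intro set_eqI)
    fix k
    have nt: "real n * t \<le> real n" using assms by (simp add: mult_left_le)
    have "real k / real n < t \<longleftrightarrow> int k < \<lceil>real n * t\<rceil>"
      using assms by (simp add: less_ceiling_iff pos_divide_less_eq mult.commute)
    also have "\<dots> \<longleftrightarrow> k < nat \<lceil>real n * t\<rceil>" by (simp add: zless_nat_eq_int_zless)
    finally have 1: "real k / real n < t \<longleftrightarrow> k < nat \<lceil>real n * t\<rceil>" .
    have "nat \<lceil>real n * t\<rceil> \<le> n" using nt by (simp add: nat_le_iff ceiling_le_iff)
    then show "k \<in> {k \<in> {1..n}. real k / real n < t} \<longleftrightarrow> k \<in> {1..<nat \<lceil>real n * t\<rceil>}"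
      unfolding mem_Collect_eq 1 by (metis atLeastAtMost_iff atLeastLessThan_iff dual_order.trans less_imp_le)
  qed
  then have "(\<Sum>k=1..n. of_bool (real k / real n < t)) = real (nat \<lceil>real n * t\<rceil> - 1)"
    by (simp add: sum.If_cases of_bool_def Int_def)
  moreover have "0 \<le> real n * t" using assms by simp
  ultimately show "(\<Sum>k=1..n. of_bool (real k / real n < t)) \<le> real n * t"
    "real n * t \<le> (\<Sum>k=1..n. of_bool (real k / real n < t)) + (1::real)"
    by linarith+
qed

text \<open>Integrate the pointwise count of \<open>count_below_bounds\<close> at
  \<open>t = f x\<close>. The error 1/n is independent of \<open>M\<close>, which lets
  semicontinuity pass to the limit.\<close>

lemma integral_layer_bounds:
  assumes "prob_space M" and f: "f \<in> borel_measurable M"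
    and f01: "\<And>x. x \<in> space M \<Longrightarrow> 0 \<le> f x \<and> f x \<le> (1::real)" and n: "n > 0"
  defines "s \<equiv> (\<Sum>k=1..n. measure M {x \<in> space M. real k / real n < f x}) / real n"
  shows "s \<le> integral\<^sup>L M f" "integral\<^sup>L M f \<le> s + 1 / real n"
proof -
  interpret prob_space M by fact
  let ?A = "\<lambda>k. {x \<in> space M. real k / real n < f x}"
  let ?g = "\<lambda>x. (\<Sum>k=1..n. indicator (?A k) x) / real n :: real"
  have A: "?A k \<in> sets M" for k using f by measurable
  have int_g: "integrable M ?g" using A
    by (intro integrable_divide integrable_sum) (auto simp: integrable_indicator_iff emeasure_eq_measure)
  have int_f: "integrable M f"
    using f f01 by (intro integrable_const_bound[where B = 1]) auto
  have s: "integral\<^sup>L M ?g = s"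
  proof -
    have "integral\<^sup>L M ?g = (\<Sum>k=1..n. integral\<^sup>L M (indicator (?A k))) / real n"
      using A by (subst integral_divide_zero, subst Bochner_Integration.integral_sum)
        (auto simp: integrable_indicator_iff emeasure_eq_measure)
    also have "\<dots> = s" unfolding s_def using A by (intro arg_cong2[where f = "(/)"] sum.cong) (auto intro!: arg_cong[where f = "measure M"])
    finally show ?thesis .
  qed
  have g: "?g x = (\<Sum>k=1..n. of_bool (real k / real n < f x)) / real n" if "x \<in> space M" for x
    using that by (intro arg_cong2[where f = "(/)"] sum.cong) (auto simp: indicator_def)
  have "?g x \<le> f x" "f x \<le> ?g x + 1 / real n" if "x \<in> space M" for x
    unfolding g[OF that] using count_below_bounds[of "f x" n] f01[OF that] n
    by (auto simp: field_simps)
  then have "integral\<^sup>L M ?g \<le> integral\<^sup>L M f" "integral\<^sup>L M f \<le> integral\<^sup>L M (\<lambda>x. ?g x + 1 / real n)"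
    using int_f int_g by (intro integral_mono; simp)+
  moreover have "integral\<^sup>L M (\<lambda>x. ?g x + 1 / real n) = s + 1 / real n"
    using int_g s by (subst Bochner_Integration.integral_add) (auto simp: prob_space)
  ultimately show "s \<le> integral\<^sup>L M f" "integral\<^sup>L M f \<le> s + 1 / real n" using s by auto
qed

text \<open>Superlevel sets of a continuous function are open, so each layer sum is lower
  semicontinuous; the integral is the supremum of the layer sums, and suprema preserve lower
  semicontinuity.\<close>

lemma lsc_map_integral:
  assumes top: "topspace Z = prob_measures X"
    and Z: "\<And>U. openin X U \<Longrightarrow> lsc_map Z (\<lambda>M. measure M U)"
    and f: "continuous_map X euclideanreal f" and f01: "\<And>x. x \<in> topspace X \<Longrightarrow> 0 \<le> f x \<and> f x \<le> 1"
  shows "lsc_map Z (\<lambda>M. integral\<^sup>L M f)"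
  unfolding lsc_map_def
proof
  fix a
  define s where "s n M = (\<Sum>k=1..n. measure M {x \<in> topspace X. real k / real n < f x}) / real n"
    for n and M :: "'a measure"
  have lsc: "lsc_map Z (s n)" if "n > 0" for n
    unfolding s_def using f that unfolding continuous_map_upper_lower_semicontinuous_lt
    by (intro lsc_map_divide lsc_map_sum Z) auto
  have b: "s n M \<le> integral\<^sup>L M f" "integral\<^sup>L M f \<le> s n M + 1 / real n"
    if M: "M \<in> prob_measures X" and n: "n > 0" for n M
  proof -
    have "f \<in> borel_measurable M"
      using continuous_map_borel_measurable[OF f] prob_measuresD(2)[OF M]
      by (simp cong: measurable_cong_sets)
    from integral_layer_bounds[OF prob_measuresD(1)[OF M] this _ n]
    show "s n M \<le> integral\<^sup>L M f" "integral\<^sup>L M f \<le> s n M + 1 / real n"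
      using f01 by (auto simp: s_def prob_measuresD(3)[OF M])
  qed
  have "{M \<in> topspace Z. a < integral\<^sup>L M f} = (\<Union>n\<in>{0<..}. {M \<in> topspace Z. a < s n M})" (is "?L = ?R")
  proof (intro equalityI subsetI)
    fix M assume "M \<in> ?L"
    then have M: "M \<in> prob_measures X" "a < integral\<^sup>L M f" by (auto simp: top)
    obtain n where n: "n > 0" "1 / real n < integral\<^sup>L M f - a"
      using M(2) by (metis diff_gt_0_iff_gt nat_approx_posE zero_less_Suc)
    then have "a < s n M" using b(2)[OF M(1) n(1)] by simp
    then show "M \<in> ?R" using n \<open>M \<in> ?L\<close> by auto
  next
    fix M assume "M \<in> ?R"
    then obtain n where n: "n > 0" "M \<in> topspace Z" "a < s n M" by auto
    then show "M \<in> ?L" using b(1)[of M n] by (auto simp: top)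
  qed
  moreover have "openin Z ?R" using lsc unfolding lsc_map_def by (intro openin_Union) auto
  ultimately show "openin Z ?L" by simp
qed

lemma continuous_map_integral_of_lsc:
  assumes top: "topspace Z = prob_measures X"
    and Z: "\<And>U. openin X U \<Longrightarrow> lsc_map Z (\<lambda>M. measure M U)"
    and f: "f \<in> bcont X"
  shows "continuous_map Z euclideanreal (\<lambda>M. integral\<^sup>L M f)"
proof -
  obtain K where K: "K > 0" "\<And>x. x \<in> topspace X \<Longrightarrow> \<bar>f x\<bar> \<le> K"
    using f unfolding bcont_def bounded_pos by auto
  have cf: "continuous_map X euclideanreal f" using f by (simp add: bcont_def)
  \<comment> \<open>Rescaling by a bound \<open>K\<close> moves the values into [0,1]; total mass 1
    then turns lower semicontinuity for \<open>1 - g\<close> into upper semicontinuity for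
    \<open>g\<close>.\<close>
  define g where "g x = (f x + K) / (2 * K)" for x
  have cg: "continuous_map X euclideanreal g"
    unfolding g_def divide_inverse by (intro continuous_map_real_mult continuous_map_add cf continuous_map_canonical_const)
  have g01: "0 \<le> g x \<and> g x \<le> 1" if "x \<in> topspace X" for x
    unfolding g_def using K(1) K(2)[OF that] by (auto simp: field_simps abs_le_iff)
  have bg: "g \<in> bcont X" unfolding bcont_def bounded_iff using cg g01 by (auto intro!: exI[of _ 1])
  have l1: "lsc_map Z (\<lambda>M. integral\<^sup>L M g)"
    by (rule lsc_map_integral[OF top Z cg]) (auto simp: g01)
  have l2: "lsc_map Z (\<lambda>M. integral\<^sup>L M (\<lambda>x. 1 - g x))"
    by (rule lsc_map_integral[OF top Z]) (use g01 cg in \<open>auto intro!: continuous_map_diff\<close>)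
  have eq2: "integral\<^sup>L M (\<lambda>x. 1 - g x) = 1 - integral\<^sup>L M g" if "M \<in> prob_measures X" for M
  proof -
    interpret prob_space M by (rule prob_measuresD[OF that])
    show ?thesis using bcont_integrable[OF bg that] by (simp add: prob_space)
  qed
  have eq: "integral\<^sup>L M f = 2 * K * integral\<^sup>L M g - K" if "M \<in> prob_measures X" for M
  proof -
    interpret prob_space M by (rule prob_measuresD[OF that])
    have "f = (\<lambda>x. 2 * K * g x - K)" using K(1) by (auto simp: g_def fun_eq_iff)
    then have "integral\<^sup>L M f = integral\<^sup>L M (\<lambda>x. 2 * K * g x - K)" by simp
    also have "\<dots> = 2 * K * integral\<^sup>L M g - K"
      using bcont_integrable[OF bg that] by (simp add: prob_space)
    finally show ?thesis .
  qed
  have "continuous_map Z euclideanreal (\<lambda>M. integral\<^sup>L M g)"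
    unfolding continuous_map_upper_lower_semicontinuous_lt
  proof (intro conjI allI)
    show "openin Z {M \<in> topspace Z. a < integral\<^sup>L M g}" for a using l1 by (simp add: lsc_map_def)
    fix a
    have "{M \<in> topspace Z. integral\<^sup>L M g < a} = {M \<in> topspace Z. 1 - a < integral\<^sup>L M (\<lambda>x. 1 - g x)}"
      using eq2 by (auto simp: top)
    then show "openin Z {M \<in> topspace Z. integral\<^sup>L M g < a}" using l2 by (simp add: lsc_map_def)
  qed
  then have "continuous_map Z euclideanreal (\<lambda>M. 2 * K * integral\<^sup>L M g - K)"
    by (intro continuous_map_diff continuous_map_real_mult continuous_map_canonical_const)
  then show ?thesis by (rule continuous_map_eq) (simp add: eq top)
qed

text \<open>Finite unions are needed because the measure of an open set is the supremum over finite
  unions of basic subsets, not over the basic subsets themselves; rational thresholds keep the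
  family countable.\<close>

definition weak_subbase :: "'x topology \<Rightarrow> 'x set set \<Rightarrow> 'x measure set set" where
  "weak_subbase X \<B> = (\<lambda>(F, q). {M \<in> prob_measures X. q < measure M (\<Union>F)}) ` ({F. finite F \<and> F \<subseteq> \<B>} \<times> (\<rat> :: real set))"

text \<open>By the layer-cake sums of \<open>integral_layer_bounds\<close>, integrals of bounded continuous functions are
  continuous as soon as the maps \<open>M \<mapsto> measure M U\<close>, \<open>U\<close> open, are lower semicontinuous.\<close>
lemma countable_subbase_weak_topology:
  assumes X: "nice_space X"
    and \<B>: "countable \<B>" "\<And>V. V \<in> \<B> \<Longrightarrow> openin X V"
    and base: "\<And>U x. openin X U \<Longrightarrow> x \<in> U \<Longrightarrow> \<exists>V\<in>\<B>. x \<in> V \<and> V \<subseteq> U"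
  shows "countable_subbase (weak_topology X) (weak_subbase X \<B>)"
proof -
  let ?S = "weak_subbase X \<B>"
  \<comment> \<open>\<open>Z\<close> is generated by the candidate subbase on the same set of
    measures. Once the identity from \<open>Z\<close> to the weak topology is continuous, every
    weakly open set is a union of finite intersections of candidates.\<close>
  define Z where "Z = topology (arbitrary union_of (finite intersection_of (\<lambda>V. V \<in> ?S) relative_to prob_measures X))"
  have op_Z: "openin Z = arbitrary union_of (finite intersection_of (\<lambda>V. V \<in> ?S) relative_to prob_measures X)"
    unfolding Z_def by (rule ext) (rule openin_subbase)
  have top_Z: "topspace Z = prob_measures X" unfolding Z_def by simp
  have Z_S: "openin Z V" if "V \<in> ?S" for V
  proof -
    have "V \<subseteq> prob_measures X" using that by (auto simp: weak_subbase_def)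
    then show ?thesis
      unfolding op_Z using that
      by (intro arbitrary_union_of_inc relative_to_subset_inc finite_intersection_of_inc)
  qed
  have lsc: "lsc_map Z (\<lambda>M. measure M U)" if U: "openin X U" for U
    unfolding lsc_map_def
  proof
    fix a
    let ?C = "{F. finite F \<and> F \<subseteq> {V \<in> \<B>. V \<subseteq> U}}"
    have "{M \<in> topspace Z. a < measure M U} =
      (\<Union>F\<in>?C. \<Union>q\<in>{q::real. q \<in> \<rat> \<and> a < q}. {M \<in> prob_measures X. q < measure M (\<Union>F)})" (is "?L = ?R")
    proof (intro equalityI subsetI)
      fix M assume "M \<in> ?L"
      then have M: "M \<in> prob_measures X" "a < measure M U" by (auto simp: top_Z)
      interpret prob_space M by (rule prob_measuresD[OF M(1)])
      have sV: "V \<in> sets M" if "V \<in> \<B>" for V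
        using openin_borel_of[OF \<B>(2)[OF that]] prob_measuresD[OF M(1)] by simp
      \<comment> \<open>The empty set is the default when no basic set lies inside \<open>U\<close>;
        it is removed again in \<open>?F\<close>, as it need not belong to
        \<open>\<B>\<close>.\<close>
      define V where "V k = (if {V \<in> \<B>. V \<subseteq> U} = {} then {} else from_nat_into {V \<in> \<B>. V \<subseteq> U} k)" for k
      have V: "V k = {} \<or> V k \<in> {V \<in> \<B>. V \<subseteq> U}" for k
        unfolding V_def using from_nat_into[of "{V \<in> \<B>. V \<subseteq> U}" k] by presburger
      have "(\<Union>k. V k) = U"
      proof (intro equalityI subsetI)
        fix x assume "x \<in> U"
        then obtain W where W: "W \<in> {V \<in> \<B>. V \<subseteq> U}" "x \<in> W" using base[OF U] by blast
        have "countable {V \<in> \<B>. V \<subseteq> U}" using \<B>(1) by simp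
        then obtain k where "from_nat_into {V \<in> \<B>. V \<subseteq> U} k = W" using from_nat_into_surj W(1) by metis
        then have "V k = W" using W(1) unfolding V_def by auto
        then show "x \<in> (\<Union>k. V k)" using W(2) by auto
      next
        fix x assume "x \<in> (\<Union>k. V k)"
        then obtain k where "x \<in> V k" by blast
        then show "x \<in> U" using V[of k] by auto
      qed
      moreover have "(\<lambda>n. measure M (\<Union>k<n. V k)) \<longlonglongrightarrow> measure M (\<Union>n. \<Union>k<n. V k)"
      proof (rule finite_Lim_measure_incseq)
        have "V k \<in> sets M" for k using V[of k] sV by auto
        then show "range (\<lambda>n. \<Union>k<n. V k) \<subseteq> sets M" by auto
        show "incseq (\<lambda>n. \<Union>k<n. V k)" by (intro monoI) force
      qed
      moreover have "(\<Union>n. \<Union>k<n. V k) = (\<Union>k. V k)" by auto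
      ultimately have "(\<lambda>n. measure M (\<Union>k<n. V k)) \<longlonglongrightarrow> measure M U" by simp
      from order_tendstoD(1)[OF this M(2)] obtain n where n: "a < measure M (\<Union>k<n. V k)"
        by (auto simp: eventually_sequentially)
      obtain q :: real where q: "q \<in> \<rat>" "a < q" "q < measure M (\<Union>k<n. V k)" using Rats_dense_in_real[OF n] by blast
      let ?F = "V ` {..<n} - {{}}"
      have "?F \<in> ?C" using V by auto
      moreover have "\<Union>?F = (\<Union>k<n. V k)" by auto
      ultimately show "M \<in> ?R" using q M(1)
        by (intro UN_I[of ?F] UN_I[of q]) auto
    next
      fix M assume "M \<in> ?R"
      then obtain F q where M: "F \<in> ?C" "a < q" "M \<in> prob_measures X" "q < measure M (\<Union>F)" by auto
      interpret prob_space M by (rule prob_measuresD[OF M(3)])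
      have "U \<in> sets M" using openin_borel_of[OF U] prob_measuresD[OF M(3)] by simp
      then have "measure M (\<Union>F) \<le> measure M U" using M(1) by (intro finite_measure_mono) auto
      then show "M \<in> ?L" using M by (auto simp: top_Z)
    qed
    moreover have "openin Z ?R"
    proof (intro openin_Union ballI)
      fix W assume "W \<in> (\<lambda>F. \<Union>q\<in>{q::real. q \<in> \<rat> \<and> a < q}. {M \<in> prob_measures X. q < measure M (\<Union>F)}) ` ?C"
      then obtain F where F: "F \<in> ?C"
        and W: "W = (\<Union>q\<in>{q::real. q \<in> \<rat> \<and> a < q}. {M \<in> prob_measures X. q < measure M (\<Union>F)})" by blast
      have "{M \<in> prob_measures X. q < measure M (\<Union>F)} \<in> ?S" if "q \<in> \<rat>" for q
        unfolding weak_subbase_def using F that by (intro image_eqI[of _ _ "(F, q)"]) auto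
      then show "openin Z W" unfolding W by (intro openin_Union) (auto intro: Z_S)
    qed
    ultimately show "openin Z ?L" by simp
  qed
  have cont: "continuous_map Z (weak_topology X) (\<lambda>M. M)"
    unfolding weak_topology_def
  proof (rule continuous_map_pullback')
    have "continuous_map Z (product_topology (\<lambda>_. euclideanreal) (bcont X)) (\<lambda>M. \<lambda>f\<in>bcont X. integral\<^sup>L M f)"
      using continuous_map_integral_of_lsc[OF top_Z lsc]
      by (intro continuous_map_componentwise[THEN iffD2]) auto
    then show "continuous_map Z (product_topology (\<lambda>_. euclideanreal) (bcont X))
       ((\<lambda>M. \<lambda>f\<in>bcont X. integral\<^sup>L M f) \<circ> (\<lambda>M. M))" by (simp add: o_def)
  qed (auto simp: top_Z)
  have "countable ?S"
    unfolding weak_subbase_def using \<B>(1)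
    by (intro countable_image countable_SIGMA countable_Collect_finite_subset countable_rat)
  moreover have "\<forall>V\<in>?S. openin (weak_topology X) V"
    unfolding weak_subbase_def using \<B>(2) by (auto intro!: openin_weak_topology_measure[OF X] openin_Union)
  moreover have "\<exists>F. finite F \<and> F \<subseteq> ?S \<and> M \<in> \<Inter>F \<and> topspace (weak_topology X) \<inter> \<Inter>F \<subseteq> U"
    if U: "openin (weak_topology X) U" "M \<in> U" for U M
  proof -
    have "openin Z {x \<in> topspace Z. x \<in> U}"
      using openin_continuous_map_preimage[OF cont U(1)] .
    moreover have "{x \<in> topspace Z. x \<in> U} = U" using openin_subset[OF U(1)] by (auto simp: top_Z)
    ultimately have "(arbitrary union_of (finite intersection_of (\<lambda>V. V \<in> ?S) relative_to prob_measures X)) U"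
      by (simp add: op_Z)
    then obtain \<U> where "\<U> \<subseteq> Collect (finite intersection_of (\<lambda>V. V \<in> ?S) relative_to prob_measures X)" "\<Union>\<U> = U"
      unfolding union_of_def by auto
    then obtain W where W: "W \<in> \<U>" "M \<in> W" "W \<subseteq> U"
      and "(finite intersection_of (\<lambda>V. V \<in> ?S) relative_to prob_measures X) W" using U(2) by blast
    then obtain F where "finite F" "F \<subseteq> ?S" "W = prob_measures X \<inter> \<Inter>F"
      unfolding relative_to_def intersection_of_def by blast
    then show ?thesis using W by (intro exI[of _ F]) auto
  qed
  ultimately show ?thesis unfolding countable_subbase_def by simp
qed

text \<open>Complete regularity comes from the pullback description, so only the T0 property is
  left; distinct measures differ on some open set \<open>U\<close>, and a threshold on
  \<open>measure M U\<close> tells them apart.\<close>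

lemma nice_space_weak_topology:
  assumes X: "nice_space X"
  shows "nice_space (weak_topology X)"
proof -
  obtain \<B> where "countable \<B>" "\<And>V. V \<in> \<B> \<Longrightarrow> openin X V"
    "\<And>U x. openin X U \<Longrightarrow> x \<in> U \<Longrightarrow> \<exists>V\<in>\<B>. x \<in> V \<and> V \<subseteq> U"
    using X unfolding nice_space_def second_countable_def by meson
  from countable_subbase_weak_topology[OF X this]
  have "second_countable (weak_topology X)" by (rule countable_subbase_imp_second_countable)
  moreover have cr: "completely_regular_space (weak_topology X)"
    unfolding weak_topology_def
    by (intro completely_regular_pullback_topology completely_regular_space_product_topology[THEN iffD2] disjI2 ballI
      metrizable_imp_completely_regular_space metrizable_space_euclidean)
  moreover have "t0_space (weak_topology X)"
    unfolding t0_space_def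
  proof (intro ballI impI)
    fix M N assume MN: "M \<in> topspace (weak_topology X)" "N \<in> topspace (weak_topology X)" "M \<noteq> N"
    then obtain U where U: "openin X U" "measure M U \<noteq> measure N U"
      using prob_measures_eqI[of M X N] by auto
    let ?W = "\<lambda>r. {M \<in> prob_measures X. r < measure M U}"
    show "\<exists>W. openin (weak_topology X) W \<and> (M \<notin> W) = (N \<in> W)"
    proof (cases "measure M U < measure N U")
      case True
      then show ?thesis using openin_weak_topology_measure[OF X U(1)] MN
        by (intro exI[of _ "?W (measure M U)"]) auto
    next
      case False
      then show ?thesis using openin_weak_topology_measure[OF X U(1)] MN U(2)
        by (intro exI[of _ "?W (measure N U)"]) auto
    qed
  qed
  ultimately show ?thesis
    unfolding nice_space_def
    by (simp add: regular_t0_imp_Hausdorff_space completely_regular_imp_regular_space)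
qed

section \<open>Weak Borel sets and evaluation maps\<close>

lemma measurable_weak_topology_prob_algebra:
  assumes X: "nice_space X"
  shows "(\<lambda>M. M) \<in> borel_of (weak_topology X) \<rightarrow>\<^sub>M prob_algebra (borel_of X)"
proof (rule measurable_prob_algebra_generated[OF sets_borel_of])
  show "Int_stable {U. openin X U}" by (auto simp: Int_stable_def openin_Int)
  show "{U. openin X U} \<subseteq> Pow (topspace X)" by (auto dest: openin_subset)
  fix U assume "U \<in> {U. openin X U}"
  then have U: "openin X U" by simp
  have "(\<lambda>M. measure M U) \<in> borel_measurable (borel_of (weak_topology X))"
  proof (rule borel_measurableI_greater)
    fix r
    show "{M \<in> space (borel_of (weak_topology X)). r < measure M U} \<in> sets (borel_of (weak_topology X))"
      using openin_borel_of[OF openin_weak_topology_measure[OF X U]] by simp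
  qed
  then have "(\<lambda>M. ennreal (measure M U)) \<in> borel_measurable (borel_of (weak_topology X))" by simp
  then show "(\<lambda>M. emeasure M U) \<in> borel_measurable (borel_of (weak_topology X))"
    by (rule measurable_cong[THEN iffD1, rotated])
       (auto dest!: prob_measuresD(1) simp: finite_measure.emeasure_eq_measure prob_space.finite_measure)
qed (auto simp: prob_measuresD)

text \<open>Together with \<open>measurable_weak_topology_prob_algebra\<close> this identifies the
  Borel sigma-algebra of the weak topology with the one generated by the evaluations
  \<open>M \<mapsto> measure M A\<close>; only the countable subbase has to be tested.\<close>

lemma measurable_into_weak_topology:
  assumes X: "nice_space X" and K: "K \<in> N \<rightarrow>\<^sub>M prob_algebra (borel_of X)"
  shows "K \<in> N \<rightarrow>\<^sub>M borel_of (weak_topology X)"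
proof -
  obtain \<B> where \<B>: "countable \<B>" "\<And>V. V \<in> \<B> \<Longrightarrow> openin X V"
    "\<And>U x. openin X U \<Longrightarrow> x \<in> U \<Longrightarrow> \<exists>V\<in>\<B>. x \<in> V \<and> V \<subseteq> U"
    using X unfolding nice_space_def second_countable_def by meson
  show ?thesis
  proof (rule measurable_countable_subbase[OF countable_subbase_weak_topology[OF X \<B>]])
    show K': "K \<in> space N \<rightarrow> topspace (weak_topology X)"
      using measurable_space[OF K] by (auto simp: prob_measures_eq_space)
    fix V assume "V \<in> weak_subbase X \<B>"
    then obtain F q where V: "F \<subseteq> \<B>" "V = {M \<in> prob_measures X. q < measure M (\<Union>F)}"
      by (auto simp: weak_subbase_def)
    have "\<Union>F \<in> sets (borel_of X)" using V(1) \<B>(2) by (intro openin_borel_of openin_Union) auto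
    then have "(\<lambda>a. measure (K a) (\<Union>F)) \<in> borel_measurable N"
      using K measurable_measure_prob_algebra measurable_compose by blast
    then have "{a \<in> space N. q < measure (K a) (\<Union>F)} \<in> sets N" by measurable
    moreover have "K -` V \<inter> space N = {a \<in> space N. q < measure (K a) (\<Union>F)}"
      using K' V(2) by auto
    ultimately show "K -` V \<inter> space N \<in> sets N" by simp
  qed
qed

text \<open>For a merely Borel \<open>f\<close> the push-forward need not be weakly continuous; its
  measurability is read off in \<open>prob_algebra\<close>, where evaluations of the image are
  evaluations at preimages.\<close>

lemma measurable_distr_weak_topology:
  assumes "nice_space X" "nice_space Y" "f \<in> borel_of X \<rightarrow>\<^sub>M borel_of Y"
  shows "(\<lambda>M. distr M (borel_of Y) f) \<in> borel_of (weak_topology X) \<rightarrow>\<^sub>M borel_of (weak_topology Y)"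
  using measurable_compose[OF measurable_weak_topology_prob_algebra measurable_distr_prob_space] assms
  by (intro measurable_into_weak_topology) auto


subsection \<open>Souslin spaces and Blackwell's theorem\<close>

text \<open>\<open>agree n\<close> says that two codes share a cylinder of depth \<open>n\<close>;
  this relation replaces the topology of the Baire space.\<close>

definition agree :: "nat \<Rightarrow> (nat \<Rightarrow> nat) \<Rightarrow> (nat \<Rightarrow> nat) \<Rightarrow> bool" where
  "agree n a b \<longleftrightarrow> (\<forall>i<n. a i = b i)"

lemma agree_refl [simp]: "agree n a a" and agree_0 [simp]: "agree 0 a b"
  by (auto simp: agree_def)

lemma agree_sym: "agree n a b \<Longrightarrow> agree n b a"
  by (simp add: agree_def)

lemma agree_trans: "agree n a b \<Longrightarrow> agree n b c \<Longrightarrow> agree n a c"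
  by (simp add: agree_def)

lemma agree_mono: "agree n a b \<Longrightarrow> m \<le> n \<Longrightarrow> agree m a b"
  by (simp add: agree_def)

definition closed_pred :: "(nat \<Rightarrow> nat) set \<Rightarrow> ((nat \<Rightarrow> nat) \<Rightarrow> bool) \<Rightarrow> bool" where
  "closed_pred F Q \<longleftrightarrow> (\<forall>a\<in>F. (\<forall>n. \<exists>b\<in>F. agree n a b \<and> Q b) \<longrightarrow> Q a)"

definition clopen_pred :: "(nat \<Rightarrow> nat) set \<Rightarrow> ((nat \<Rightarrow> nat) \<Rightarrow> bool) \<Rightarrow> bool" where
  "clopen_pred F Q \<longleftrightarrow> (\<forall>a\<in>F. \<exists>n. \<forall>b\<in>F. agree n a b \<longrightarrow> Q b = Q a)"

text \<open>Combinatorial form of: \<open>F\<close> is closed in the Baire space and \<open>g\<close> is a continuous map from \<open>F\<close> onto \<open>X\<close>.\<close>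
definition baire_param :: "'x topology \<Rightarrow> (nat \<Rightarrow> nat) set \<Rightarrow> ((nat \<Rightarrow> nat) \<Rightarrow> 'x) \<Rightarrow> bool" where
  "baire_param X F g \<longleftrightarrow>
     (\<forall>a. (\<forall>n. \<exists>b\<in>F. agree n a b) \<longrightarrow> a \<in> F) \<and> g ` F = topspace X \<and>
     (\<forall>U a. openin X U \<longrightarrow> a \<in> F \<longrightarrow> g a \<in> U \<longrightarrow> (\<exists>n. \<forall>b\<in>F. agree n a b \<longrightarrow> g b \<in> U))"

lemma baire_paramD:
  assumes "baire_param X F g"
  shows "(\<And>n. \<exists>b\<in>F. agree n a b) \<Longrightarrow> a \<in> F"
    and "g ` F = topspace X"
    and "openin X U \<Longrightarrow> a \<in> F \<Longrightarrow> g a \<in> U \<Longrightarrow> \<exists>n. \<forall>b\<in>F. agree n a b \<longrightarrow> g b \<in> U"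
  using assms unfolding baire_param_def by simp_all

lemma closed_pred_closedin:
  assumes "baire_param X F g" "closedin X K"
  shows "closed_pred F (\<lambda>a. g a \<in> K)"
  unfolding closed_pred_def
proof (intro ballI impI, rule ccontr)
  fix a assume a: "a \<in> F" "\<forall>n. \<exists>b\<in>F. agree n a b \<and> g b \<in> K" "g a \<notin> K"
  have "openin X (topspace X - K)" using assms(2) by (simp add: closedin_def)
  moreover have "g a \<in> topspace X - K" using a baire_paramD(2)[OF assms(1)] by blast
  ultimately obtain n where "\<forall>b\<in>F. agree n a b \<longrightarrow> g b \<in> topspace X - K"
    using baire_paramD(3)[OF assms(1) _ a(1)] by blast
  then show False using a(2) by blast
qed

lemma clopen_imp_closed_pred: "clopen_pred F Q \<Longrightarrow> closed_pred F Q"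
  unfolding clopen_pred_def closed_pred_def by blast

lemma clopen_pred_not: "clopen_pred F Q \<Longrightarrow> clopen_pred F (\<lambda>a. \<not> Q a)"
  unfolding clopen_pred_def by blast

lemma clopen_pred_cong: "(\<And>a. a \<in> F \<Longrightarrow> P a = Q a) \<Longrightarrow> clopen_pred F P = clopen_pred F Q"
  unfolding clopen_pred_def by (intro ball_cong ex_cong refl) simp

lemma closed_pred_ball:
  "(\<And>k. closed_pred F (Q k)) \<Longrightarrow> closed_pred F (\<lambda>a. \<forall>k. Q k a)"
  unfolding closed_pred_def by blast

text \<open>\<open>sect\<close> and \<open>join_sects\<close> are the two directions of the
  homeomorphism between the Baire space and its countable power, given by pairing the
  indices.\<close>

definition sect :: "nat \<Rightarrow> (nat \<Rightarrow> nat) \<Rightarrow> nat \<Rightarrow> nat" where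
  "sect k a n = a (prod_encode (k, n))"

definition join_sects :: "(nat \<Rightarrow> nat \<Rightarrow> nat) \<Rightarrow> nat \<Rightarrow> nat" where
  "join_sects s m = (case prod_decode m of (k, n) \<Rightarrow> s k n)"

lemma sect_join_sects [simp]: "sect k (join_sects s) = s k"
  by (rule ext) (simp add: sect_def join_sects_def)

text \<open>The first \<open>n\<close> entries of a section sit at finitely many positions, so
  taking a section is uniformly continuous.\<close>

lemma agree_sect: "\<exists>N. \<forall>a b. agree N a b \<longrightarrow> agree n (sect k a) (sect k b)"
proof -
  have "finite ((\<lambda>i. prod_encode (k, i)) ` {..<n})" by simp
  then obtain N where "\<forall>m\<in>(\<lambda>i. prod_encode (k, i)) ` {..<n}. m < N"
    unfolding finite_nat_set_iff_bounded by blast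
  then show ?thesis by (intro exI[of _ N]) (auto simp: agree_def sect_def)
qed

lemma clopen_pred_sect:
  assumes "clopen_pred F Q" "\<And>a. a \<in> G \<Longrightarrow> sect k a \<in> F"
  shows "clopen_pred G (\<lambda>a. Q (sect k a))"
  unfolding clopen_pred_def
proof
  fix a assume a: "a \<in> G"
  then obtain n where n: "\<forall>b\<in>F. agree n (sect k a) b \<longrightarrow> Q b = Q (sect k a)"
    using assms unfolding clopen_pred_def by blast
  obtain N where "\<forall>a b. agree N a b \<longrightarrow> agree n (sect k a) (sect k b)" using agree_sect by blast
  then show "\<exists>n. \<forall>b\<in>G. agree n a b \<longrightarrow> Q (sect k b) = Q (sect k a)"
    using n assms(2) by (intro exI[of _ N]) blast
qed

section \<open>Fibre products, products and unions of parametrisations\<close>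

lemma sect_limit:
  assumes F: "baire_param X F g" and G: "\<And>a. a \<in> G \<Longrightarrow> sect k a \<in> F"
    and a: "\<And>n. \<exists>b\<in>G. agree n a b"
  shows "sect k a \<in> F"
proof (rule baire_paramD(1)[OF F])
  fix n
  obtain N where N: "\<forall>a b. agree N a b \<longrightarrow> agree n (sect k a) (sect k b)" using agree_sect by blast
  then show "\<exists>b\<in>F. agree n (sect k a) b" using a[of N] G by blast
qed

lemma sect_continuous:
  assumes F: "baire_param X F g" and G: "\<And>a. a \<in> G \<Longrightarrow> sect k a \<in> F"
    and U: "openin X U" "sect k a \<in> F" "g (sect k a) \<in> U"
  shows "\<exists>n. \<forall>b\<in>G. agree n a b \<longrightarrow> g (sect k b) \<in> U"
proof -
  obtain n where n: "\<forall>b\<in>F. agree n (sect k a) b \<longrightarrow> g b \<in> U"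
    using baire_paramD(3)[OF F U(1), of "sect k a"] U(2,3) by meson
  obtain N where N: "\<forall>a b. agree N a b \<longrightarrow> agree n (sect k a) (sect k b)" using agree_sect by blast
  show ?thesis
  proof (intro exI ballI impI)
    fix b assume "b \<in> G" "agree N a b"
    then show "g (sect k b) \<in> U" using n N G by simp
  qed
qed

text \<open>A code of the fibre product is a sequence of codes, one from each parametrisation,
  naming the same point. Every set made clopen by one factor stays clopen because sections are
  continuous; in this way countably many Borel sets become clopen at once.\<close>

lemma baire_param_fibre_product:
  assumes X: "Hausdorff_space X" and Fg: "\<And>k::nat. baire_param X (F k) (g k)"
  obtains G \<gamma> where "baire_param X G \<gamma>"
    "\<forall>k C. clopen_pred (F k) (\<lambda>a. g k a \<in> C) \<longrightarrow> clopen_pred G (\<lambda>a. \<gamma> a \<in> C)"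
proof -
  define G where "G = {a. (\<forall>k. sect k a \<in> F k) \<and> (\<forall>k. g k (sect k a) = g 0 (sect 0 a))}"
  define \<gamma> where "\<gamma> a = g 0 (sect 0 a)" for a
  have GF: "sect k a \<in> F k" "g k (sect k a) = \<gamma> a" if "a \<in> G" for a k
    using that unfolding G_def \<gamma>_def by blast+
  have "baire_param X G \<gamma>"
    unfolding baire_param_def
  proof (intro conjI allI impI)
    fix a assume a: "\<forall>n. \<exists>b\<in>G. agree n a b"
    have s: "sect k a \<in> F k" for k
      using sect_limit[OF Fg[of k], of G k a] GF(1) a by blast
    moreover have "g k (sect k a) = g 0 (sect 0 a)" for k
    proof (rule ccontr)
      \<comment> \<open>Two different values would have disjoint neighbourhoods, yet a code of
        \<open>G\<close> close to \<open>a\<close> sends both sections to the same point.\<close>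
      assume ne: "g k (sect k a) \<noteq> g 0 (sect 0 a)"
      have "g k (sect k a) \<in> topspace X" "g 0 (sect 0 a) \<in> topspace X"
        using s baire_paramD(2)[OF Fg] by blast+
      then obtain U V where UV: "openin X U" "openin X V" "g k (sect k a) \<in> U" "g 0 (sect 0 a) \<in> V" "disjnt U V"
        using X ne unfolding Hausdorff_space_def by blast
      obtain n where n: "\<forall>b\<in>G. agree n a b \<longrightarrow> g k (sect k b) \<in> U"
        using sect_continuous[OF Fg[of k] GF(1) UV(1) s UV(3)] by blast
      obtain m where m: "\<forall>b\<in>G. agree m a b \<longrightarrow> g 0 (sect 0 b) \<in> V"
        using sect_continuous[OF Fg[of 0] GF(1) UV(2) s UV(4)] by blast
      obtain b where b: "b \<in> G" "agree (max n m) a b" using a by blast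
      then have "agree n a b" "agree m a b" by (auto intro: agree_mono)
      then have "\<gamma> b \<in> U" "\<gamma> b \<in> V" using n m b(1) GF(2)[OF b(1)] by metis+
      then show False using UV(5) by (auto simp: disjnt_def)
    qed
    ultimately show "a \<in> G" unfolding G_def by blast
  next
    show "\<gamma> ` G = topspace X"
    proof (intro equalityI subsetI)
      fix x assume "x \<in> topspace X"
      then have "\<forall>k. \<exists>a. a \<in> F k \<and> g k a = x" using baire_paramD(2)[OF Fg] by (metis imageE)
      then obtain s where s: "\<And>k. s k \<in> F k \<and> g k (s k) = x" by metis
      then have "join_sects s \<in> G" "\<gamma> (join_sects s) = x" by (auto simp: G_def \<gamma>_def)
      then show "x \<in> \<gamma> ` G" by blast
    next
      fix x assume "x \<in> \<gamma> ` G"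
      then obtain a where "a \<in> G" "x = g 0 (sect 0 a)" by (auto simp: \<gamma>_def)
      then show "x \<in> topspace X" using GF(1)[of a 0] baire_paramD(2)[OF Fg[of 0]] by blast
    qed
  next
    fix U a assume "openin X U" "a \<in> G" "\<gamma> a \<in> U"
    then show "\<exists>n. \<forall>b\<in>G. agree n a b \<longrightarrow> \<gamma> b \<in> U"
      using sect_continuous[OF Fg[of 0] GF(1), of G] GF(1)[of a 0] unfolding \<gamma>_def by blast
  qed
  moreover have "clopen_pred G (\<lambda>a. \<gamma> a \<in> C)" if "clopen_pred (F k) (\<lambda>a. g k a \<in> C)" for k C
  proof -
    have "clopen_pred G (\<lambda>a. g k (sect k a) \<in> C)"
      by (rule clopen_pred_sect[OF that]) (rule GF)
    then show ?thesis unfolding clopen_pred_def using GF(2) by simp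
  qed
  ultimately show ?thesis using that by blast
qed

lemma baire_param_prod:
  assumes X: "baire_param X F g" and Y: "baire_param Y H h"
  shows "\<exists>G \<gamma>. baire_param (prod_topology X Y) G \<gamma>"
proof -
  \<comment> \<open>Only sections 0 and 1 carry data; the other sections are unconstrained.\<close>
  define G where "G = {a. sect 0 a \<in> F \<and> sect 1 a \<in> H}"
  define \<gamma> where "\<gamma> a = (g (sect 0 a), h (sect 1 a))" for a
  have G: "a \<in> G \<Longrightarrow> sect 0 a \<in> F" "a \<in> G \<Longrightarrow> sect 1 a \<in> H" for a by (auto simp: G_def)
  have "baire_param (prod_topology X Y) G \<gamma>"
    unfolding baire_param_def
  proof (intro conjI allI impI)
    fix a assume a: "\<forall>n. \<exists>b\<in>G. agree n a b"
    have "sect 0 a \<in> F" by (rule sect_limit[OF X G(1)]) (use a in auto)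
    moreover have "sect 1 a \<in> H" by (rule sect_limit[OF Y G(2)]) (use a in auto)
    ultimately show "a \<in> G" by (simp add: G_def)
  next
    have "(x, y) \<in> \<gamma> ` G" if xy: "x \<in> topspace X" "y \<in> topspace Y" for x y
    proof -
      obtain a where a: "a \<in> F" "g a = x" using baire_paramD(2)[OF X] xy(1) by (metis imageE)
      obtain b where b: "b \<in> H" "h b = y" using baire_paramD(2)[OF Y] xy(2) by (metis imageE)
      have "join_sects (\<lambda>k. if k = 0 then a else b) \<in> G"
        "\<gamma> (join_sects (\<lambda>k. if k = 0 then a else b)) = (x, y)"
        using a b by (auto simp: G_def \<gamma>_def)
      then show ?thesis by (metis imageI)
    qed
    moreover have "\<gamma> a \<in> topspace X \<times> topspace Y" if "a \<in> G" for a
      using G[OF that] baire_paramD(2)[OF X] baire_paramD(2)[OF Y] by (auto simp: \<gamma>_def)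
    ultimately show "\<gamma> ` G = topspace (prod_topology X Y)"
      unfolding topspace_prod_topology by (intro equalityI subsetI) (blast, force)
  next
    fix W a assume W: "openin (prod_topology X Y) W" "a \<in> G" "\<gamma> a \<in> W"
    then obtain U V where UV: "openin X U" "openin Y V" "g (sect 0 a) \<in> U" "h (sect 1 a) \<in> V" "U \<times> V \<subseteq> W"
      using W(1)[unfolded openin_prod_topology_alt, rule_format, of "g (sect 0 a)" "h (sect 1 a)"]
      unfolding \<gamma>_def by blast
    obtain n where n: "\<forall>b\<in>G. agree n a b \<longrightarrow> g (sect 0 b) \<in> U"
      using sect_continuous[OF X G(1) UV(1) G(1)[OF W(2)] UV(3)] by blast
    obtain m where m: "\<forall>b\<in>G. agree m a b \<longrightarrow> h (sect 1 b) \<in> V"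
      using sect_continuous[OF Y G(2) UV(2) G(2)[OF W(2)] UV(4)] by blast
    have "\<gamma> b \<in> W" if "b \<in> G" "agree (max n m) a b" for b
    proof -
      have "agree n a b" "agree m a b" using that(2) by (auto intro: agree_mono)
      then show ?thesis using n m that(1) UV(5) unfolding \<gamma>_def by blast
    qed
    then show "\<exists>n. \<forall>b\<in>G. agree n a b \<longrightarrow> \<gamma> b \<in> W" by blast
  qed
  then show ?thesis by blast
qed

text \<open>The first digit of a new code records a piece \<open>K k\<close> containing the point, or \<open>0\<close> if there is none.\<close>
lemma baire_param_union:
  assumes Fg: "baire_param X F g"
    and K: "\<And>k::nat. closed_pred F (\<lambda>a. g a \<in> K k)" and nK: "closed_pred F (\<lambda>a. g a \<notin> (\<Union>k. K k))"
  obtains G \<gamma> where "baire_param X G \<gamma>" "clopen_pred G (\<lambda>a. \<gamma> a \<in> (\<Union>k. K k))"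
proof -
  define tl where "tl a = (\<lambda>n. a (Suc n))" for a :: "nat \<Rightarrow> nat"
  define Q where "Q d x = (case d of 0 \<Rightarrow> x \<notin> (\<Union>k. K k) | Suc k \<Rightarrow> x \<in> K k)" for d x
  define G where "G = {a. tl a \<in> F \<and> Q (a 0) (g (tl a))}"
  define \<gamma> where "\<gamma> a = g (tl a)" for a
  have ag: "agree n (tl a) (tl b)" "a 0 = b 0" if "agree (Suc n) a b" for a b n
    using that by (auto simp: agree_def tl_def)
  have Q: "closed_pred F (\<lambda>a. Q d (g a))" for d
    using K nK by (cases d) (auto simp: Q_def)
  have "baire_param X G \<gamma>"
    unfolding baire_param_def
  proof (intro conjI allI impI)
    fix a assume a: "\<forall>n. \<exists>b\<in>G. agree n a b"
    have lim: "\<exists>b\<in>F. agree n (tl a) b \<and> Q (a 0) (g b)" for n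
    proof -
      obtain b where b: "b \<in> G" "agree (Suc n) a b" using a by blast
      show ?thesis using b(1) ag[OF b(2)] by (intro bexI[of _ "tl b"]) (auto simp: G_def)
    qed
    have "tl a \<in> F" by (rule baire_paramD(1)[OF Fg]) (use lim in blast)
    moreover have "Q (a 0) (g (tl a))"
      using Q lim \<open>tl a \<in> F\<close> unfolding closed_pred_def by blast
    ultimately show "a \<in> G" unfolding G_def by (intro CollectI conjI)
  next
    have "x \<in> \<gamma> ` G" if x: "x \<in> topspace X" for x
    proof -
      have "x \<in> g ` F" using x by (simp only: baire_paramD(2)[OF Fg])
      then obtain a where a: "a \<in> F" "g a = x" by (rule imageE) simp
      have "\<exists>d. Q d x"
      proof (cases "x \<in> (\<Union>k. K k)")
        case True
        then obtain k where "x \<in> K k" by blast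
        then show ?thesis by (intro exI[of _ "Suc k"]) (simp add: Q_def)
      next
        case False
        then show ?thesis by (intro exI[of _ 0]) (simp add: Q_def)
      qed
      then obtain d where d: "Q d x" by blast
      have "tl (case_nat d a) = a" by (simp add: tl_def)
      then have "case_nat d a \<in> G" "\<gamma> (case_nat d a) = x" using a d by (auto simp: G_def \<gamma>_def)
      then show ?thesis by (metis imageI)
    qed
    then show "\<gamma> ` G = topspace X" using baire_paramD(2)[OF Fg] by (auto simp: G_def \<gamma>_def)
  next
    fix U a assume U: "openin X U" "a \<in> G" "\<gamma> a \<in> U"
    then obtain n where n: "\<forall>b\<in>F. agree n (tl a) b \<longrightarrow> g b \<in> U"
      using baire_paramD(3)[OF Fg U(1)] unfolding G_def \<gamma>_def by blast
    show "\<exists>n. \<forall>b\<in>G. agree n a b \<longrightarrow> \<gamma> b \<in> U"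
      using n ag by (intro exI[of _ "Suc n"]) (auto simp: G_def \<gamma>_def)
  qed
  moreover have "clopen_pred G (\<lambda>a. \<gamma> a \<in> (\<Union>k. K k))"
    unfolding clopen_pred_def
  proof
    fix a assume "a \<in> G"
    \<comment> \<open>A point in several pieces has several codes, but every one of them starts with
      a nonzero digit, so a cylinder of depth 1 decides membership.\<close>
    have *: "\<gamma> b \<in> (\<Union>k. K k) \<longleftrightarrow> b 0 \<noteq> 0" if "b \<in> G" for b
      using that by (cases "b 0") (auto simp: G_def \<gamma>_def Q_def)
    show "\<exists>n. \<forall>b\<in>G. agree n a b \<longrightarrow> (\<gamma> b \<in> (\<Union>k. K k)) = (\<gamma> a \<in> (\<Union>k. K k))"
      using ag(2)[of 0] * \<open>a \<in> G\<close> by (intro exI[of _ "Suc 0"]) metis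
  qed
  ultimately show ?thesis using that by blast
qed

text \<open>This is the theorem that a Borel set becomes clopen in a finer Polish topology, stated
  for codes instead of points. Complements are free since clopenness is symmetric; open sets are
  countable unions of closed sets; for a countable union all members are first made clopen at once,
  after which the pieces and the complement of the union are closed, as
  \<open>baire_param_union\<close> demands.\<close>

lemma borel_clopen_param:
  assumes X: "nice_space X" and F0: "baire_param X F0 g0" and C: "C \<in> sets (borel_of X)"
  shows "\<exists>F g. baire_param X F g \<and> clopen_pred F (\<lambda>a. g a \<in> C)"
  using C unfolding sets_borel_of
proof (induction rule: sigma_sets.induct)
  case (Basic U)
  then have U: "openin X U" by simp
  obtain u :: "nat \<Rightarrow> 'a \<Rightarrow> real" where u: "\<And>n. continuous_map X euclideanreal (u n)"
    "\<And>n x. x \<in> topspace X \<Longrightarrow> 0 \<le> u n x \<and> u n x \<le> indicator U x"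
    "\<And>x. x \<in> topspace X \<Longrightarrow> (\<lambda>n. u n x) \<longlonglongrightarrow> indicator U x"
    using indicator_approx[OF X U] by metis
  \<comment> \<open>The threshold 1/2 lies strictly between the two values of the indicator, so the
    pieces stay inside \<open>U\<close> and exhaust it.\<close>
  define K where "K n = {x \<in> topspace X. 1/2 \<le> u n x}" for n
  have K: "closedin X (K n)" for n
    using u(1)[of n] unfolding K_def continuous_map_upper_lower_semicontinuous_le by blast
  have UK: "U = (\<Union>n. K n)"
  proof (intro equalityI subsetI)
    fix x assume x: "x \<in> U"
    then have xt: "x \<in> topspace X" using openin_subset[OF U] by blast
    then have "(\<lambda>n. u n x) \<longlonglongrightarrow> 1" using u(3)[of x] x by simp
    from order_tendstoD(1)[OF this, of "1/2"] obtain n where "1/2 < u n x"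
      by (auto simp: eventually_sequentially)
    then show "x \<in> (\<Union>n. K n)" using xt by (auto simp: K_def intro!: exI[of _ n])
  next
    fix x assume "x \<in> (\<Union>n. K n)"
    then obtain n where "x \<in> topspace X" "1/2 \<le> u n x" by (auto simp: K_def)
    then show "x \<in> U" using u(2)[of x n] by (cases "x \<in> U") auto
  qed
  have "closed_pred F0 (\<lambda>a. g0 a \<in> topspace X - U)"
    by (rule closed_pred_closedin[OF F0]) (use U in auto)
  then have "closed_pred F0 (\<lambda>a. g0 a \<notin> (\<Union>n. K n))"
    using baire_paramD(2)[OF F0] unfolding closed_pred_def UK[symmetric] by blast
  from baire_param_union[OF F0 closed_pred_closedin[OF F0 K] this]
  obtain F g where "baire_param X F g" "clopen_pred F (\<lambda>a. g a \<in> (\<Union>n. K n))" .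
  then show ?case unfolding UK[symmetric] by (intro exI conjI)
next
  case Empty
  then show ?case using F0 by (intro exI[of _ F0] exI[of _ g0]) (auto simp: clopen_pred_def)
next
  case (Compl C)
  from Compl.IH obtain F g where F: "baire_param X F g" "clopen_pred F (\<lambda>a. g a \<in> C)"
    by (elim exE conjE)
  have "g a \<in> topspace X - C \<longleftrightarrow> \<not> g a \<in> C" if "a \<in> F" for a
    using that baire_paramD(2)[OF F(1)] by blast
  from clopen_pred_cong[OF this] have "clopen_pred F (\<lambda>a. g a \<in> topspace X - C)"
    using clopen_pred_not[OF F(2)] by simp
  then show ?case using F(1) by (intro exI conjI)
next
  case (Union C)
  from Union.IH have "\<forall>k. \<exists>F g. baire_param X F g \<and> clopen_pred F (\<lambda>a. g a \<in> C k)" by (intro allI)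
  from choice[OF this] obtain F where "\<forall>k. \<exists>g. baire_param X (F k) g \<and> clopen_pred (F k) (\<lambda>a. g a \<in> C k)" ..
  from choice[OF this] obtain g where Fg: "\<And>k. baire_param X (F k) (g k)" "\<And>k. clopen_pred (F k) (\<lambda>a. g k a \<in> C k)"
    by auto
  have "Hausdorff_space X" using X by (simp add: nice_space_def)
  from baire_param_fibre_product[OF this Fg(1)] obtain G \<gamma> where
    G: "baire_param X G \<gamma>" and cl: "\<forall>k C. clopen_pred (F k) (\<lambda>a. g k a \<in> C) \<longrightarrow> clopen_pred G (\<lambda>a. \<gamma> a \<in> C)" .
  have "closed_pred G (\<lambda>a. \<gamma> a \<in> C k)" for k using cl[rule_format, OF Fg(2)] by (rule clopen_imp_closed_pred)
  moreover have "closed_pred G (\<lambda>a. \<forall>k. \<gamma> a \<notin> C k)"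
    by (rule closed_pred_ball[of G "\<lambda>k a. \<gamma> a \<notin> C k"], rule clopen_imp_closed_pred, rule clopen_pred_not, rule cl[rule_format], rule Fg(2))
  moreover have "(\<lambda>a. \<gamma> a \<notin> (\<Union>k. C k)) = (\<lambda>a. \<forall>k. \<gamma> a \<notin> C k)" by auto
  ultimately have "\<And>k. closed_pred G (\<lambda>a. \<gamma> a \<in> C k)" "closed_pred G (\<lambda>a. \<gamma> a \<notin> (\<Union>k. C k))" by simp_all
  from baire_param_union[OF G this]
  obtain F g where "baire_param X F g" "clopen_pred F (\<lambda>a. g a \<in> (\<Union>n. C n))" .
  then show ?case by (intro exI conjI)
qed

text \<open>Lusin's separation argument: if \<open>E\<close> could not be separated from its complement by
  a set generated by the \<open>D k\<close>, then nested pairs of inseparable cylinders would shrink to two points that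
  no \<open>D k\<close> distinguishes.\<close>
theorem blackwell:
  assumes X: "nice_space X" and F0: "baire_param X F0 g0"
    and D: "\<And>k::nat. D k \<in> sets (borel_of X)"
    and sep: "\<And>x y. x \<in> topspace X \<Longrightarrow> y \<in> topspace X \<Longrightarrow> x \<noteq> y \<Longrightarrow> \<exists>k. (x \<in> D k) \<noteq> (y \<in> D k)"
  shows "sets (borel_of X) = sigma_sets (topspace X) (range D)"
proof
  have Dsub: "D k \<subseteq> topspace X" for k using sets.sets_into_space[OF D] by simp
  interpret \<Sigma>: sigma_algebra "topspace X" "sigma_sets (topspace X) (range D)"
    by (rule sigma_algebra_sigma_sets) (use Dsub in auto)
  let ?\<Sigma> = "sigma_sets (topspace X) (range D)"
  show "?\<Sigma> \<subseteq> sets (borel_of X)"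
    using sets.sigma_sets_subset[of "range D" "borel_of X"] D by auto
  show "sets (borel_of X) \<subseteq> ?\<Sigma>"
  proof (rule subsetI, rule ccontr)
    fix E assume E: "E \<in> sets (borel_of X)" and notin: "E \<notin> ?\<Sigma>"
    have Esub: "E \<subseteq> topspace X" using sets.sets_into_space[OF E] by simp
    \<comment> \<open>\<open>E\<close> is put in front of the \<open>D k\<close>, so that a single
      parametrisation makes all of them clopen; limits of codes then cannot leave \<open>E\<close>
      or its complement.\<close>
    define C where "C k = (case k of 0 \<Rightarrow> E | Suc j \<Rightarrow> D j)" for k
    have "C k \<in> sets (borel_of X)" for k using D E by (simp add: C_def split: nat.split)
    from borel_clopen_param[OF X F0 this]
    have "\<forall>k. \<exists>F g. baire_param X F g \<and> clopen_pred F (\<lambda>a. g a \<in> C k)" by (intro allI)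
    from choice[OF this] obtain F where "\<forall>k. \<exists>g. baire_param X (F k) g \<and> clopen_pred (F k) (\<lambda>a. g a \<in> C k)" ..
    from choice[OF this] obtain g where Fg: "\<And>k. baire_param X (F k) (g k)" "\<And>k. clopen_pred (F k) (\<lambda>a. g k a \<in> C k)"
      by auto
    have "Hausdorff_space X" using X by (simp add: nice_space_def)
    from baire_param_fibre_product[OF this Fg(1)] obtain G \<gamma> where
      G: "baire_param X G \<gamma>" and cl: "\<forall>k C. clopen_pred (F k) (\<lambda>a. g k a \<in> C) \<longrightarrow> clopen_pred G (\<lambda>a. \<gamma> a \<in> C)" .
    have clE: "clopen_pred G (\<lambda>a. \<gamma> a \<in> E)" using cl[rule_format, OF Fg(2)[of 0]] by (simp add: C_def)
    have clD: "clopen_pred G (\<lambda>a. \<gamma> a \<in> D j)" for j using cl[rule_format, OF Fg(2)[of "Suc j"]] by (simp add: C_def)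
    have \<gamma>: "\<gamma> a \<in> topspace X" if "a \<in> G" for a using baire_paramD(2)[OF G] that by blast
    define separable where "separable A B \<longleftrightarrow> (\<exists>W\<in>?\<Sigma>. A \<subseteq> W \<and> W \<inter> B = {})" for A B
    define P where "P n a = \<gamma> ` {c \<in> G. agree n a c \<and> \<gamma> c \<in> E}" for n a
    define N where "N n b = \<gamma> ` {c \<in> G. agree n b c \<and> \<gamma> c \<notin> E}" for n b
    have PN_cong: "P n a = P n a'" "N n a = N n a'" if "agree n a a'" for n a a'
      unfolding P_def N_def using that agree_trans agree_sym by blast+
    \<comment> \<open>If \<open>W i j\<close> separates each pair, then
      \<open>\<Union>i. \<Inter>j. W i j\<close> separates the unions. Read backwards: an
      inseparable pair of unions has an inseparable pair of members.\<close>
    have sep_UN: "separable (\<Union>i. A i) (\<Union>j. B j)" if "\<And>i j. separable (A i) (B j)"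
      for A B :: "nat \<Rightarrow> 'a set"
    proof -
      have "\<forall>i j. \<exists>W. W \<in> ?\<Sigma> \<and> A i \<subseteq> W \<and> W \<inter> B j = {}" using that unfolding separable_def by blast
      then obtain W where W: "\<And>i j. W i j \<in> ?\<Sigma>" "\<And>i j. A i \<subseteq> W i j" "\<And>i j. W i j \<inter> B j = {}" by metis
      have "(\<Union>i. \<Inter>j. W i j) \<in> ?\<Sigma>"
        using W(1) by (intro \<Sigma>.countable_UN \<Sigma>.countable_INT) auto
      moreover have "(\<Union>i. A i) \<subseteq> (\<Union>i. \<Inter>j. W i j)" using W(2) by blast
      moreover have "(\<Union>i. \<Inter>j. W i j) \<inter> (\<Union>j. B j) = {}" using W(3) by blast
      ultimately show ?thesis unfolding separable_def by blast
    qed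
    define Bad where "Bad n p \<longleftrightarrow> \<not> separable (P n (fst p)) (N n (snd p))" for n p
    have step: "\<exists>q. Bad (Suc n) q \<and> agree n (fst p) (fst q) \<and> agree n (snd p) (snd q)" if bad_p: "Bad n p" for n p
    proof -
      obtain a b where p: "p = (a, b)" by fastforce
      \<comment> \<open>Fixing digit \<open>n\<close> splits a cylinder of depth \<open>n\<close>
        into countably many of depth \<open>n + 1\<close>, so some pair of refinements stays
        inseparable.\<close>
      have cyl: "agree n a c \<longleftrightarrow> (\<exists>i. agree (Suc n) (a(n := i)) c)" for a c
        by (auto simp: agree_def less_Suc_eq)
      have "{c \<in> G. agree n a c \<and> \<gamma> c \<in> E} = (\<Union>i. {c \<in> G. agree (Suc n) (a(n := i)) c \<and> \<gamma> c \<in> E})"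
        "{c \<in> G. agree n b c \<and> \<gamma> c \<notin> E} = (\<Union>i. {c \<in> G. agree (Suc n) (b(n := i)) c \<and> \<gamma> c \<notin> E})"
        unfolding cyl[of a] cyl[of b] by auto
      then have eqs: "P n a = (\<Union>i. P (Suc n) (a(n := i)))" "N n b = (\<Union>j. N (Suc n) (b(n := j)))"
        unfolding P_def N_def by (simp_all only: image_UN)
      have "\<exists>i j. \<not> separable (P (Suc n) (a(n := i))) (N (Suc n) (b(n := j)))"
      proof (rule ccontr)
        assume "\<nexists>i j. \<not> separable (P (Suc n) (a(n := i))) (N (Suc n) (b(n := j)))"
        then have "\<And>i j. separable (P (Suc n) (a(n := i))) (N (Suc n) (b(n := j)))" by simp
        from sep_UN[OF this] bad_p show False by (simp add: Bad_def p eqs)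
      qed
      then obtain i j where "\<not> separable (P (Suc n) (a(n := i))) (N (Suc n) (b(n := j)))" by (elim exE)
      then show ?thesis
        by (intro exI[of _ "(a(n := i), b(n := j))"]) (auto simp: Bad_def p agree_def)
    qed
    \<comment> \<open>Depth 0 imposes no restriction, so any two codes start the construction; a set
      separating \<open>E\<close> from its complement would be \<open>E\<close> itself.\<close>
    have "Bad 0 (a, b)" for a b
    proof -
      have eqs: "P 0 a = E" "N 0 b = topspace X - E"
        unfolding P_def N_def using baire_paramD(2)[OF G] Esub by auto
      show ?thesis unfolding Bad_def
      proof
        assume "separable (P 0 (fst (a, b))) (N 0 (snd (a, b)))"
        then obtain W where W: "W \<in> ?\<Sigma>" "E \<subseteq> W" "W \<inter> (topspace X - E) = {}"
          unfolding separable_def by (auto simp: eqs)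
        then have "W = E" using \<Sigma>.sets_into_space[OF W(1)] by blast
        then show False using W(1) notin by simp
      qed
    qed
    then have "\<exists>p. Bad 0 p" by blast
    from dependent_nat_choice[of Bad "\<lambda>n p q. agree n (fst p) (fst q) \<and> agree n (snd p) (snd q)", OF this step]
    obtain s where s: "\<And>n. Bad n (s n)"
      "\<And>n. agree n (fst (s n)) (fst (s (Suc n))) \<and> agree n (snd (s n)) (snd (s (Suc n)))" by metis
    \<comment> \<open>Digit \<open>i\<close> is fixed from stage \<open>i + 1\<close> on, so the
      diagonal code agrees with stage \<open>n\<close> on its first \<open>n\<close> digits.\<close>
    define a where "a i = fst (s (Suc i)) i" for i
    define b where "b i = snd (s (Suc i)) i" for i
    have lim: "agree n (fst (s n)) a \<and> agree n (snd (s n)) b" for n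
    proof (induction n)
      case (Suc n)
      have "fst (s (Suc n)) i = a i \<and> snd (s (Suc n)) i = b i" if "i < Suc n" for i
      proof (cases "i = n")
        case False
        then show ?thesis using that Suc s(2)[of n] by (simp add: agree_def less_Suc_eq)
      qed (simp add: a_def b_def)
      then show ?case by (auto simp: agree_def)
    qed simp
    have bad: "\<not> separable (P n a) (N n b)" for n
      using s(1)[of n] PN_cong lim[of n] unfolding Bad_def by metis
    \<comment> \<open>If one side were empty, the empty set or the whole space would separate the
      pair. Nonemptiness gives codes of \<open>G\<close> arbitrarily close to \<open>a\<close> and
      \<open>b\<close>.\<close>
    have ne: "P n a \<noteq> {}" "N n b \<noteq> {}" for n
    proof -
      show "P n a \<noteq> {}"
      proof
        assume "P n a = {}"
        then have "separable (P n a) (N n b)" unfolding separable_def by (intro bexI[of _ "{}"]) auto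
        then show False using bad by blast
      qed
      show "N n b \<noteq> {}"
      proof
        assume "N n b = {}"
        then have "separable (P n a) (N n b)"
          unfolding separable_def P_def using \<gamma> by (intro bexI[of _ "topspace X"]) auto
        then show False using bad by blast
      qed
    qed
    have exa: "\<exists>c\<in>G. agree n a c \<and> \<gamma> c \<in> E" and exb: "\<exists>c\<in>G. agree n b c \<and> \<gamma> c \<notin> E" for n
      using ne[of n] unfolding P_def N_def by blast+
    have aG: "a \<in> G" by (rule baire_paramD(1)[OF G]) (use exa in blast)
    have bG: "b \<in> G" by (rule baire_paramD(1)[OF G]) (use exb in blast)
    have "\<gamma> a \<in> E"
      using clopen_imp_closed_pred[OF clE] aG exa unfolding closed_pred_def by blast
    moreover have "\<gamma> b \<notin> E"
      using clopen_imp_closed_pred[OF clopen_pred_not[OF clE]] bG exb unfolding closed_pred_def by blast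
    ultimately obtain k where k: "(\<gamma> a \<in> D k) \<noteq> (\<gamma> b \<in> D k)"
      using sep[OF \<gamma>[OF aG] \<gamma>[OF bG]] by metis
    obtain n where n: "\<forall>c\<in>G. agree n a c \<longrightarrow> (\<gamma> c \<in> D k) = (\<gamma> a \<in> D k)"
      using clD aG unfolding clopen_pred_def by blast
    obtain m where m: "\<forall>c\<in>G. agree m b c \<longrightarrow> (\<gamma> c \<in> D k) = (\<gamma> b \<in> D k)"
      using clD bG unfolding clopen_pred_def by blast
    let ?l = "max n m"
    have l: "(x \<in> D k) = (\<gamma> a \<in> D k)" "x \<in> topspace X" if "x \<in> P ?l a" for x
      using that n \<gamma> agree_mono[of ?l a _ n] unfolding P_def by auto
    have r: "(x \<in> D k) = (\<gamma> b \<in> D k)" if "x \<in> N ?l b" for x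
      using that m agree_mono[of ?l b _ m] unfolding N_def by auto
    have Dk: "D k \<in> ?\<Sigma>" by auto
    \<comment> \<open>At this depth the two sides lie on opposite sides of \<open>D k\<close>, so
      \<open>D k\<close> or its complement separates them.\<close>
    have "separable (P ?l a) (N ?l b)"
    proof (cases "\<gamma> a \<in> D k")
      case True
      then show ?thesis unfolding separable_def using l r k Dk by (intro bexI[of _ "D k"]) auto
    next
      case False
      then show ?thesis unfolding separable_def using l r k \<Sigma>.compl_sets[OF Dk]
        by (intro bexI[of _ "topspace X - D k"]) auto
    qed
    then show False using bad by blast
  qed
qed

section \<open>Souslin spaces as images of closed sets of the Baire space\<close>

lemma baire_param_continuous_image:
  assumes F: "baire_param X F g" and f: "continuous_map X Y f" "f ` topspace X = topspace Y"
  shows "baire_param Y F (f \<circ> g)"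
  unfolding baire_param_def
proof (intro conjI allI impI)
  show "(f \<circ> g) ` F = topspace Y" using baire_paramD(2)[OF F] f(2) by (metis image_comp)
  fix U a assume U: "openin Y U" "a \<in> F" "(f \<circ> g) a \<in> U"
  have "openin X {x \<in> topspace X. f x \<in> U}" by (rule openin_continuous_map_preimage[OF f(1) U(1)])
  moreover have "g a \<in> {x \<in> topspace X. f x \<in> U}" using U baire_paramD(2)[OF F] by auto
  ultimately obtain n where "\<forall>b\<in>F. agree n a b \<longrightarrow> g b \<in> {x \<in> topspace X. f x \<in> U}"
    using baire_paramD(3)[OF F _ U(2)] by blast
  then show "\<exists>n. \<forall>b\<in>F. agree n a b \<longrightarrow> (f \<circ> g) b \<in> U" by (intro exI[of _ n]) auto
next
  fix a assume "\<forall>n. \<exists>b\<in>F. agree n a b"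
  then show "a \<in> F" using baire_paramD(1)[OF F] by blast
qed

text \<open>A code lists indices of points in a countable dense set with rapidly shrinking steps.
  The condition on the steps involves two neighbouring digits at a time, so it is closed, and
  completeness provides the limit that the code names.\<close>

lemma (in Metric_space) baire_param_complete:
  assumes c: "mcomplete" and s: "separable_space mtopology"
  shows "\<exists>F g. baire_param mtopology F g"
proof (cases "M = {}")
  case True
  have T: "topspace mtopology = {}" unfolding topspace_mtopology by (rule True)
  have "baire_param mtopology {} g" for g unfolding baire_param_def T by simp
  then show ?thesis by blast
next
  case False
  obtain C where C: "countable C" "C \<subseteq> M" "mtopology closure_of C = M"
    using s unfolding separable_space_def by auto
  then have "C \<noteq> {}" using False by auto
  define e where "e = from_nat_into C"
  have eM: "e k \<in> M" for k unfolding e_def using from_nat_into[OF \<open>C \<noteq> {}\<close>] C(2) by blast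
  have dense: "\<exists>k. d x (e k) < r" if xr: "x \<in> M" "r > 0" for x r
  proof -
    obtain y where "y \<in> C" "y \<in> mball x r"
      using xr C(3) unfolding metric_closure_of by blast
    then show ?thesis
      using from_nat_into_surj[OF C(1) \<open>y \<in> C\<close>] unfolding e_def by auto
  qed
  define F where "F = {a. \<forall>n. d (e (a n)) (e (a (Suc n))) \<le> (1/2)^n}"
  \<comment> \<open>The right-hand side is the closed form of the geometric sum over the exponents
    from \<open>n\<close> to \<open>n + k - 1\<close>; dropping the subtracted term gives the tail
    bound \<open>2 * (1/2)^n\<close>.\<close>
  have close: "d (e (a n)) (e (a (n + k))) \<le> 2 * (1/2)^n - 2 * (1/2)^(n + k)" if "a \<in> F" for a n k
  proof (induction k)
    case (Suc k)
    have "d (e (a n)) (e (a (n + Suc k))) \<le> d (e (a n)) (e (a (n + k))) + d (e (a (n + k))) (e (a (n + Suc k)))"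
      by (rule triangle) (auto simp: eM)
    also have "\<dots> \<le> 2 * (1/2)^n - 2 * (1/2)^(n + k) + (1/2)^(n + k)"
      using Suc that unfolding F_def by (intro add_mono) auto
    finally show ?case by simp
  qed (use eM in simp)
  have close': "d (e (a n)) (e (a (n + k))) \<le> 2 * (1/2)^n" if "a \<in> F" for a n k
    using close[OF that, of n k] zero_le_power[of "1/2::real" "n + k"] by linarith
  have "\<exists>l. limitin mtopology (\<lambda>n. e (a n)) l sequentially" if a: "a \<in> F" for a
  proof -
    have "MCauchy (\<lambda>n. e (a n))"
      unfolding MCauchy_def
    proof (intro conjI allI impI)
      fix \<epsilon> :: real assume \<epsilon>: "\<epsilon> > 0"
      obtain N where N: "(1/2::real)^N < \<epsilon> / 4" using real_arch_pow_inv[of "\<epsilon>/4" "1/2"] \<epsilon> by auto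
      have "d (e (a n)) (e (a n')) < \<epsilon>" if "N \<le> n" "N \<le> n'" for n n'
      proof -
        have 1: "d (e (a N)) (e (a n)) \<le> 2 * (1/2)^N" "d (e (a N)) (e (a n')) \<le> 2 * (1/2)^N"
          using close'[OF a, of N "n - N"] close'[OF a, of N "n' - N"] that by auto
        have "d (e (a n)) (e (a n')) \<le> d (e (a n)) (e (a N)) + d (e (a N)) (e (a n'))"
          by (rule triangle) (auto simp: eM)
        then show ?thesis using 1 N commute[of "e (a n)"] by simp
      qed
      then show "\<exists>N. \<forall>n n'. N \<le> n \<longrightarrow> N \<le> n' \<longrightarrow> d (e (a n)) (e (a n')) < \<epsilon>" by blast
    qed (auto simp: eM)
    then show ?thesis using c unfolding mcomplete_def by blast
  qed
  then obtain g where g: "\<And>a. a \<in> F \<Longrightarrow> limitin mtopology (\<lambda>n. e (a n)) (g a) sequentially" by metis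
  have gM: "g a \<in> M" if "a \<in> F" for a using g[OF that] limitin_mspace by blast
  have g_close: "d (g a) (e (a n)) \<le> 2 * (1/2)^n" if a: "a \<in> F" for a n
  proof (rule field_le_epsilon)
    fix \<epsilon> :: real assume "\<epsilon> > 0"
    then have "\<forall>\<^sub>F k in sequentially. e (a k) \<in> M \<and> d (e (a k)) (g a) < \<epsilon>"
      using g[OF a] unfolding limitin_metric by blast
    then obtain K where K: "\<And>k. k \<ge> K \<Longrightarrow> d (e (a k)) (g a) < \<epsilon>" unfolding eventually_sequentially by blast
    have "d (g a) (e (a n)) \<le> d (g a) (e (a (n + K))) + d (e (a (n + K))) (e (a n))"
      by (rule triangle) (auto simp: eM gM a)
    also have "\<dots> \<le> \<epsilon> + 2 * (1/2)^n"
      using K[of "n + K"] close'[OF a, of n K] commute[of "g a"] commute[of "e (a n)"] by (intro add_mono) auto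
    finally show "d (g a) (e (a n)) \<le> 2 * (1/2)^n + \<epsilon>" by simp
  qed
  have "baire_param mtopology F g"
    unfolding baire_param_def
  proof (intro conjI allI impI)
    fix a assume a: "\<forall>n. \<exists>b\<in>F. agree n a b"
    have "d (e (a n)) (e (a (Suc n))) \<le> (1/2)^n" for n
    proof -
      obtain b where "b \<in> F" "agree (Suc (Suc n)) a b" using a by blast
      then show ?thesis by (simp add: F_def agree_def)
    qed
    then show "a \<in> F" by (simp add: F_def)
  next
    have "x \<in> g ` F" if x: "x \<in> M" for x
    proof -
      \<comment> \<open>The exponent \<open>n + 1\<close> leaves room: two consecutive errors add up
        to at most 3/4 of \<open>(1/2)^n\<close>, within the bound that \<open>F\<close>
        requires.\<close>
      have "\<forall>n. \<exists>k. d x (e k) < (1/2)^(n + 1)" by (intro allI dense[OF x] zero_less_power) simp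
      then obtain a where a: "\<And>n. d x (e (a n)) < (1/2)^(n + 1)" by metis
      have "d (e (a n)) (e (a (Suc n))) \<le> (1/2)^n" for n
      proof -
        have "d (e (a n)) (e (a (Suc n))) \<le> d (e (a n)) x + d x (e (a (Suc n)))"
          by (rule triangle) (auto simp: eM x)
        also have "\<dots> \<le> (1/2)^(n + 1) + (1/2)^(Suc n + 1)"
          using a[of n] a[of "Suc n"] commute[of x "e (a n)"] by (intro add_mono) auto
        also have "\<dots> \<le> (1/2)^n" by simp
        finally show ?thesis .
      qed
      then have aF: "a \<in> F" by (simp add: F_def)
      have "d x (g a) \<le> 0"
      proof (rule field_le_epsilon)
        fix \<epsilon> :: real assume \<epsilon>: "\<epsilon> > 0"
        obtain n where n: "(1/2::real)^n < \<epsilon> / 4" using real_arch_pow_inv[of "\<epsilon>/4" "1/2"] \<epsilon> by auto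
        have "d x (g a) \<le> d x (e (a n)) + d (e (a n)) (g a)"
          by (rule triangle) (auto simp: eM x gM aF)
        also have "\<dots> \<le> (1/2)^(n + 1) + 2 * (1/2)^n"
          using a[of n] g_close[OF aF, of n] commute[of "g a"] by (intro add_mono) auto
        also have "\<dots> \<le> 4 * (1/2)^n" by simp
        finally show "d x (g a) \<le> 0 + \<epsilon>" using n by simp
      qed
      then have "x = g a" using x gM[OF aF] nonneg[of x "g a"] zero[of x "g a"] by auto
      then show ?thesis using aF by blast
    qed
    then show "g ` F = topspace mtopology" using gM by auto
  next
    fix U a assume U: "openin mtopology U" "a \<in> F" "g a \<in> U"
    then obtain r where r: "r > 0" "mball (g a) r \<subseteq> U" unfolding openin_mtopology by blast
    \<comment> \<open>Codes sharing digit \<open>n\<close> name points within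
      \<open>2 * (1/2)^n\<close> of the same \<open>e (a n)\<close>, hence within
      \<open>4 * (1/2)^n\<close> of each other; whence \<open>r / 4\<close> and the depth
      \<open>Suc n\<close>.\<close>
    obtain n where n: "(1/2::real)^n < r / 4" using real_arch_pow_inv[of "r/4" "1/2"] r by auto
    have "g b \<in> U" if b: "b \<in> F" "agree (Suc n) a b" for b
    proof -
      have "d (g a) (g b) \<le> d (g a) (e (a n)) + d (e (a n)) (g b)"
        by (rule triangle) (auto simp: eM gM U b)
      moreover have "d (e (a n)) (g b) \<le> 2 * (1/2)^n"
        using g_close[OF b(1), of n] b(2) commute[of "g b"] by (simp add: agree_def)
      ultimately have "d (g a) (g b) < r" using g_close[OF U(2), of n] n by simp
      then show ?thesis using r(2) gM U(2) b(1) by auto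
    qed
    then show "\<exists>n. \<forall>b\<in>F. agree n a b \<longrightarrow> g b \<in> U" by blast
  qed
  then show ?thesis by blast
qed

lemma souslin_baire_param:
  assumes "souslin_space X"
  shows "\<exists>F g. baire_param X F g"
proof -
  obtain m :: "real metric" and f where m: "mcomplete_of m" "separable_space (mtopology_of m)"
    "continuous_map (mtopology_of m) X f" "f ` mspace m = topspace X"
    using assms unfolding souslin_space_def by blast
  interpret Metric_space "mspace m" "mdist m" by (rule Metric_space_mspace_mdist)
  obtain F g where "baire_param (mtopology_of m) F g"
    using baire_param_complete m(1,2) unfolding mcomplete_of_def mtopology_of_def by blast
  then show ?thesis using baire_param_continuous_image[OF _ m(3)] m(4) by auto
qed

lemma (in Metric_space) second_countable_separable:
  assumes "separable_space mtopology"
  shows "second_countable mtopology"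
proof -
  obtain C where C: "countable C" "C \<subseteq> M" "mtopology closure_of C = M"
    using assms unfolding separable_space_def by auto
  let ?B = "(\<lambda>(c, q). mball c q) ` (C \<times> (\<rat> :: real set))"
  show ?thesis
    unfolding second_countable_def
  proof (intro exI conjI ballI allI impI)
    show "countable ?B" using C(1) by (intro countable_image countable_SIGMA countable_rat)
    show "openin mtopology V" if "V \<in> ?B" for V using that by auto
    fix U x assume U: "openin mtopology U \<and> x \<in> U"
    then obtain r where r: "r > 0" "mball x r \<subseteq> U" unfolding openin_mtopology by blast
    have x: "x \<in> M" using U openin_subset by fastforce
    obtain q where q: "q \<in> \<rat>" "0 < q" "q < r / 2" using Rats_dense_in_real[of 0 "r/2"] r(1) by auto
    obtain c where c: "c \<in> C" "c \<in> mball x q"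
      using x q(2) C(3) unfolding metric_closure_of by blast
    have "x \<in> mball c q" using c x by (simp add: commute)
    moreover have "mball c q \<subseteq> U"
    proof
      fix y assume y: "y \<in> mball c q"
      have "d x y \<le> d x c + d c y" using c y x by (intro triangle) auto
      also have "\<dots> < r" using c y q by auto
      finally have "y \<in> mball x r" using x y by auto
      then show "y \<in> U" using r(2) by blast
    qed
    ultimately show "\<exists>V\<in>?B. x \<in> V \<and> V \<subseteq> U" using c(1) q(1) by (intro bexI[of _ "mball c q"]) auto
  qed
qed

lemma metrizable_second_countable_nice:
  assumes "metrizable_space X" "second_countable X"
  shows "nice_space X"
  using assms by (simp add: nice_space_def metrizable_imp_Hausdorff_space metrizable_imp_completely_regular_space)

text \<open>Separability passes to the continuous image, and in a metrizable space it gives second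
  countability through balls of rational radius.\<close>

lemma souslin_metrizable_nice:
  assumes "metrizable_space X" "souslin_space X"
  shows "nice_space X"
proof -
  obtain m :: "real metric" and f where "separable_space (mtopology_of m)"
    "continuous_map (mtopology_of m) X f" "f ` mspace m = topspace X"
    using assms(2) unfolding souslin_space_def by blast
  then have sep: "separable_space X"
    using separable_space_continuous_map_image[of "mtopology_of m" X f] by simp
  obtain M d where "Metric_space M d" "X = Metric_space.mtopology M d"
    using assms(1) unfolding metrizable_space_def by blast
  then have "second_countable X" using Metric_space.second_countable_separable sep by blast
  then show ?thesis using assms(1) by (rule metrizable_second_countable_nice[rotated])
qed


subsection \<open>Belief hierarchies\<close>

lemma topspace_cps_top [simp]: "topspace (cps_top X Bs c) = cps_set X Bs c"
  unfolding cps_top_def by (auto simp: cps_set_def)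

lemma nice_space_cps_top: "nice_space X \<Longrightarrow> countable Bs \<Longrightarrow> nice_space (cps_top X Bs c)"
  unfolding cps_top_def
  by (intro nice_space_subtopology nice_space_product_topology nice_space_weak_topology)

lemma cps_set_prob_measures: "\<mu> \<in> cps_set X Bs c \<Longrightarrow> B \<in> Bs \<Longrightarrow> \<mu> B \<in> prob_measures X"
  by (auto simp: cps_set_def)

lemma distr_prob_measures:
  assumes M: "M \<in> prob_measures X" and f: "f \<in> borel_of X \<rightarrow>\<^sub>M borel_of Y"
  shows "distr M (borel_of Y) f \<in> prob_measures Y"
proof -
  have "f \<in> M \<rightarrow>\<^sub>M borel_of Y" using f prob_measuresD(2)[OF M] by (simp cong: measurable_cong_sets)
  then show ?thesis
    using prob_space.prob_space_distr[OF prob_measuresD(1)[OF M]] by (simp add: prob_measures_def)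
qed

lemma measure_distr_prob_measures:
  assumes M: "M \<in> prob_measures X" and f: "f \<in> borel_of X \<rightarrow>\<^sub>M borel_of Y" and A: "A \<in> sets (borel_of Y)"
  shows "measure (distr M (borel_of Y) f) A = measure M (f -` A \<inter> topspace X)"
proof -
  have "f \<in> M \<rightarrow>\<^sub>M borel_of Y" using f prob_measuresD(2)[OF M] by (simp cong: measurable_cong_sets)
  then show ?thesis using A prob_measuresD(3)[OF M] by (simp add: measure_distr)
qed

text \<open>The chain rule for the image is the chain rule for preimages; this works because the
  preimage of each conditioning event \<open>d B\<close> is the conditioning event
  \<open>c B\<close>.\<close>

lemma cps_image_in_cps_set:
  assumes f: "f \<in> borel_of X \<rightarrow>\<^sub>M borel_of Y"
    and c: "\<And>B. B \<in> Bs \<Longrightarrow> f -` d B \<inter> topspace X = c B"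
    and d: "\<And>B. B \<in> Bs \<Longrightarrow> d B \<in> sets (borel_of Y)"
    and \<mu>: "\<mu> \<in> cps_set X Bs c"
  shows "cps_image Bs (borel_of Y) f \<mu> \<in> cps_set Y Bs d"
proof -
  note pm = cps_set_prob_measures[OF \<mu>]
  have m: "measure (distr (\<mu> B) (borel_of Y) f) A = measure (\<mu> B) (f -` A \<inter> topspace X)"
    if "B \<in> Bs" "A \<in> sets (borel_of Y)" for A B
    by (rule measure_distr_prob_measures[OF pm f]) (use that in auto)
  have "measure (distr (\<mu> B) (borel_of Y) f) A * measure (distr (\<mu> C) (borel_of Y) f) (d B) =
      measure (distr (\<mu> C) (borel_of Y) f) A"
    if A: "A \<in> sets (borel_of Y)" and BC: "B \<in> Bs" "C \<in> Bs" and sub: "A \<subseteq> d B" "d B \<subseteq> d C" for A B C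
  proof -
    have "f -` A \<inter> topspace X \<in> sets (borel_of X)" using measurable_sets[OF f A] by simp
    moreover have "f -` A \<inter> topspace X \<subseteq> c B" "c B \<subseteq> c C"
      using sub unfolding c[OF BC(1), symmetric] c[OF BC(2), symmetric] by blast+
    ultimately have "measure (\<mu> B) (f -` A \<inter> topspace X) * measure (\<mu> C) (c B) = measure (\<mu> C) (f -` A \<inter> topspace X)"
      using \<mu> BC unfolding cps_set_def by blast
    then show ?thesis using m d A BC c by simp
  qed
  moreover have "measure (distr (\<mu> B) (borel_of Y) f) (d B) = 1" if "B \<in> Bs" for B
    using \<mu> that m[OF that d[OF that]] c[OF that] by (simp add: cps_set_def)
  moreover have "cps_image Bs (borel_of Y) f \<mu> \<in> Pi\<^sub>E Bs (\<lambda>_. prob_measures Y)"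
    unfolding cps_image_def using distr_prob_measures[OF pm f] by auto
  ultimately show ?thesis unfolding cps_set_def by (simp add: cps_image_def)
qed

lemma cps_image_cps_image:
  assumes f: "f \<in> borel_of X \<rightarrow>\<^sub>M borel_of Y" and g: "g \<in> borel_of Y \<rightarrow>\<^sub>M borel_of Z"
    and h: "\<And>x. x \<in> topspace X \<Longrightarrow> g (f x) = h x"
    and \<mu>: "\<mu> \<in> cps_set X Bs c"
  shows "cps_image Bs (borel_of Z) g (cps_image Bs (borel_of Y) f \<mu>) = cps_image Bs (borel_of Z) h \<mu>"
proof -
  have "distr (distr (\<mu> B) (borel_of Y) f) (borel_of Z) g = distr (\<mu> B) (borel_of Z) h" if B: "B \<in> Bs" for B
  proof -
    note pm = cps_set_prob_measures[OF \<mu> B]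
    have "f \<in> \<mu> B \<rightarrow>\<^sub>M borel_of Y" using f prob_measuresD(2)[OF pm] by (simp cong: measurable_cong_sets)
    then have "distr (distr (\<mu> B) (borel_of Y) f) (borel_of Z) g = distr (\<mu> B) (borel_of Z) (g \<circ> f)"
      by (rule distr_distr[OF g])
    also have "\<dots> = distr (\<mu> B) (borel_of Z) h"
      by (rule distr_cong) (auto simp: h prob_measuresD(3)[OF pm])
    finally show ?thesis .
  qed
  then show ?thesis by (auto simp: cps_image_def fun_eq_iff restrict_def)
qed

text \<open>Countability of \<open>Bs\<close> reduces the claim to single conditioning events, where
  it is measurability of the push-forward of measures.\<close>

lemma measurable_cps_image:
  assumes X: "nice_space X" and Y: "nice_space Y" and Bs: "countable Bs"
    and f: "f \<in> borel_of X \<rightarrow>\<^sub>M borel_of Y"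
    and c: "\<And>B. B \<in> Bs \<Longrightarrow> f -` d B \<inter> topspace X = c B"
    and d: "\<And>B. B \<in> Bs \<Longrightarrow> d B \<in> sets (borel_of Y)"
  shows "cps_image Bs (borel_of Y) f \<in> borel_of (cps_top X Bs c) \<rightarrow>\<^sub>M borel_of (cps_top Y Bs d)"
  unfolding cps_top_def[of Y]
proof (rule measurable_into_subtopology)
  show "cps_image Bs (borel_of Y) f \<in> borel_of (cps_top X Bs c) \<rightarrow>\<^sub>M
    borel_of (product_topology (\<lambda>_. weak_topology Y) Bs)"
  proof (rule measurable_into_product_topology[OF Bs])
    show "second_countable (weak_topology Y)"
      using nice_space_weak_topology[OF Y] by (simp add: nice_space_def)
    fix B assume B: "B \<in> Bs"
    have "continuous_map (cps_top X Bs c) (weak_topology X) (\<lambda>\<mu>. \<mu> B)"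
      unfolding cps_top_def by (intro continuous_map_from_subtopology continuous_map_product_projection B)
    from measurable_compose[OF continuous_map_measurable[OF this] measurable_distr_weak_topology[OF X Y f]]
    show "(\<lambda>x. cps_image Bs (borel_of Y) f x B) \<in> borel_of (cps_top X Bs c) \<rightarrow>\<^sub>M borel_of (weak_topology Y)"
      using B by (simp add: cps_image_def)
  qed (auto simp: cps_image_def)
  show "cps_image Bs (borel_of Y) f \<mu> \<in> cps_set Y Bs d" if "\<mu> \<in> space (borel_of (cps_top X Bs c))" for \<mu>
    by (rule cps_image_in_cps_set[OF f c d]) (use that in auto)
qed

section \<open>Canonical hierarchy spaces\<close>

lemma Hc_0: "Hc S Bs 0 p = transport (H1obj S Bs p)"
  and Hc_Suc: "Hc S Bs (Suc k) p = transport (HObj S Bs k p)"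
  by (simp_all add: Hc_def)

text \<open>Because \<open>Hc S Bs n\<close> is the level of order \<open>n + 1\<close>, index
  \<open>n\<close> here is domain number \<open>n + 1\<close>; domain number 0, which is
  \<open>S\<close> itself, is treated separately.\<close>

definition Theta :: "'a topology \<Rightarrow> (player \<Rightarrow> 'a set set) \<Rightarrow> nat \<Rightarrow> player \<Rightarrow> ('a \<times> real) topology" where
  "Theta S Bs n p = prod_topology S (Hc S Bs n (other p))"

abbreviation Theta_cyl where
  "Theta_cyl S Bs n p \<equiv> (\<lambda>B. B \<times> topspace (Hc S Bs n (other p)))"

text \<open>One predicate for both forms of the marginal condition, so that \<open>HObj\<close> gets
  a single equation for all \<open>n\<close>; for n = 0 the marginal is on \<open>S\<close> and has
  a different type.\<close>

definition coherent :: "'a topology \<Rightarrow> (player \<Rightarrow> 'a set set) \<Rightarrow> nat \<Rightarrow> player \<Rightarrow>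
    real \<Rightarrow> ('a set \<Rightarrow> ('a \<times> real) measure) \<Rightarrow> bool" where
  "coherent S Bs n p c \<nu> \<longleftrightarrow> (case n of
     0 \<Rightarrow> cps_image (Bs p) (borel_of S) fst \<nu> = dec (topspace (H1obj S Bs p)) c
   | Suc k \<Rightarrow> cps_image (Bs p) (borel_of (Theta S Bs k p))
       (\<lambda>(s, h). (s, fst (dec (topspace (HObj S Bs k (other p))) h))) \<nu> = snd (dec (topspace (HObj S Bs k p)) c))"

lemma HObj_eq:
  "HObj S Bs n p = subtopology (prod_topology (Hc S Bs n p) (cps_top (Theta S Bs n p) (Bs p) (Theta_cyl S Bs n p)))
     {(c, \<nu>). coherent S Bs n p c \<nu>}"
  by (cases n) (simp_all add: Hc_0 Hc_Suc Theta_def coherent_def Hc_def[symmetric] split: nat.split)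

locale belief_setting =
  fixes S :: "'a topology" and Bs :: "player \<Rightarrow> 'a set set"
  assumes nice_S: "nice_space S"
    and countable_Bs: "countable (Bs p)"
    and borel_Bs: "Bs p \<subseteq> sets (borel_of S)"
begin

lemma Bs_topspace: "B \<in> Bs p \<Longrightarrow> B \<subseteq> topspace S"
  using borel_Bs[of p] sets.sets_into_space[of B "borel_of S"] by auto

lemma cylinder_borel:
  assumes "B \<in> Bs p" shows "B \<times> topspace Y \<in> sets (borel_of (prod_topology S Y))"
proof -
  have "fst \<in> borel_of (prod_topology S Y) \<rightarrow>\<^sub>M borel_of S"
    by (rule continuous_map_measurable) (rule continuous_map_fst)
  then have "fst -` B \<inter> space (borel_of (prod_topology S Y)) \<in> sets (borel_of (prod_topology S Y))"
    using borel_Bs assms by (intro measurable_sets) auto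
  moreover have "fst -` B \<inter> space (borel_of (prod_topology S Y)) = B \<times> topspace Y"
    using Bs_topspace[OF assms] by auto
  ultimately show ?thesis by simp
qed

lemma nice_H1obj: "nice_space (H1obj S Bs p)"
  unfolding H1obj_def by (intro nice_space_cps_top nice_S countable_Bs)

lemma nice_HObj_step: "(\<And>p. nice_space (Hc S Bs n p)) \<Longrightarrow> nice_space (HObj S Bs n p)"
  unfolding HObj_eq Theta_def
  by (intro nice_space_subtopology nice_space_prod_topology nice_space_cps_top nice_S countable_Bs)

lemma nice_Hc: "nice_space (Hc S Bs n p)"
proof (induction n arbitrary: p)
  case 0 then show ?case unfolding Hc_0 by (intro nice_space_transport nice_H1obj)
next
  case (Suc n) then show ?case unfolding Hc_Suc by (intro nice_space_transport nice_HObj_step)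
qed

lemma nice_HObj: "nice_space (HObj S Bs n p)"
  by (rule nice_HObj_step[OF nice_Hc])

lemma nice_Theta: "nice_space (Theta S Bs n p)"
  unfolding Theta_def by (intro nice_space_prod_topology nice_S nice_Hc)

text \<open>Drops the last belief of a coded hierarchy: after decoding, the first component is
  already the code of the prefix.\<close>

definition prj :: "nat \<Rightarrow> player \<Rightarrow> real \<Rightarrow> real" where
  "prj n p h = fst (dec (topspace (HObj S Bs n p)) h)"

lemma continuous_map_prj: "continuous_map (Hc S Bs (Suc n) p) (Hc S Bs n p) (prj n p)"
proof -
  have "continuous_map (Hc S Bs (Suc n) p) (HObj S Bs n p) (dec (topspace (HObj S Bs n p)))"
    unfolding Hc_Suc using homeomorphic_maps_transport[OF nice_HObj] by (simp add: homeomorphic_maps_def)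
  moreover have "continuous_map (HObj S Bs n p) (Hc S Bs n p) fst"
    unfolding HObj_eq by (intro continuous_map_from_subtopology continuous_map_fst)
  ultimately have "continuous_map (Hc S Bs (Suc n) p) (Hc S Bs n p) (fst \<circ> dec (topspace (HObj S Bs n p)))"
    by (rule continuous_map_compose)
  then show ?thesis by (simp add: prj_def[abs_def] o_def)
qed

lemma measurable_pair_map:
  assumes X: "second_countable X" and Y: "second_countable Y" and f: "f \<in> borel_of X \<rightarrow>\<^sub>M borel_of Y"
  shows "(\<lambda>(s, x). (s, f x)) \<in> borel_of (prod_topology S X) \<rightarrow>\<^sub>M borel_of (prod_topology S Y)"
proof -
  have S: "second_countable S" using nice_S by (simp add: nice_space_def)
  have "fst \<in> borel_of (prod_topology S X) \<rightarrow>\<^sub>M borel_of S" "snd \<in> borel_of (prod_topology S X) \<rightarrow>\<^sub>M borel_of X"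
    by (intro continuous_map_measurable continuous_map_fst continuous_map_snd)+
  from measurable_into_prod_topology[OF S Y this(1) measurable_compose[OF this(2) f]]
  show ?thesis by (simp add: case_prod_beta')
qed

end

section \<open>Hierarchy maps of a type structure\<close>

locale cps_type_structure = belief_setting S Bs
  for S :: "'a topology" and Bs :: "player \<Rightarrow> 'a set set" +
  fixes T :: "player \<Rightarrow> 't topology" and \<beta> :: "player \<Rightarrow> 't \<Rightarrow> 'a set \<Rightarrow> ('a \<times> 't) measure"
  assumes nice_T: "nice_space (T p)"
    and measurable_\<beta>: "\<beta> p \<in> borel_of (T p) \<rightarrow>\<^sub>M
       borel_of (cps_top (prod_topology S (T (other p))) (Bs p) (\<lambda>B. B \<times> topspace (T (other p))))"
begin

abbreviation "hc \<equiv> hcode S Bs \<beta>"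

definition hmap :: "nat \<Rightarrow> player \<Rightarrow> 'a \<times> 't \<Rightarrow> 'a \<times> real" where
  "hmap n q = (\<lambda>(s, t). (s, hc n q t))"

text \<open>The belief of order \<open>n + 2\<close>; the first-order belief on \<open>S\<close> has
  a type of its own and is kept apart.\<close>

definition level :: "nat \<Rightarrow> player \<Rightarrow> 't \<Rightarrow> 'a set \<Rightarrow> ('a \<times> real) measure" where
  "level n p t = cps_image (Bs p) (borel_of (Theta S Bs n p)) (hmap n (other p)) (\<beta> p t)"

lemma hc_0: "hc 0 p t = enc (topspace (H1obj S Bs p)) (cps_image (Bs p) (borel_of S) fst (\<beta> p t))"
  and hc_Suc: "hc (Suc n) p t = enc (topspace (HObj S Bs n p)) (hc n p t, level n p t)"
  by (simp_all add: level_def hmap_def Theta_def)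

lemma nice_prod: "nice_space (prod_topology S (T p))"
  by (intro nice_space_prod_topology nice_S nice_T)

lemma \<beta>_cps_set:
  "t \<in> topspace (T p) \<Longrightarrow> \<beta> p t \<in> cps_set (prod_topology S (T (other p))) (Bs p) (\<lambda>B. B \<times> topspace (T (other p)))"
  using measurable_space[OF measurable_\<beta>] by simp

lemma measurable_hmap:
  assumes "hc n q \<in> borel_of (T q) \<rightarrow>\<^sub>M borel_of (Hc S Bs n q)"
  shows "hmap n q \<in> borel_of (prod_topology S (T q)) \<rightarrow>\<^sub>M borel_of (prod_topology S (Hc S Bs n q))"
  unfolding hmap_def using assms nice_T[of q] nice_Hc[of n q]
  by (intro measurable_pair_map) (auto simp: nice_space_def)

lemma hmap_cylinder:
  assumes h: "hc n q \<in> borel_of (T q) \<rightarrow>\<^sub>M borel_of (Hc S Bs n q)" and B: "B \<in> Bs p"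
  shows "hmap n q -` (B \<times> topspace (Hc S Bs n q)) \<inter> topspace (prod_topology S (T q)) = B \<times> topspace (T q)"
  using Bs_topspace[OF B] measurable_space[OF h] by (auto simp: hmap_def)

lemma fst_cylinder: "B \<in> Bs p \<Longrightarrow> fst -` B \<inter> topspace (prod_topology S Y) = B \<times> topspace Y"
  using Bs_topspace[of B p] by auto

lemma measurable_level:
  assumes h: "hc n (other p) \<in> borel_of (T (other p)) \<rightarrow>\<^sub>M borel_of (Hc S Bs n (other p))"
  shows "level n p \<in> borel_of (T p) \<rightarrow>\<^sub>M
    borel_of (cps_top (Theta S Bs n p) (Bs p) (Theta_cyl S Bs n p))"
proof -
  have "cps_image (Bs p) (borel_of (Theta S Bs n p)) (hmap n (other p)) \<in>
     borel_of (cps_top (prod_topology S (T (other p))) (Bs p) (\<lambda>B. B \<times> topspace (T (other p)))) \<rightarrow>\<^sub>M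
     borel_of (cps_top (Theta S Bs n p) (Bs p) (Theta_cyl S Bs n p))"
    unfolding Theta_def
    by (intro measurable_cps_image nice_prod nice_Theta[unfolded Theta_def] countable_Bs measurable_hmap h
        hmap_cylinder cylinder_borel)
  from measurable_compose[OF measurable_\<beta> this] show ?thesis by (simp add: level_def[abs_def])
qed

text \<open>Measurability and decoding have to be proved together: \<open>enc\<close> is inverted
  only on the level itself, so tuples must first be known to be coherent, and coherence at one level
  compares beliefs with the decoded codes of the level below, for both players.\<close>

lemma hierarchy_step:
  "(\<forall>p. hc n p \<in> borel_of (T p) \<rightarrow>\<^sub>M borel_of (Hc S Bs n p)) \<and>
   (\<forall>p. \<forall>t\<in>topspace (T p). case n of
      0 \<Rightarrow> dec (topspace (H1obj S Bs p)) (hc 0 p t) = cps_image (Bs p) (borel_of S) fst (\<beta> p t)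
    | Suc k \<Rightarrow> dec (topspace (HObj S Bs k p)) (hc (Suc k) p t) = (hc k p t, level k p t))"
proof (induction n)
  case 0
  have fst_meas: "fst \<in> borel_of (prod_topology S (T q)) \<rightarrow>\<^sub>M borel_of S" for q
    by (intro continuous_map_measurable continuous_map_fst)
  have m: "(\<lambda>t. cps_image (Bs p) (borel_of S) fst (\<beta> p t)) \<in> borel_of (T p) \<rightarrow>\<^sub>M borel_of (H1obj S Bs p)" for p
    unfolding H1obj_def
    by (rule measurable_compose[OF measurable_\<beta>])
       (use borel_Bs in \<open>intro measurable_cps_image nice_prod nice_S countable_Bs fst_meas fst_cylinder; blast\<close>)
  have "enc (topspace (H1obj S Bs p)) \<in> borel_of (H1obj S Bs p) \<rightarrow>\<^sub>M borel_of (Hc S Bs 0 p)" for p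
    unfolding Hc_0 using homeomorphic_maps_transport[OF nice_H1obj]
    by (intro continuous_map_measurable) (simp add: homeomorphic_maps_def)
  from measurable_compose[OF m this]
  have "hc 0 p \<in> borel_of (T p) \<rightarrow>\<^sub>M borel_of (Hc S Bs 0 p)" for p
    unfolding hc_0[abs_def] .
  moreover have "dec (topspace (H1obj S Bs p)) (hc 0 p t) = cps_image (Bs p) (borel_of S) fst (\<beta> p t)"
    if "t \<in> topspace (T p)" for p t
    unfolding hc_0 using measurable_space[OF m] that by (intro dec_enc[OF nice_H1obj]) auto
  ultimately show ?case by (simp del: hcode.simps)
next
  case (Suc n)
  then have hn: "hc n p \<in> borel_of (T p) \<rightarrow>\<^sub>M borel_of (Hc S Bs n p)" for p by blast
  have coh: "coherent S Bs n p (hc n p t) (level n p t)" if t: "t \<in> topspace (T p)" for p t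
  proof (cases n)
    case 0
    have "cps_image (Bs p) (borel_of S) fst (level 0 p t) = cps_image (Bs p) (borel_of S) fst (\<beta> p t)"
      unfolding level_def Theta_def
      by (rule cps_image_cps_image[OF measurable_hmap[OF hn[unfolded 0]] _ _ \<beta>_cps_set[OF t]])
         (auto simp: hmap_def intro!: continuous_map_measurable continuous_map_fst)
    then show ?thesis using Suc.IH t unfolding coherent_def by (simp add: 0 del: hcode.simps)
  next
    case (Suc k)
    have D: "dec (topspace (HObj S Bs k p)) (hc (Suc k) p t) = (hc k p t, level k p t)"
      if "t \<in> topspace (T p)" for p t using Suc.IH that unfolding Suc by (simp del: hcode.simps)
    \<comment> \<open>\<open>prj\<close> undoes the last step of the opponent's coding, so the two
      push-forwards compose to the one of lower order.\<close>
    have "cps_image (Bs p) (borel_of (Theta S Bs k p)) (\<lambda>(s, h). (s, prj k (other p) h)) (level (Suc k) p t)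
        = level k p t"
      unfolding level_def Theta_def
    proof (rule cps_image_cps_image[OF measurable_hmap[OF hn[unfolded Suc]] _ _ \<beta>_cps_set[OF t]])
      show "(\<lambda>(s, h). (s, prj k (other p) h)) \<in> borel_of (prod_topology S (Hc S Bs (Suc k) (other p))) \<rightarrow>\<^sub>M
         borel_of (prod_topology S (Hc S Bs k (other p)))"
        using nice_Hc[of "Suc k" "other p"] nice_Hc[of k "other p"]
        by (intro measurable_pair_map continuous_map_measurable continuous_map_prj) (auto simp: nice_space_def)
      fix x assume "x \<in> topspace (prod_topology S (T (other p)))"
      then show "(case hmap (Suc k) (other p) x of (s, h) \<Rightarrow> (s, prj k (other p) h)) = hmap k (other p) x"
        using D[of "snd x" "other p"] by (auto simp: hmap_def prj_def simp del: hcode.simps)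
    qed
    then show ?thesis
      unfolding coherent_def Suc using D[OF t] by (simp add: prj_def del: hcode.simps)
  qed
  have m: "(\<lambda>t. (hc n p t, level n p t)) \<in> borel_of (T p) \<rightarrow>\<^sub>M borel_of (HObj S Bs n p)" for p
    unfolding HObj_eq
  proof (rule measurable_into_subtopology)
    show "(\<lambda>t. (hc n p t, level n p t)) \<in> borel_of (T p) \<rightarrow>\<^sub>M
      borel_of (prod_topology (Hc S Bs n p) (cps_top (Theta S Bs n p) (Bs p) (Theta_cyl S Bs n p)))"
      using nice_Hc[of n p] nice_space_cps_top[OF nice_Theta[of n p] countable_Bs[of p], of "Theta_cyl S Bs n p"]
      by (intro measurable_into_prod_topology hn measurable_level) (auto simp: nice_space_def)
  qed (use coh in simp)
  have "enc (topspace (HObj S Bs n p)) \<in> borel_of (HObj S Bs n p) \<rightarrow>\<^sub>M borel_of (Hc S Bs (Suc n) p)" for p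
    unfolding Hc_Suc using homeomorphic_maps_transport[OF nice_HObj]
    by (intro continuous_map_measurable) (simp add: homeomorphic_maps_def)
  from measurable_compose[OF m this]
  have "hc (Suc n) p \<in> borel_of (T p) \<rightarrow>\<^sub>M borel_of (Hc S Bs (Suc n) p)" for p
    unfolding hc_Suc[abs_def] .
  moreover have "dec (topspace (HObj S Bs n p)) (hc (Suc n) p t) = (hc n p t, level n p t)"
    if "t \<in> topspace (T p)" for p t
    unfolding hc_Suc using measurable_space[OF m] that by (intro dec_enc[OF nice_HObj]) auto
  ultimately show ?case by (simp del: hcode.simps)
qed

lemma measurable_hc: "hc n p \<in> borel_of (T p) \<rightarrow>\<^sub>M borel_of (Hc S Bs n p)"
  using hierarchy_step by blast

lemma dec_hc_0: "t \<in> topspace (T p) \<Longrightarrow>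
    dec (topspace (H1obj S Bs p)) (hc 0 p t) = cps_image (Bs p) (borel_of S) fst (\<beta> p t)"
  using hierarchy_step[of 0] by simp

lemma dec_hc_Suc: "t \<in> topspace (T p) \<Longrightarrow>
    dec (topspace (HObj S Bs n p)) (hc (Suc n) p t) = (hc n p t, level n p t)"
  using hierarchy_step[of "Suc n"] by (simp del: hcode.simps)

lemma prj_hc: "t \<in> topspace (T p) \<Longrightarrow> prj n p (hc (Suc n) p t) = hc n p t"
  by (simp add: prj_def dec_hc_Suc del: hcode.simps)

lemma hier_eq: "hier S Bs \<beta> p t = (cps_image (Bs p) (borel_of S) fst (\<beta> p t), \<lambda>n. level n p t)"
  by (simp add: hier_def level_def hmap_def Theta_def)

text \<open>Each code decodes to the beliefs that it records. Hence injectivity of the infinite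
  hierarchy map yields, for distinct types, a finite order at which their codes differ.\<close>

lemma hc_eq_imp_hier_eq:
  assumes t: "t \<in> topspace (T p)" "t' \<in> topspace (T p)" and eq: "\<And>n. hc n p t = hc n p t'"
  shows "hier S Bs \<beta> p t = hier S Bs \<beta> p t'"
proof -
  have "(hc n p t, level n p t) = (hc n p t', level n p t')" for n
    by (simp only: dec_hc_Suc[OF t(1), symmetric] dec_hc_Suc[OF t(2), symmetric] eq[of "Suc n"])
  moreover have "cps_image (Bs p) (borel_of S) fst (\<beta> p t) = cps_image (Bs p) (borel_of S) fst (\<beta> p t')"
    by (simp only: dec_hc_0[OF t(1), symmetric] dec_hc_0[OF t(2), symmetric] eq[of 0])
  ultimately show ?thesis unfolding hier_eq by simp
qed

end


subsection \<open>Adjoining an isolated point\<close>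

text \<open>The sum of \<open>X\<close> with an isolated point \<open>None\<close> or, with
  \<open>b\<close> false, just a copy of \<open>X\<close> inside the option type, so that the spaces
  of both players can have the same type.\<close>

definition option_topology :: "bool \<Rightarrow> 'x topology \<Rightarrow> 'x option topology" where
  "option_topology b X = topology (\<lambda>U. U \<subseteq> Some ` topspace X \<union> (if b then {None} else {}) \<and>
     openin X {x \<in> topspace X. Some x \<in> U})"

lemma openin_option_topology:
  "openin (option_topology b X) U \<longleftrightarrow> U \<subseteq> Some ` topspace X \<union> (if b then {None} else {}) \<and>
     openin X {x \<in> topspace X. Some x \<in> U}"
proof -
  let ?P = "\<lambda>U. U \<subseteq> Some ` topspace X \<union> (if b then {None} else {}) \<and> openin X {x \<in> topspace X. Some x \<in> U}"
  have "istopology ?P"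
    unfolding istopology_def
  proof (intro conjI allI impI)
    fix U V assume UV: "?P U" "?P V"
    have "{x \<in> topspace X. Some x \<in> U \<inter> V} = {x \<in> topspace X. Some x \<in> U} \<inter> {x \<in> topspace X. Some x \<in> V}"
      by auto
    then show "openin X {x \<in> topspace X. Some x \<in> U \<inter> V}" using UV by (simp add: openin_Int)
    show "U \<inter> V \<subseteq> Some ` topspace X \<union> (if b then {None} else {})" using UV by blast
  next
    fix \<K> assume K: "\<forall>U\<in>\<K>. ?P U"
    have "{x \<in> topspace X. Some x \<in> \<Union>\<K>} = (\<Union>U\<in>\<K>. {x \<in> topspace X. Some x \<in> U})" by auto
    moreover have "openin X (\<Union>U\<in>\<K>. {x \<in> topspace X. Some x \<in> U})" using K by (intro openin_Union) auto
    ultimately show "openin X {x \<in> topspace X. Some x \<in> \<Union>\<K>}" by simp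
    show "\<Union>\<K> \<subseteq> Some ` topspace X \<union> (if b then {None} else {})" using K by blast
  qed
  then show ?thesis unfolding option_topology_def by (simp add: topology_inverse')
qed

lemma openin_option_topology_Some: "openin X V \<Longrightarrow> openin (option_topology b X) (Some ` V)"
proof -
  assume V: "openin X V"
  then have "{x \<in> topspace X. Some x \<in> Some ` V} = V" using openin_subset by auto
  then show ?thesis using V openin_subset[OF V] unfolding openin_option_topology by auto
qed

lemma openin_option_topology_None: "openin (option_topology True X) {None}"
  by (auto simp: openin_option_topology)

lemma topspace_option_topology [simp]:
  "topspace (option_topology b X) = Some ` topspace X \<union> (if b then {None} else {})"
proof
  have "openin (option_topology b X) (Some ` topspace X \<union> (if b then {None} else {}))"
    using openin_Un[OF openin_option_topology_Some[OF openin_topspace] openin_option_topology_None]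
      openin_option_topology_Some[OF openin_topspace] by (cases b) simp_all
  then show "Some ` topspace X \<union> (if b then {None} else {}) \<subseteq> topspace (option_topology b X)"
    by (rule openin_subset)
  show "topspace (option_topology b X) \<subseteq> Some ` topspace X \<union> (if b then {None} else {})"
    using openin_topspace[of "option_topology b X"] unfolding openin_option_topology by blast
qed

lemma continuous_map_Some: "continuous_map X (option_topology b X) Some"
  unfolding continuous_map_def by (auto simp: openin_option_topology)

lemma metrizable_option_topology:
  assumes "metrizable_space X" shows "metrizable_space (option_topology b X)"
proof -
  obtain M d where "Metric_space M d" and X: "X = Metric_space.mtopology M d"
    using assms unfolding metrizable_space_def by blast
  then interpret Metric_space M d by blast
  \<comment> \<open>Truncation at 1 bounds distances between old points, so the detour through
    \<open>None\<close>, of length 2, respects the triangle inequality; distance 1 makes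
    \<open>None\<close> isolated.\<close>
  define d' where "d' x y = (case x of None \<Rightarrow> (case y of None \<Rightarrow> 0 | Some _ \<Rightarrow> 1)
    | Some a \<Rightarrow> (case y of None \<Rightarrow> 1 | Some b \<Rightarrow> min 1 (d a b)))" for x y
  define A where "A = Some ` M \<union> (if b then {None} else {})"
  have A_Some: "Some a \<in> A \<longleftrightarrow> a \<in> M" for a by (auto simp: A_def)
  have "Metric_space A d'"
  proof
    show "0 \<le> d' x y" for x y by (auto simp: d'_def split: option.split)
    show "d' x y = d' y x" for x y by (auto simp: d'_def commute split: option.split)
    show "d' x y = 0 \<longleftrightarrow> x = y" if "x \<in> A" "y \<in> A" for x y
      using that by (auto simp: d'_def A_def min_def split: option.split if_splits)
    show "d' x z \<le> d' x y + d' y z" if xyz: "x \<in> A" "y \<in> A" "z \<in> A" for x y z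
    proof (cases x; cases y; cases z)
      fix u v w assume "x = Some u" "y = Some v" "z = Some w"
      moreover from this have "d u w \<le> d u v + d v w" using xyz by (intro triangle) (auto simp: A_def split: if_splits)
      ultimately show ?thesis using nonneg[of u v] nonneg[of v w] by (auto simp: d'_def min_def simp del: nonneg)
    qed (auto simp: d'_def min_def)
  qed
  then interpret O: Metric_space A d' .
  have "openin (option_topology b X) U \<longleftrightarrow> openin O.mtopology U" for U
  proof
    assume U: "openin (option_topology b X) U"
    then have "U \<subseteq> A" and V: "openin mtopology {x \<in> M. Some x \<in> U}"
      unfolding openin_option_topology by (auto simp: X A_def)
    moreover have "\<exists>r>0. O.mball x r \<subseteq> U" if x: "x \<in> U" for x
    proof (cases x)
      case None
      have "O.mball x 1 \<subseteq> {None}" by (auto simp: O.in_mball None d'_def min_def split: option.splits)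
      then show ?thesis using x None by (intro exI[of _ 1]) auto
    next
      case (Some y)
      then have "y \<in> {x \<in> M. Some x \<in> U}" using x \<open>U \<subseteq> A\<close> by (auto simp: A_def split: if_splits)
      then obtain r where r: "r > 0" "mball y r \<subseteq> {x \<in> M. Some x \<in> U}"
        using V unfolding openin_mtopology by blast
      \<comment> \<open>With radius at most 1 the ball misses \<open>None\<close> and the truncation
        has no effect.\<close>
      have "z \<in> U" if z: "z \<in> O.mball x (min r 1)" for z
      proof (cases z)
        case None
        then show ?thesis using z by (simp add: O.in_mball Some d'_def)
      next
        case (Some w)
        then have "w \<in> mball y r" using z \<open>x = Some y\<close>
          by (auto simp: O.in_mball d'_def A_Some min_def split: if_splits)
        then show ?thesis using r(2) Some by blast
      qed
      then show ?thesis using r(1) by (intro exI[of _ "min r 1"]) auto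
    qed
    ultimately show "openin O.mtopology U" unfolding O.openin_mtopology by blast
  next
    assume U: "openin O.mtopology U"
    have "\<exists>r>0. mball x r \<subseteq> {x \<in> M. Some x \<in> U}" if x: "x \<in> M" "Some x \<in> U" for x
    proof -
      obtain r where r: "r > 0" "O.mball (Some x) r \<subseteq> U" using U x unfolding O.openin_mtopology by blast
      have "Some y \<in> O.mball (Some x) r" if "y \<in> mball x r" for y
        using that by (auto simp: O.in_mball d'_def A_Some)
      then show ?thesis using r by (intro exI[of _ r]) auto
    qed
    then have "openin mtopology {x \<in> M. Some x \<in> U}" unfolding openin_mtopology by blast
    moreover have "U \<subseteq> A" using U unfolding O.openin_mtopology by blast
    ultimately show "openin (option_topology b X) U" unfolding openin_option_topology by (simp add: X A_def)
  qed
  then have "option_topology b X = O.mtopology" by (simp add: topology_eq)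
  then show ?thesis using O.metrizable_space_mtopology by simp
qed

lemma second_countable_option_topology:
  assumes "second_countable X" shows "second_countable (option_topology b X)"
proof -
  obtain \<B> where \<B>: "countable \<B>" "\<And>V. V \<in> \<B> \<Longrightarrow> openin X V"
    and base: "\<And>U x. openin X U \<Longrightarrow> x \<in> U \<Longrightarrow> \<exists>V\<in>\<B>. x \<in> V \<and> V \<subseteq> U"
    using assms unfolding second_countable_def by meson
  let ?B = "(`) Some ` \<B> \<union> (if b then {{None}} else {})"
  show ?thesis
    unfolding second_countable_def
  proof (intro exI conjI ballI allI impI)
    show "countable ?B" using \<B>(1) by simp
    show "openin (option_topology b X) V" if "V \<in> ?B" for V
      using that \<B>(2) openin_option_topology_None by (auto intro: openin_option_topology_Some split: if_splits)
    fix U x assume U: "openin (option_topology b X) U \<and> x \<in> U"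
    show "\<exists>V\<in>?B. x \<in> V \<and> V \<subseteq> U"
    proof (cases x)
      case None
      then have "b" using U by (auto simp: openin_option_topology split: if_splits)
      then show ?thesis using U None by (intro bexI[of _ "{None}"]) auto
    next
      case (Some y)
      then have "openin X {x \<in> topspace X. Some x \<in> U}" "y \<in> {x \<in> topspace X. Some x \<in> U}"
        using U by (auto simp: openin_option_topology split: if_splits)
      from base[OF this] obtain V where "V \<in> \<B>" "y \<in> V" "V \<subseteq> {x \<in> topspace X. Some x \<in> U}" by blast
      then show ?thesis using Some by (intro bexI[of _ "Some ` V"]) auto
    qed
  qed
qed

lemma sets_borel_option_topology:
  assumes A: "A \<subseteq> topspace (option_topology b X)" and S: "Some -` A \<inter> topspace X \<in> sets (borel_of X)"
  shows "A \<in> sets (borel_of (option_topology b X))"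
proof -
  have *: "Some ` E \<in> sets (borel_of (option_topology b X))" if "E \<in> sets (borel_of X)" for E
    using that unfolding sets_borel_of[of X]
  proof (induction rule: sigma_sets.induct)
    case (Basic U) then show ?case by (auto intro: openin_borel_of openin_option_topology_Some)
  next
    case (Compl E)
    have "Some ` (topspace X - E) = Some ` topspace X - Some ` E" by auto
    then show ?case using Compl.IH openin_borel_of[OF openin_option_topology_Some[OF openin_topspace, of b X]] by auto
  next
    case (Union E) then show ?case by (simp add: image_UN)
  qed simp
  have "A = Some ` (Some -` A \<inter> topspace X) \<union> (A \<inter> {None})"
    using A by (auto split: if_splits)
  moreover have "A \<inter> {None} \<in> sets (borel_of (option_topology b X))"
  proof (cases "None \<in> A")
    case True
    then have "b" using A by (auto split: if_splits)
    then show ?thesis using True openin_borel_of[OF openin_option_topology_None, of X] by simp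
  qed simp
  ultimately show ?thesis using *[OF S] by (metis sets.Un)
qed

text \<open>Whenever \<open>None\<close> is a point, \<open>{None}\<close> is open, so the value
  there cannot spoil measurability and only the restriction to old points matters.\<close>

lemma measurable_option_topology:
  assumes f: "(\<lambda>x. f (Some x)) \<in> borel_of X \<rightarrow>\<^sub>M N" and None: "b \<Longrightarrow> f None \<in> space N"
  shows "f \<in> borel_of (option_topology b X) \<rightarrow>\<^sub>M N"
proof (rule measurableI)
  show "f x \<in> space N" if "x \<in> space (borel_of (option_topology b X))" for x
    using that None measurable_space[OF f] by (auto split: if_splits)
  fix A assume "A \<in> sets N"
  then have "(\<lambda>x. f (Some x)) -` A \<inter> topspace X \<in> sets (borel_of X)" using measurable_sets[OF f] by simp
  moreover have "Some -` (f -` A \<inter> topspace (option_topology b X)) \<inter> topspace X = (\<lambda>x. f (Some x)) -` A \<inter> topspace X"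
    by auto
  ultimately show "f -` A \<inter> space (borel_of (option_topology b X)) \<in> sets (borel_of (option_topology b X))"
    using sets_borel_option_topology[of "f -` A \<inter> topspace (option_topology b X)" b X] by simp
qed

subsection \<open>Beliefs are determined by their hierarchies\<close>

context cps_type_structure
begin

text \<open>The sigma-algebra generated by \<open>hmap n q\<close>: events expressible through the
  state and player q's beliefs up to order \<open>n + 1\<close>.\<close>

definition hmap_sets :: "player \<Rightarrow> nat \<Rightarrow> ('a \<times> 't) set set" where
  "hmap_sets q n = (\<lambda>E. hmap n q -` E \<inter> topspace (prod_topology S (T q))) `
     sets (borel_of (prod_topology S (Hc S Bs n q)))"

text \<open>\<open>hmap n q\<close> is \<open>hmap (Suc n) q\<close> followed by the Borel map that
  drops the last belief, so an event of one order is also an event of the next.\<close>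

lemma hmap_sets_mono: "n \<le> m \<Longrightarrow> hmap_sets q n \<subseteq> hmap_sets q m"
proof (rule lift_Suc_mono_le[of "hmap_sets q"])
  fix n
  show "hmap_sets q n \<subseteq> hmap_sets q (Suc n)"
  proof
    fix A assume "A \<in> hmap_sets q n"
    then obtain E where E: "E \<in> sets (borel_of (prod_topology S (Hc S Bs n q)))"
      "A = hmap n q -` E \<inter> topspace (prod_topology S (T q))" unfolding hmap_sets_def by blast
    let ?\<pi> = "\<lambda>(s, h). (s, prj n q h)"
    have \<pi>: "?\<pi> \<in> borel_of (prod_topology S (Hc S Bs (Suc n) q)) \<rightarrow>\<^sub>M borel_of (prod_topology S (Hc S Bs n q))"
      using nice_Hc[of "Suc n" q] nice_Hc[of n q]
      by (intro measurable_pair_map continuous_map_measurable continuous_map_prj) (auto simp: nice_space_def)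
    have hm: "?\<pi> (hmap (Suc n) q x) = hmap n q x" "hmap (Suc n) q x \<in> topspace (prod_topology S (Hc S Bs (Suc n) q))"
      if "x \<in> topspace (prod_topology S (T q))" for x
      using that prj_hc[of "snd x" q n] measurable_space[OF measurable_hc[of "Suc n" q], of "snd x"]
      by (auto simp: hmap_def simp del: hcode.simps)
    have "A = hmap (Suc n) q -` (?\<pi> -` E \<inter> topspace (prod_topology S (Hc S Bs (Suc n) q))) \<inter> topspace (prod_topology S (T q))"
      (is "A = ?R")
    proof (rule set_eqI)
      fix x
      show "x \<in> A \<longleftrightarrow> x \<in> ?R"
        unfolding E(2)
        by (cases "x \<in> topspace (prod_topology S (T q))") (simp_all only: Int_iff vimage_eq hm simp_thms)
    qed
    moreover have "?\<pi> -` E \<inter> topspace (prod_topology S (Hc S Bs (Suc n) q)) \<in> sets (borel_of (prod_topology S (Hc S Bs (Suc n) q)))"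
      using measurable_sets[OF \<pi> E(1)] by simp
    ultimately show "A \<in> hmap_sets q (Suc n)" unfolding hmap_sets_def by blast
  qed
qed

text \<open>An increasing union of sigma-algebras need not be one, but any two of its members lie in
  a common stage, which is all that uniqueness of measures asks for.\<close>

lemma hmap_sets_Int_stable: "Int_stable (\<Union>n. hmap_sets q n)"
  unfolding Int_stable_def
proof (intro ballI)
  fix A B assume "A \<in> (\<Union>n. hmap_sets q n)" "B \<in> (\<Union>n. hmap_sets q n)"
  then obtain n m where "A \<in> hmap_sets q n" "B \<in> hmap_sets q m" by blast
  then have "A \<in> hmap_sets q (max n m)" "B \<in> hmap_sets q (max n m)"
    using hmap_sets_mono[of n "max n m" q] hmap_sets_mono[of m "max n m" q] by auto
  then obtain E E' where "E \<in> sets (borel_of (prod_topology S (Hc S Bs (max n m) q)))"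
    "A = hmap (max n m) q -` E \<inter> topspace (prod_topology S (T q))"
    "E' \<in> sets (borel_of (prod_topology S (Hc S Bs (max n m) q)))"
    "B = hmap (max n m) q -` E' \<inter> topspace (prod_topology S (T q))"
    unfolding hmap_sets_def by blast
  then have "A \<inter> B \<in> hmap_sets q (max n m)"
    unfolding hmap_sets_def by (intro image_eqI[of _ _ "E \<inter> E'"]) auto
  then show "A \<inter> B \<in> (\<Union>n. hmap_sets q n)" by blast
qed

text \<open>The generators of all finite orders are cut down to countably many, the preimages of
  basic open sets, because \<open>blackwell\<close> works with a countable separating
  family.\<close>

lemma sigma_hmap_sets:
  assumes param: "baire_param (prod_topology S (T q)) F g"
    and inj: "inj_on (hier S Bs \<beta> q) (topspace (T q))"
  shows "sets (borel_of (prod_topology S (T q))) = sigma_sets (topspace (prod_topology S (T q))) (\<Union>n. hmap_sets q n)"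
proof
  let ?X = "prod_topology S (T q)" and ?Y = "\<lambda>n. prod_topology S (Hc S Bs n q)"
  have hmap_sets_borel: "hmap_sets q n \<subseteq> sets (borel_of ?X)" for n
    using measurable_sets[OF measurable_hmap[OF measurable_hc]] unfolding hmap_sets_def by auto
  then show "sigma_sets (topspace ?X) (\<Union>n. hmap_sets q n) \<subseteq> sets (borel_of ?X)"
    using sets.sigma_sets_subset[of "\<Union>n. hmap_sets q n" "borel_of ?X"] by auto
  have nY: "nice_space (?Y n)" for n by (intro nice_space_prod_topology nice_S nice_Hc)
  have "\<forall>n. \<exists>\<B>. countable \<B> \<and> (\<forall>V\<in>\<B>. openin (?Y n) V) \<and> (\<forall>U x. openin (?Y n) U \<and> x \<in> U \<longrightarrow> (\<exists>V\<in>\<B>. x \<in> V \<and> V \<subseteq> U))"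
    using nY unfolding nice_space_def second_countable_def by simp
  from choice[OF this] obtain \<B> where \<B>: "\<And>n. countable (\<B> n)" "\<And>n V. V \<in> \<B> n \<Longrightarrow> openin (?Y n) V"
    and base: "\<And>n U x. openin (?Y n) U \<Longrightarrow> x \<in> U \<Longrightarrow> \<exists>V\<in>\<B> n. x \<in> V \<and> V \<subseteq> U" by metis
  \<comment> \<open>The empty set is inserted since the enumeration needs a nonempty family, and a
    base of an empty space may be empty.\<close>
  define W where "W n k = from_nat_into (insert {} (\<B> n)) k" for n k
  have W: "openin (?Y n) (W n k)" for n k
    using from_nat_into[of "insert {} (\<B> n)" k] \<B>(2) unfolding W_def by auto
  define D where "D m = (case prod_decode m of (n, k) \<Rightarrow> hmap n q -` W n k \<inter> topspace ?X)" for m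
  have DG: "D m \<in> (\<Union>n. hmap_sets q n)" for m
    unfolding D_def hmap_sets_def using openin_borel_of[OF W] by (auto split: prod.split)
  then have DB: "D m \<in> sets (borel_of ?X)" for m using hmap_sets_borel by blast
  have sep: "\<exists>k. (x \<in> D k) \<noteq> (y \<in> D k)" if x: "x \<in> topspace ?X" and y: "y \<in> topspace ?X" and ne: "x \<noteq> y" for x y
  proof -
    have fs: "fst (hmap n q z) = fst z" "snd (hmap n q z) = hc n q (snd z)" for n z
      by (simp_all add: hmap_def case_prod_beta' del: hcode.simps)
    \<comment> \<open>If the states differ, index 0 already separates, since \<open>hmap\<close>
      keeps the state; otherwise the types differ and non-redundancy supplies an order.\<close>
    obtain n where n: "hmap n q x \<noteq> hmap n q y"
    proof (cases "fst x = fst y")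
      case False
      then show ?thesis using that[of 0] fs(1) by metis
    next
      case True
      then have "snd x \<noteq> snd y" "snd x \<in> topspace (T q)" "snd y \<in> topspace (T q)" using ne x y by (auto simp: prod_eq_iff)
      then have "hier S Bs \<beta> q (snd x) \<noteq> hier S Bs \<beta> q (snd y)" using inj by (auto dest: inj_onD)
      then obtain n where "hc n q (snd x) \<noteq> hc n q (snd y)"
        using hc_eq_imp_hier_eq[of "snd x" q "snd y"] \<open>snd x \<in> _\<close> \<open>snd y \<in> _\<close> by blast
      then show ?thesis using that[of n] fs(2) by metis
    qed
    have hY: "hmap n q z \<in> topspace (?Y n)" if "z \<in> topspace ?X" for z
      using measurable_space[OF measurable_hmap[OF measurable_hc]] that by simp
    have "t1_space (?Y n)" using nY[of n] unfolding nice_space_def by (simp add: Hausdorff_imp_t1_space)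
    then obtain U where U: "openin (?Y n) U" "hmap n q x \<in> U" "hmap n q y \<notin> U"
      using hY[OF x] hY[OF y] n unfolding t1_space_def by meson
    then obtain V where V: "V \<in> \<B> n" "hmap n q x \<in> V" "V \<subseteq> U" using base by blast
    then obtain k where k: "W n k = V"
      unfolding W_def using from_nat_into_surj[of "insert {} (\<B> n)" V] \<B>(1) by auto
    have "D (prod_encode (n, k)) = hmap n q -` V \<inter> topspace ?X" by (simp add: D_def k)
    then show ?thesis using V U x by (intro exI[of _ "prod_encode (n, k)"]) auto
  qed
  have "sets (borel_of ?X) = sigma_sets (topspace ?X) (range D)"
    by (rule blackwell[OF nice_prod param DB sep])
  also have "\<dots> \<subseteq> sigma_sets (topspace ?X) (\<Union>n. hmap_sets q n)"
    using DG by (intro sigma_sets_mono') blast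
  finally show "sets (borel_of ?X) \<subseteq> sigma_sets (topspace ?X) (\<Union>n. hmap_sets q n)" .
qed

text \<open>For each conditioning event the two measures agree on the events of every finite order,
  an intersection-stable generator of the Borel sets.\<close>

lemma cps_eqI:
  assumes param: "baire_param (prod_topology S (T (other p))) F g"
    and inj: "inj_on (hier S Bs \<beta> (other p)) (topspace (T (other p)))"
    and \<mu>: "\<mu> \<in> cps_set (prod_topology S (T (other p))) (Bs p) c"
    and \<nu>: "\<nu> \<in> cps_set (prod_topology S (T (other p))) (Bs p) c"
    and eq: "\<And>n. cps_image (Bs p) (borel_of (Theta S Bs n p)) (hmap n (other p)) \<mu> =
      cps_image (Bs p) (borel_of (Theta S Bs n p)) (hmap n (other p)) \<nu>"
  shows "\<mu> = \<nu>"
proof (rule PiE_ext)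
  let ?q = "other p" and ?X = "prod_topology S (T (other p))"
  show "\<mu> \<in> Pi\<^sub>E (Bs p) (\<lambda>_. prob_measures ?X)" "\<nu> \<in> Pi\<^sub>E (Bs p) (\<lambda>_. prob_measures ?X)"
    using \<mu> \<nu> by (auto simp: cps_set_def)
  fix B assume B: "B \<in> Bs p"
  note pm = cps_set_prob_measures[OF \<mu> B] cps_set_prob_measures[OF \<nu> B]
  interpret m: prob_space "\<mu> B" by (rule prob_measuresD[OF pm(1)])
  interpret n: prob_space "\<nu> B" by (rule prob_measuresD[OF pm(2)])
  show "\<mu> B = \<nu> B"
  proof (rule measure_eqI_generator_eq[OF hmap_sets_Int_stable[of ?q], where A = "\<lambda>_. topspace ?X"])
    show "(\<Union>n. hmap_sets ?q n) \<subseteq> Pow (topspace ?X)" by (auto simp: hmap_sets_def)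
    show "sets (\<mu> B) = sigma_sets (topspace ?X) (\<Union>n. hmap_sets ?q n)"
      "sets (\<nu> B) = sigma_sets (topspace ?X) (\<Union>n. hmap_sets ?q n)"
      using sigma_hmap_sets[OF param inj] prob_measuresD(2)[OF pm(1)] prob_measuresD(2)[OF pm(2)] by simp_all
    have "topspace ?X = hmap 0 ?q -` topspace (prod_topology S (Hc S Bs 0 ?q)) \<inter> topspace ?X"
      using measurable_space[OF measurable_hmap[OF measurable_hc[of 0 ?q]]] by auto
    then have "topspace ?X \<in> hmap_sets ?q 0"
      unfolding hmap_sets_def using openin_borel_of[OF openin_topspace] by blast
    then show "range (\<lambda>_. topspace ?X) \<subseteq> (\<Union>n. hmap_sets ?q n)" by blast
    fix A assume "A \<in> (\<Union>n. hmap_sets ?q n)"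
    then obtain n E where E: "E \<in> sets (borel_of (Theta S Bs n p))" "A = hmap n ?q -` E \<inter> topspace ?X"
      unfolding hmap_sets_def Theta_def by blast
    have "distr (\<mu> B) (borel_of (Theta S Bs n p)) (hmap n ?q) = distr (\<nu> B) (borel_of (Theta S Bs n p)) (hmap n ?q)"
      using fun_cong[OF eq[of n], of B] B by (simp add: cps_image_def)
    then have "measure (\<mu> B) A = measure (\<nu> B) A"
      using measure_distr_prob_measures[OF pm(1) measurable_hmap[OF measurable_hc], folded Theta_def, OF E(1)]
        measure_distr_prob_measures[OF pm(2) measurable_hmap[OF measurable_hc], folded Theta_def, OF E(1)]
      unfolding E(2) by simp
    then show "emeasure (\<mu> B) A = emeasure (\<nu> B) A"
      by (simp add: m.emeasure_eq_measure n.emeasure_eq_measure)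
  qed (auto simp: m.emeasure_eq_measure)
qed

end

subsection \<open>Adjoining a type with a prescribed belief\<close>

locale belief_extension = cps_type_structure S Bs T \<beta>
  for S :: "'a topology" and Bs :: "player \<Rightarrow> 'a set set"
    and T :: "player \<Rightarrow> 't topology" and \<beta> :: "player \<Rightarrow> 't \<Rightarrow> 'a set \<Rightarrow> ('a \<times> 't) measure" +
  fixes i :: player and \<mu> :: "'a set \<Rightarrow> ('a \<times> 't) measure"
  assumes \<mu>: "\<mu> \<in> cps_set (prod_topology S (T (other i))) (Bs i) (\<lambda>B. B \<times> topspace (T (other i)))"
begin

definition ext_T :: "player \<Rightarrow> 't option topology" where
  "ext_T p = option_topology (p = i) (T p)"

definition belief :: "player \<Rightarrow> 't option \<Rightarrow> 'a set \<Rightarrow> ('a \<times> 't) measure" where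
  "belief p x = (case x of None \<Rightarrow> \<mu> | Some t \<Rightarrow> \<beta> p t)"

definition incl :: "'a \<times> 't \<Rightarrow> 'a \<times> 't option" where
  "incl = (\<lambda>(s, t). (s, Some t))"

text \<open>Old beliefs and \<open>\<mu>\<close> alike are moved along \<open>incl\<close>, so
  nobody assigns positive probability to the new type.\<close>

definition ext_\<beta> :: "player \<Rightarrow> 't option \<Rightarrow> 'a set \<Rightarrow> ('a \<times> 't option) measure" where
  "ext_\<beta> p x = cps_image (Bs p) (borel_of (prod_topology S (ext_T (other p)))) incl (belief p x)"

lemma nice_ext_T: "metrizable_space (T p) \<Longrightarrow> nice_space (ext_T p)"
  unfolding ext_T_def using nice_T[of p]
  by (intro metrizable_second_countable_nice metrizable_option_topology second_countable_option_topology)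
     (auto simp: nice_space_def)

lemma measurable_incl:
  "nice_space (ext_T q) \<Longrightarrow> incl \<in> borel_of (prod_topology S (T q)) \<rightarrow>\<^sub>M borel_of (prod_topology S (ext_T q))"
  unfolding incl_def using nice_T[of q]
  by (intro measurable_pair_map continuous_map_measurable) (auto simp: nice_space_def ext_T_def continuous_map_Some)

lemma incl_cylinder:
  "B \<in> Bs p \<Longrightarrow> incl -` (B \<times> topspace (ext_T q)) \<inter> topspace (prod_topology S (T q)) = B \<times> topspace (T q)"
  using Bs_topspace[of B p] by (auto simp: incl_def ext_T_def)

lemma belief_cps_set: "x \<in> topspace (ext_T p) \<Longrightarrow>
    belief p x \<in> cps_set (prod_topology S (T (other p))) (Bs p) (\<lambda>B. B \<times> topspace (T (other p)))"
  using \<beta>_cps_set \<mu> by (auto simp: ext_T_def belief_def split: if_splits)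

lemma measurable_ext_\<beta>:
  assumes n: "\<And>q. nice_space (ext_T q)"
  shows "ext_\<beta> p \<in> borel_of (ext_T p) \<rightarrow>\<^sub>M
    borel_of (cps_top (prod_topology S (ext_T (other p))) (Bs p) (\<lambda>B. B \<times> topspace (ext_T (other p))))"
  unfolding ext_T_def[of p]
proof (rule measurable_option_topology)
  have "cps_image (Bs p) (borel_of (prod_topology S (ext_T (other p)))) incl \<in>
    borel_of (cps_top (prod_topology S (T (other p))) (Bs p) (\<lambda>B. B \<times> topspace (T (other p)))) \<rightarrow>\<^sub>M
    borel_of (cps_top (prod_topology S (ext_T (other p))) (Bs p) (\<lambda>B. B \<times> topspace (ext_T (other p))))"
    by (intro measurable_cps_image nice_prod nice_space_prod_topology[OF nice_S n] countable_Bs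
        measurable_incl n incl_cylinder cylinder_borel)
  from measurable_compose[OF measurable_\<beta> this]
  show "(\<lambda>x. ext_\<beta> p (Some x)) \<in> borel_of (T p) \<rightarrow>\<^sub>M
    borel_of (cps_top (prod_topology S (ext_T (other p))) (Bs p) (\<lambda>B. B \<times> topspace (ext_T (other p))))"
    by (simp add: ext_\<beta>_def belief_def)
  assume "p = i"
  then have "None \<in> topspace (ext_T p)" by (simp add: ext_T_def)
  from cps_image_in_cps_set[OF measurable_incl[OF n] incl_cylinder cylinder_borel belief_cps_set[OF this]]
  show "ext_\<beta> p None \<in> space (borel_of (cps_top (prod_topology S (ext_T (other p))) (Bs p) (\<lambda>B. B \<times> topspace (ext_T (other p)))))"
    unfolding ext_\<beta>_def by simp
qed

text \<open>\<open>incl\<close> followed by the new \<open>hmap\<close> is the old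
  \<open>hmap\<close> as soon as the opponent's codes on old types are unchanged; every order can
  then be computed from the belief before it was moved.\<close>

lemma hier_extension:
  assumes n: "\<And>q. nice_space (ext_T q)"
  shows "hier S Bs ext_\<beta> i None =
    (cps_image (Bs i) (borel_of S) fst \<mu>, \<lambda>n. cps_image (Bs i) (borel_of (Theta S Bs n i)) (hmap n (other i)) \<mu>)"
proof -
  interpret E: cps_type_structure S Bs ext_T ext_\<beta>
    by unfold_locales (use n measurable_ext_\<beta>[OF n] in auto)
  have fst_image: "cps_image (Bs p) (borel_of S) fst (ext_\<beta> p x) = cps_image (Bs p) (borel_of S) fst (belief p x)"
    if "x \<in> topspace (ext_T p)" for p x
    unfolding ext_\<beta>_def
    by (rule cps_image_cps_image[OF measurable_incl[OF n] _ _ belief_cps_set[OF that]])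
       (auto simp: incl_def intro!: continuous_map_measurable continuous_map_fst)
  \<comment> \<open>Kept conditional on the opponent's codes, so that it serves both in the
    induction for \<open>hc_Some\<close> and, once that is proved, for the new type.\<close>
  have level: "E.level n p x = cps_image (Bs p) (borel_of (Theta S Bs n p)) (hmap n (other p)) (belief p x)"
    if x: "x \<in> topspace (ext_T p)" and IH: "\<And>t. t \<in> topspace (T (other p)) \<Longrightarrow> E.hc n (other p) (Some t) = hc n (other p) t"
    for n p x
    unfolding E.level_def ext_\<beta>_def[of p x] Theta_def
    by (rule cps_image_cps_image[OF measurable_incl[OF n] E.measurable_hmap[OF E.measurable_hc] _ belief_cps_set[OF x]])
       (use IH in \<open>auto simp: incl_def hmap_def E.hmap_def simp del: hcode.simps\<close>)
  have hc_Some: "E.hc n p (Some t) = hc n p t" if "t \<in> topspace (T p)" for n p t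
    using that
  proof (induction n arbitrary: p t)
    case 0
    then have "Some t \<in> topspace (ext_T p)" by (auto simp: ext_T_def)
    then show ?case unfolding hc_0 E.hc_0 by (simp add: fst_image belief_def)
  next
    case (Suc n)
    then have "Some t \<in> topspace (ext_T p)" by (auto simp: ext_T_def)
    from level[OF this Suc.IH] have "E.level n p (Some t) = level n p t"
      by (simp add: belief_def level_def del: hcode.simps)
    then show ?case unfolding hc_Suc E.hc_Suc using Suc by (simp del: hcode.simps)
  qed
  have "None \<in> topspace (ext_T i)" by (simp add: ext_T_def)
  then show ?thesis
    unfolding E.hier_eq using fst_image level[OF _ hc_Some] by (simp add: belief_def del: hcode.simps)
qed

end

theorem theorem2:
  fixes S :: "'a topology"
    and Bs :: "player \<Rightarrow> 'a set set"
    and T :: "player \<Rightarrow> 't topology"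
    and \<beta> :: "player \<Rightarrow> 't \<Rightarrow> 'a set \<Rightarrow> ('a \<times> 't) measure"
  assumes S_metrizable: "metrizable_space S"
    and S_souslin: "souslin_space S"
    and Bs_countable: "\<And>p. countable (Bs p)"
    and Bs_borel: "\<And>p. Bs p \<subseteq> sets (borel_of S) - {{}}"
    and ts: "type_structure S Bs T \<beta>"
    and souslin: "souslin_structure T"
    and nonred: "non_redundant S Bs T \<beta>"
    and terminal_T: "terminal S Bs T \<beta>"
  shows "complete_structure S Bs T \<beta>"
proof -
  have metrT: "metrizable_space (T p)" for p using ts by (simp add: type_structure_def)
  have soT: "souslin_space (T p)" for p using souslin by (simp add: souslin_structure_def)
  interpret cps_type_structure S Bs T \<beta>
  proof
    show "nice_space S" by (rule souslin_metrizable_nice[OF S_metrizable S_souslin])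
    show "nice_space (T p)" for p by (rule souslin_metrizable_nice[OF metrT soT])
    show "Bs p \<subseteq> sets (borel_of S)" for p using Bs_borel by blast
    show "countable (Bs p)" for p by (rule Bs_countable)
    show "\<beta> p \<in> borel_of (T p) \<rightarrow>\<^sub>M
       borel_of (cps_top (prod_topology S (T (other p))) (Bs p) (\<lambda>B. B \<times> topspace (T (other p))))" for p
      using ts by (simp add: type_structure_def)
  qed
  have "\<exists>t\<in>topspace (T p). \<beta> p t = \<mu>"
    if \<mu>: "\<mu> \<in> cps_set (prod_topology S (T (other p))) (Bs p) (\<lambda>B. B \<times> topspace (T (other p)))" for p \<mu>
  proof -
    interpret X: belief_extension S Bs T \<beta> p \<mu> by unfold_locales (rule \<mu>)
    have n: "nice_space (X.ext_T q)" for q by (rule X.nice_ext_T[OF metrT])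
    have "type_structure S Bs X.ext_T X.ext_\<beta>"
      unfolding type_structure_def using X.measurable_ext_\<beta>[OF n]
      by (simp add: X.ext_T_def metrizable_option_topology[OF metrT])
    moreover have "None \<in> topspace (X.ext_T p)" by (simp add: X.ext_T_def)
    ultimately obtain t where t: "t \<in> topspace (T p)" "hier S Bs X.ext_\<beta> p None = hier S Bs \<beta> p t"
      using terminal_T unfolding terminal_def by blast
    then have eq: "level n p t = cps_image (Bs p) (borel_of (Theta S Bs n p)) (hmap n (other p)) \<mu>" for n
      unfolding X.hier_extension[OF n] hier_eq by (simp add: fun_eq_iff)
    \<comment> \<open>The Souslin hypotheses enter again here: beyond separability they supply codes
      for both factors of the product, as Blackwell's theorem demands.\<close>
    obtain F g where "baire_param S F g" using souslin_baire_param[OF S_souslin] by blast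
    moreover obtain G h where "baire_param (T (other p)) G h" using souslin_baire_param[OF soT] by blast
    ultimately obtain H k where param: "baire_param (prod_topology S (T (other p))) H k"
      using baire_param_prod by blast
    have "\<beta> p t = \<mu>"
    proof (rule cps_eqI[OF param _ \<beta>_cps_set[OF t(1)] \<mu>])
      show "inj_on (hier S Bs \<beta> (other p)) (topspace (T (other p)))" using nonred by (simp add: non_redundant_def)
    qed (use eq in \<open>simp add: level_def\<close>)
    then show ?thesis using t(1) by blast
  qed
  then show ?thesis
    unfolding complete_structure_def using \<beta>_cps_set by blast
qed

end
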